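(* Let $A$ be a finite dimensional non-nilpotent $T$-graded associative algebra over an algebraically closed field $F$ of characteristic $0$ for some semigroup $T$. Suppose that the Jacobson radical $J:=J(A)$ is a graded ideal. Let $$A/J = B_1 \oplus \ldots \oplus B_q \text{ (direct sum of graded ideals)}$$ where $B_i$ are graded-simple algebras, and let $\varkappa \colon A/J \to A$ be any homomorphism of algebras (not necessarily graded) such that $\pi\varkappa = \mathrm{id}_{A/J}$, where $\pi \colon A \to A/J$ is the natural projection. Then there exist constants $C_1, C_2 > 0$, $r_1, r_2 \in \mathbb R$ such that $C_1 n^{r_1} d^n \leqslant c^{T\text{-}\mathrm{gr}}_n(A) \leqslant C_2 n^{r_2} d^n$ for all $n \in \mathbb N$, where $d$ is the maximum of $\dim\left( B_{i_1}\oplus B_{i_2} \oplus \ldots \oplus B_{i_r}\right)$ over all $r\geqslant 1$ and all indices $i_1,\dots,i_r$ such that $$((FT)^*\varkappa(B_{i_1}))A^+ \,((FT)^*\varkappa(B_{i_2})) A^+ \ldots ((FT)^*\varkappa(B_{i_{r-1}})) A^+\,((FT)^*\varkappa(B_{i_r}))\ne 0,$$ and $A^+:=A+F\cdot 1$.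
   Context: For a semigroup $T$, an algebra $A$ is $T$-graded if $A=\bigoplus_{t\in T}A^{(t)}$ (direct sum of subspaces) with $A^{(h)}A^{(t)}\subseteq A^{(ht)}$ for all $h,t\in T$. A subspace $V$ of $A$ is graded if $V=\bigoplus_{t\in T}V\cap A^{(t)}$; a quotient by a graded ideal carries the induced grading. A $T$-graded algebra $B$ is graded-simple if $B^2\ne 0$ and $B$ has no graded two-sided ideals other than $B$ and $0$. In the definition of $d$ the indices $i_1,\dots,i_r$ are understood to be pairwise distinct (the sum $B_{i_1}\oplus\ldots\oplus B_{i_r}$ is direct in $A/J$). $(FT)^*$ is the dual of the semigroup algebra $FT$, i.e. the algebra of all functions $T\to F$ with pointwise multiplication; it acts on $A$ by $h a=h(t)a$ for $h\in(FT)^*$, $a\in A^{(t)}$, $t\in T$. For a subspace $V\subseteq A$, $(FT)^*V$ denotes the linear span of all $hv$, $h\in (FT)^*$, $v\in V$. Graded codimensions: let $F\langle X^{T\text{-}\mathrm{gr}}\rangle$ be the free associative algebra (non-commutative polynomials) on the variables $x^{(t)}_i$, $t\in T$, $i\in\mathbb N$. A polynomial $f(x^{(t_1)}_{i_1},\dots,x^{(t_s)}_{i_s})$ is a graded polynomial identity of $A$ if it vanishes whenever each $x^{(t_j)}_{i_j}$ is replaced by an arbitrary element of $A^{(t_j)}$; the set of all of them is the ideal $\mathrm{Id}^{T\text{-}\mathrm{gr}}(A)$. Let $P^{T\text{-}\mathrm{gr}}_n$ be the $F$-linear span of all monomials $x^{(t_1)}_{\sigma(1)}x^{(t_2)}_{\sigma(2)}\cdots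 x^{(t_n)}_{\sigma(n)}$ with $t_i\in T$, $\sigma\in S_n$. The $n$th graded codimension is $c^{T\text{-}\mathrm{gr}}_n(A)=\dim_F\bigl(P^{T\text{-}\mathrm{gr}}_n/(P^{T\text{-}\mathrm{gr}}_n\cap \mathrm{Id}^{T\text{-}\mathrm{gr}}(A))\bigr)$. *)

theory Defs
  imports
    Complex_Main
    "HOL-Computational_Algebra.Polynomial"
    "HOL-Combinatorics.Permutations"
    "HOL-Library.Poly_Mapping"
begin

section \<open>Associative algebras\<close>

text \<open>Algebras need not have a unit; associativity is part of the class \<open>ring\<close>.\<close>

locale assoc_algebra = vector_space scale
  for scale :: "'f::field \<Rightarrow> 'a::ring \<Rightarrow> 'a" +
  assumes scale_mult_left: "scale c x * y = scale c (x * y)"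
    and scale_mult_right: "x * scale c y = scale c (x * y)"

definition fin_dim :: "('f::field \<Rightarrow> 'v::ab_group_add \<Rightarrow> 'v) \<Rightarrow> bool" where
  "fin_dim scale \<longleftrightarrow> (\<exists>Basis. finite_dimensional_vector_space scale Basis)"

definition algebra_hom ::
  "('f::field \<Rightarrow> 'a::ring \<Rightarrow> 'a) \<Rightarrow> ('f \<Rightarrow> 'b::ring \<Rightarrow> 'b) \<Rightarrow> ('a \<Rightarrow> 'b) \<Rightarrow> bool" where
  "algebra_hom s1 s2 f \<longleftrightarrow>
     Vector_Spaces.linear s1 s2 f \<and> (\<forall>x y. f (x * y) = f x * f y)"

definition space_prod ::
  "('f::field \<Rightarrow> 'a::ring \<Rightarrow> 'a) \<Rightarrow> 'a set \<Rightarrow> 'a set \<Rightarrow> 'a set" where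
  "space_prod scale V W = module.span scale {v * w | v w. v \<in> V \<and> w \<in> W}"

text \<open>\<open>space_power scale n\<close> is the power \<open>A\<^sup>n\<^sup>+\<^sup>1\<close> of the algebra.\<close>

primrec space_power :: "('f::field \<Rightarrow> 'a::ring \<Rightarrow> 'a) \<Rightarrow> nat \<Rightarrow> 'a set" where
  "space_power scale 0 = UNIV"
| "space_power scale (Suc n) = space_prod scale UNIV (space_power scale n)"

definition nilpotent_algebra :: "('f::field \<Rightarrow> 'a::ring \<Rightarrow> 'a) \<Rightarrow> bool" where
  "nilpotent_algebra scale \<longleftrightarrow> (\<exists>n. space_power scale n = {0})"

definition left_ideal :: "('f::field \<Rightarrow> 'a::ring \<Rightarrow> 'a) \<Rightarrow> 'a set \<Rightarrow> bool" where
  "left_ideal scale L \<longleftrightarrow> module.subspace scale L \<and> (\<forall>a. \<forall>x\<in>L. a * x \<in> L)"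

definition maximal_left_ideal :: "('f::field \<Rightarrow> 'a::ring \<Rightarrow> 'a) \<Rightarrow> 'a set \<Rightarrow> bool" where
  "maximal_left_ideal scale L \<longleftrightarrow>
     left_ideal scale L \<and> L \<noteq> UNIV \<and>
     (\<forall>L'. left_ideal scale L' \<and> L \<subseteq> L' \<longrightarrow> L' = L \<or> L' = UNIV)"

definition modular_left_ideal :: "'a::ring set \<Rightarrow> bool" where
  "modular_left_ideal L \<longleftrightarrow> (\<exists>e. \<forall>a. a - a * e \<in> L)"

text \<open>
  The Jacobson radical of a not necessarily unital algebra: the intersection of all modular
  (also called regular) maximal left ideals, and the whole algebra if there are none.
\<close>

definition jacobson_radical :: "('f::field \<Rightarrow> 'a::ring \<Rightarrow> 'a) \<Rightarrow> 'a set" where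
  "jacobson_radical scale =
     \<Inter> {L. maximal_left_ideal scale L \<and> modular_left_ideal L}"


section \<open>Direct sums and gradings\<close>

definition is_decomposition ::
  "'i set \<Rightarrow> ('i \<Rightarrow> 'v::ab_group_add set) \<Rightarrow> 'v \<Rightarrow> ('i \<Rightarrow> 'v) \<Rightarrow> bool" where
  "is_decomposition I V w f \<longleftrightarrow>
     (\<forall>i\<in>I. f i \<in> V i) \<and> (\<forall>i. i \<notin> I \<longrightarrow> f i = 0) \<and>
     finite {i. f i \<noteq> 0} \<and> w = (\<Sum>i | f i \<noteq> 0. f i)"

text \<open>Internal direct sum \<open>W = \<Oplus>i\<in>I. V i\<close>, meant for subspaces \<open>W\<close> and \<open>V i\<close>.\<close>

definition direct_sum :: "'i set \<Rightarrow> ('i \<Rightarrow> 'v::ab_group_add set) \<Rightarrow> 'v set \<Rightarrow> bool" where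
  "direct_sum I V W \<longleftrightarrow>
     (\<forall>i\<in>I. V i \<subseteq> W) \<and> (\<forall>w\<in>W. \<exists>!f. is_decomposition I V w f)"

definition is_grading ::
  "('f::field \<Rightarrow> 'a::ring \<Rightarrow> 'a) \<Rightarrow> ('t::semigroup_mult \<Rightarrow> 'a set) \<Rightarrow> bool" where
  "is_grading scale G \<longleftrightarrow>
     (\<forall>t. module.subspace scale (G t)) \<and> direct_sum UNIV G UNIV \<and>
     (\<forall>h t. \<forall>x\<in>G h. \<forall>y\<in>G t. x * y \<in> G (h * t))"

definition graded_subspace ::
  "('f::field \<Rightarrow> 'a::ring \<Rightarrow> 'a) \<Rightarrow> ('t::semigroup_mult \<Rightarrow> 'a set) \<Rightarrow> 'a set \<Rightarrow> bool" where
  "graded_subspace scale G V \<longleftrightarrow>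
     module.subspace scale V \<and> direct_sum UNIV (\<lambda>t. V \<inter> G t) V"

text \<open>\<open>I\<close> is a graded two-sided ideal of the graded subalgebra \<open>R\<close>.\<close>

definition graded_ideal_of ::
  "('f::field \<Rightarrow> 'a::ring \<Rightarrow> 'a) \<Rightarrow> ('t::semigroup_mult \<Rightarrow> 'a set) \<Rightarrow> 'a set \<Rightarrow> 'a set \<Rightarrow> bool" where
  "graded_ideal_of scale G R I \<longleftrightarrow>
     I \<subseteq> R \<and> graded_subspace scale G I \<and> (\<forall>b\<in>R. \<forall>x\<in>I. b * x \<in> I \<and> x * b \<in> I)"

text \<open>
  A graded subalgebra \<open>R\<close>, with grading \<open>R \<inter> G t\<close>, is graded-simple as an algebra in its own
  right; note that the ideals are those of \<open>R\<close> and not of the ambient algebra.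
\<close>

definition graded_simple ::
  "('f::field \<Rightarrow> 'a::ring \<Rightarrow> 'a) \<Rightarrow> ('t::semigroup_mult \<Rightarrow> 'a set) \<Rightarrow> 'a set \<Rightarrow> bool" where
  "graded_simple scale G R \<longleftrightarrow>
     (\<exists>x\<in>R. \<exists>y\<in>R. x * y \<noteq> 0) \<and>
     (\<forall>I. graded_ideal_of scale G R I \<longrightarrow> I = {0} \<or> I = R)"


section \<open>The action of the dual of the semigroup algebra\<close>

definition hom_component :: "('t \<Rightarrow> 'a::ab_group_add set) \<Rightarrow> 'a \<Rightarrow> 't \<Rightarrow> 'a" where
  "hom_component G a = (THE f. is_decomposition UNIV G a f)"

text \<open>
  A function \<open>h\<close> on \<open>T\<close> multiplies the component of degree \<open>t\<close> by \<open>h t\<close>.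
\<close>

definition dual_act ::
  "('f::field \<Rightarrow> 'a::ab_group_add \<Rightarrow> 'a) \<Rightarrow> ('t \<Rightarrow> 'a set) \<Rightarrow> ('t \<Rightarrow> 'f) \<Rightarrow> 'a \<Rightarrow> 'a" where
  "dual_act scale G h a =
     (\<Sum>t | hom_component G a t \<noteq> 0. scale (h t) (hom_component G a t))"

definition dual_span ::
  "('f::field \<Rightarrow> 'a::ab_group_add \<Rightarrow> 'a) \<Rightarrow> ('t \<Rightarrow> 'a set) \<Rightarrow> 'a set \<Rightarrow> 'a set" where
  "dual_span scale G V = module.span scale {dual_act scale G h v | h v. v \<in> V}"


section \<open>The exponent\<close>

text \<open>
  \<open>V A\<^sup>+\<close> for \<open>A\<^sup>+ = A + F\<cdot>1\<close>: the product of \<open>v\<close> and \<open>a + c\<cdot>1\<close> is \<open>v a + c v\<close>.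
\<close>

definition times_plus :: "('f::field \<Rightarrow> 'a::ring \<Rightarrow> 'a) \<Rightarrow> 'a set \<Rightarrow> 'a set" where
  "times_plus scale V = module.span scale {v * a + scale c v | v a c. v \<in> V}"

text \<open>\<open>chain_prod scale [W\<^sub>1, \<dots>, W\<^sub>r] = W\<^sub>1 A\<^sup>+ W\<^sub>2 A\<^sup>+ \<dots> A\<^sup>+ W\<^sub>r\<close>; only used for \<open>r \<ge> 1\<close>.\<close>

fun chain_prod :: "('f::field \<Rightarrow> 'a::ring \<Rightarrow> 'a) \<Rightarrow> 'a set list \<Rightarrow> 'a set" where
  "chain_prod scale [] = {0}"
| "chain_prod scale [W] = W"
| "chain_prod scale (W # W' # Ws) =
     space_prod scale (times_plus scale W) (chain_prod scale (W' # Ws))"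

text \<open>
  Here \<open>sA\<close> and \<open>sQ\<close> are the scalar multiplications of \<open>A\<close> and of \<open>A/J\<close>, and the components
  \<open>B 1, \<dots>, B q\<close> are subspaces of \<open>A/J\<close>.
\<close>

definition graded_exponent ::
  "('f::field \<Rightarrow> 'a::ring \<Rightarrow> 'a) \<Rightarrow> ('f \<Rightarrow> 'q::ring \<Rightarrow> 'q) \<Rightarrow> ('t \<Rightarrow> 'a set) \<Rightarrow>
   ('q \<Rightarrow> 'a) \<Rightarrow> nat \<Rightarrow> (nat \<Rightarrow> 'q set) \<Rightarrow> nat" where
  "graded_exponent sA sQ G \<kappa> q B =
     Max {vector_space.dim sQ (module.span sQ (\<Union>i\<in>set is. B i)) | is.
            is \<noteq> [] \<and> distinct is \<and> set is \<subseteq> {1..q} \<and>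
            chain_prod sA (map (\<lambda>i. dual_span sA G (\<kappa> ` B i)) is) \<noteq> {0}}"


section \<open>Graded polynomial identities and codimensions\<close>

text \<open>
  The variable \<open>x\<^sub>i\<close> of degree \<open>t\<close> is the pair \<open>(t, i)\<close>, a monomial is a word in these
  variables, and a non-commutative polynomial is a finitely supported function on words.
\<close>

type_synonym ('t, 'f) gr_poly = "('t \<times> nat) list \<Rightarrow>\<^sub>0 'f"

definition poly_scale :: "'f::field \<Rightarrow> ('w \<Rightarrow>\<^sub>0 'f) \<Rightarrow> ('w \<Rightarrow>\<^sub>0 'f)" where
  "poly_scale c p = Poly_Mapping.map ((*) c) p"

lemma lookup_poly_scale [simp]: "Poly_Mapping.lookup (poly_scale c p) w = c * Poly_Mapping.lookup p w"
  by (simp add: poly_scale_def Poly_Mapping.map.rep_eq when_def)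

lemma vector_space_poly_scale: "vector_space (poly_scale :: 'f::field \<Rightarrow> ('w \<Rightarrow>\<^sub>0 'f) \<Rightarrow> _)"
  by unfold_locales (auto intro!: poly_mapping_eqI simp: lookup_add algebra_simps)

text \<open>Product of a non-empty list; the value on the empty list is never used.\<close>

fun list_mult :: "'a::ring list \<Rightarrow> 'a" where
  "list_mult [] = 0"
| "list_mult [x] = x"
| "list_mult (x # y # zs) = x * list_mult (y # zs)"

definition gr_eval ::
  "('f::field \<Rightarrow> 'a::ring \<Rightarrow> 'a) \<Rightarrow> ('t \<times> nat \<Rightarrow> 'a) \<Rightarrow> ('t, 'f) gr_poly \<Rightarrow> 'a" where
  "gr_eval scale s p = (\<Sum>w\<in>Poly_Mapping.keys p. scale (Poly_Mapping.lookup p w) (list_mult (map s w)))"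

text \<open>
  Since the algebra need not be unital, polynomials have no constant term, that is, the empty
  word does not occur.
\<close>

definition gr_identities ::
  "('f::field \<Rightarrow> 'a::ring \<Rightarrow> 'a) \<Rightarrow> ('t \<Rightarrow> 'a set) \<Rightarrow> ('t, 'f) gr_poly set" where
  "gr_identities scale G =
     {p. [] \<notin> Poly_Mapping.keys p \<and> (\<forall>s. (\<forall>t i. s (t, i) \<in> G t) \<longrightarrow> gr_eval scale s p = 0)}"

definition gr_multilinear :: "nat \<Rightarrow> ('t, 'f::field) gr_poly set" where
  "gr_multilinear n = module.span poly_scale
     {Poly_Mapping.single (map (\<lambda>j. (t j, \<sigma> j)) [1..<Suc n]) 1 | t \<sigma>. \<sigma> permutes {1..n}}"

text \<open>
  \<open>S\<close> is a system of representatives of a basis of \<open>V/W\<close>, for subspaces \<open>W \<subseteq> V\<close>: the cosets of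
  its elements span \<open>V/W\<close>, and they are linearly independent (and pairwise distinct).
  As for \<open>dim\<close> in the library, the dimension of \<open>V/W\<close> is \<open>0\<close> by convention if it is infinite.
\<close>

definition quotient_basis ::
  "('f::field \<Rightarrow> 'v::ab_group_add \<Rightarrow> 'v) \<Rightarrow> 'v set \<Rightarrow> 'v set \<Rightarrow> 'v set \<Rightarrow> bool" where
  "quotient_basis scale V W S \<longleftrightarrow>
     S \<subseteq> V \<and>
     (\<forall>v\<in>V. \<exists>u\<in>module.span scale S. v - u \<in> W) \<and>
     (\<forall>S' c. finite S' \<and> S' \<subseteq> S \<and> (\<Sum>s\<in>S'. scale (c s) s) \<in> W \<longrightarrow> (\<forall>s\<in>S'. c s = 0))"

definition quotient_dim ::
  "('f::field \<Rightarrow> 'v::ab_group_add \<Rightarrow> 'v) \<Rightarrow> 'v set \<Rightarrow> 'v set \<Rightarrow> nat" where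
  "quotient_dim scale V W = card (SOME S. quotient_basis scale V W S)"

definition gr_codim ::
  "('f::field \<Rightarrow> 'a::ring \<Rightarrow> 'a) \<Rightarrow> ('t \<Rightarrow> 'a set) \<Rightarrow> nat \<Rightarrow> nat" where
  "gr_codim scale G n =
     quotient_dim poly_scale (gr_multilinear n) (gr_multilinear n \<inter> gr_identities scale G)"

end

theory Submission
  imports Defs
begin

text \<open>
  Upper bound: with \<open>A = \<kappa>(A/J) + J\<close> and a basis adapted to this decomposition and to the \<open>B i\<close>, a
  product of basis components that does not vanish has boundedly many factors in \<open>J\<close>, and the
  \<open>B i\<close> of its other factors occur in one of the products defining \<open>d\<close>. So a multilinear polynomial
  of degree \<open>n\<close> is determined by its values on polynomially many times \<open>d\<^sup>n\<close> tuples of basis elements.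

  Lower bound: in a nonvanishing product \<open>W\<^sub>1 A\<^sup>+ \<dots> A\<^sup>+ W\<^sub>r\<close> with as many factors from \<open>J\<close> as
  possible, the elements inserted at the \<open>W\<^sub>i\<close> matter only through their images in \<open>B\<^sub>i\<close>. As the
  graded multiplication operators of \<open>B\<^sub>i\<close> span its endomorphisms (Burnside), some graded multilinear
  polynomial takes the values \<open>det(u) a0\<close> on \<open>\<oplus> B\<^sub>i\<close>, where \<open>a0 \<noteq> 0\<close>. Letting left multiplication by
  \<open>y y'\<close> act as a derivation multiplies it by the trace form \<open>\<langle>y, y'\<rangle>\<close> (Razmyslov), so with boundedly
  many constants all functions \<open>\<Prod>i\<le>m. \<langle>x i, x (m + \<sigma> i)\<rangle>\<close>, for permutations \<open>\<sigma>\<close>, are realized.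
  In dual bases they are incidence vectors whose Gram matrix \<open>K\<close> has trace \<open>m! d\<^sup>m\<close>, and
  \<open>(tr K)\<^sup>2 \<le> rank K \<cdot> tr K\<^sup>2\<close> with Burnside's lemma shows that \<open>d\<^sup>2\<^sup>m\<close> divided by a polynomial in \<open>m\<close>
  many of them are linearly independent.
\<close>

section \<open>The Jacobson radical\<close>

text \<open>The obstacle is that \<open>\<kappa>\<close> need not respect the grading, so the lift
  of \<open>B i\<close> need not be a graded subspace. What helps is that \<open>J\<close> is
  graded: modulo \<open>J\<close>, taking components commutes with \<open>\<pi>\<close>, and every
  discrepancy between \<open>\<kappa>\<close> and the grading lies in \<open>J\<close>. This is the
  reason for taking as many radical factors as possible: a discrepancy would add one more and make
  the product vanish. About \<open>A/J\<close> itself only trace forms are needed: as it has no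
  nonzero nil left ideals, the form \<open>tr(L_a L_b)\<close> is nondegenerate in characteristic 0,
  which gives both a unit and dual bases. Algebraic closure provides the eigenvalue in the proof of
  Burnside's theorem. Every constant in a function costs an extra variable and a factor
  \<open>dim A\<close>, so the number of constants must not grow with \<open>n\<close>; derivations
  by products of two variables create trace factors without any. The exponents obtained are
  \<open>r1 = - d\<^sup>2\<close>, from counting contents of colourings by pairs of basis elements,
  and \<open>r2 = p\<close>, where the \<open>p\<close>-th power of \<open>J\<close> is
  zero.\<close>

locale fd_algebra = assoc_algebra scale + finite_dimensional_vector_space scale Basis
  for scale :: "'f::field \<Rightarrow> 'a::ring \<Rightarrow> 'a" and Basis :: "'a set"
begin

abbreviation "J \<equiv> jacobson_radical scale"

lemma linear_mult_left: "Vector_Spaces.linear scale scale (\<lambda>x. a * x)"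
  by unfold_locales (auto simp: distrib_left scale_mult_right)

lemma linear_mult_right: "Vector_Spaces.linear scale scale (\<lambda>x. x * a)"
  by unfold_locales (auto simp: distrib_right scale_mult_left)

lemma space_prod_subset:
  assumes "subspace S" "\<And>v w. v \<in> V \<Longrightarrow> w \<in> W \<Longrightarrow> v * w \<in> S"
  shows "space_prod scale V W \<subseteq> S"
  unfolding space_prod_def using assms by (intro span_minimal) auto

lemma space_prodI: "v \<in> V \<Longrightarrow> w \<in> W \<Longrightarrow> v * w \<in> space_prod scale V W"
  unfolding space_prod_def by (rule span_base) auto

lemma subspace_space_prod: "subspace (space_prod scale V W)"
  unfolding space_prod_def by (rule subspace_span)

lemma left_ideal_J: "left_ideal scale J"
proof -
  have "subspace J"
    unfolding jacobson_radical_def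
    by (rule subspace_Inter) (auto simp: maximal_left_ideal_def left_ideal_def)
  then show ?thesis
    by (auto simp: left_ideal_def jacobson_radical_def maximal_left_ideal_def)
qed

lemma J_left: "x \<in> J \<Longrightarrow> a * x \<in> J"
  and subspace_J: "subspace J"
  using left_ideal_J by (auto simp: left_ideal_def)

text \<open>Dimensions are bounded, so a subspace with \<open>P\<close> of largest dimension above
  \<open>L0\<close> does it. The property \<open>P\<close> is left open because maximal left ideals
  are wanted both in the whole algebra and inside a given left ideal.\<close>

lemma ex_maximal_left_ideal:
  assumes P: "P L0" and PI: "\<And>L. P L \<Longrightarrow> subspace L"
  obtains L where "P L" "L0 \<subseteq> L" "\<And>L'. P L' \<Longrightarrow> L \<subseteq> L' \<Longrightarrow> L' = L"
proof -
  define S where "S = {dim L | L. P L \<and> L0 \<subseteq> L}"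
  have fin: "finite S"
    unfolding S_def by (rule finite_subset[of _ "{..dim UNIV}"]) (auto intro!: dim_subset[OF subset_UNIV] simp del: dim_UNIV)
  have "dim L0 \<in> S" using P by (auto simp: S_def)
  then have "Max S \<in> S" using fin by (intro Max_in) auto
  then obtain L where L: "P L" "L0 \<subseteq> L" "dim L = Max S" by (auto simp: S_def)
  have "L' = L" if "P L'" "L \<subseteq> L'" for L'
  proof -
    have "dim L' \<in> S" using that L by (auto simp: S_def)
    then have "dim L' \<le> dim L" using fin L by simp
    then show ?thesis using subspace_dim_equal[of L L'] that L PI by auto
  qed
  with L that show thesis by blast
qed

lemma left_ideal_subset_maximal:
  assumes "left_ideal scale L" "L \<noteq> UNIV"
  obtains L' where "maximal_left_ideal scale L'" "L \<subseteq> L'"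
proof -
  define P where "P = (\<lambda>L. left_ideal scale L \<and> L \<noteq> UNIV)"
  have "P L" using assms by (simp add: P_def)
  moreover have "subspace L" if "P L" for L using that by (simp add: P_def left_ideal_def)
  ultimately obtain L' where L': "P L'" "L \<subseteq> L'" "\<And>K. P K \<Longrightarrow> L' \<subseteq> K \<Longrightarrow> K = L'"
    by (rule ex_maximal_left_ideal) auto
  have "maximal_left_ideal scale L'"
    unfolding maximal_left_ideal_def
  proof (intro conjI allI impI)
    fix K assume K: "left_ideal scale K \<and> L' \<subseteq> K"
    show "K = L' \<or> K = UNIV"
    proof (cases "K = UNIV")
      case False
      then show ?thesis using K L'(3)[of K] unfolding P_def by blast
    qed blast
  qed (use L'(1) in \<open>auto simp: P_def\<close>)
  with L' that show thesis by blast
qed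

text \<open>The left ideal of all \<open>a - a * x\<close> is modular, with \<open>x\<close> as
  right unit modulo it. If it were proper, a maximal left ideal above it would be modular and hence
  contain \<open>x\<close>; then it would contain every
  \<open>a = (a - a * x) + a * x\<close>.\<close>

lemma J_quasi_regular:
  assumes "x \<in> J" shows "\<exists>a. x = a - a * x"
proof -
  define L where "L = range (\<lambda>a. a - a * x)"
  have lin: "Vector_Spaces.linear scale scale (\<lambda>a. a - a * x)"
    by unfold_locales (auto simp: algebra_simps scale_mult_left)
  have sub: "subspace L"
  proof -
    interpret l: Vector_Spaces.linear scale scale "\<lambda>a. a - a * x" by (rule lin)
    show ?thesis unfolding L_def by (rule l.subspace_image) simp
  qed
  have li: "left_ideal scale L"
    unfolding left_ideal_def
  proof (intro conjI allI ballI sub)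
    fix b y assume "y \<in> L"
    then obtain a where "y = a - a * x" by (auto simp: L_def)
    then have "b * y = (b * a) - (b * a) * x" by (simp add: right_diff_distrib mult.assoc)
    then show "b * y \<in> L" by (auto simp: L_def)
  qed
  have "L = UNIV"
  proof (rule ccontr)
    assume "L \<noteq> UNIV"
    then obtain L' where L': "maximal_left_ideal scale L'" "L \<subseteq> L'"
      using left_ideal_subset_maximal li by blast
    then have *: "subspace L'" "\<And>a y. y \<in> L' \<Longrightarrow> a * y \<in> L'" "L' \<noteq> UNIV"
      by (auto simp: maximal_left_ideal_def left_ideal_def)
    have "modular_left_ideal L'"
      unfolding modular_left_ideal_def using L' by (intro exI[of _ x]) (auto simp: L_def)
    with L' have "x \<in> L'" using assms by (auto simp: jacobson_radical_def)
    have "a \<in> L'" for a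
    proof -
      have "a - a * x \<in> L'" using L' by (auto simp: L_def)
      from subspace_add[OF *(1) this *(2)[OF \<open>x \<in> L'\<close>, of a]] show ?thesis by simp
    qed
    with * show False by auto
  qed
  then have "x \<in> L" by simp
  then show ?thesis unfolding L_def by blast
qed

text \<open>The powers of \<open>J\<close>, with exponent 0 standing for the whole algebra. The
  value at 1 is given separately: without a unit, the product of \<open>J\<close> with
  \<open>UNIV\<close> may be smaller than \<open>J\<close>.\<close>

fun Jp :: "nat \<Rightarrow> 'a set" where
  "Jp 0 = UNIV"
| "Jp (Suc 0) = J"
| "Jp (Suc (Suc n)) = space_prod scale J (Jp (Suc n))"

lemma subspace_Jp: "subspace (Jp n)"
  by (cases n rule: Jp.cases) (auto simp: subspace_J subspace_space_prod)

lemma left_ideal_space_prod: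
  assumes "v \<in> space_prod scale J W" shows "a * v \<in> space_prod scale J W"
proof -
  interpret l: Vector_Spaces.linear scale scale "\<lambda>x. a * x" by (rule linear_mult_left)
  have "space_prod scale J W \<subseteq> (\<lambda>x. a * x) -` space_prod scale J W"
    by (intro space_prod_subset l.subspace_vimage subspace_space_prod)
       (auto simp: mult.assoc[symmetric] intro: space_prodI J_left)
  with assms show ?thesis by auto
qed

lemma Jp_left: "x \<in> Jp n \<Longrightarrow> a * x \<in> Jp n"
  by (cases n rule: Jp.cases) (auto simp: J_left left_ideal_space_prod)

lemma Jp_Suc_subset: "Jp (Suc n) \<subseteq> Jp n"
proof (induction n rule: Jp.induct)
  case 2
  have "space_prod scale J J \<subseteq> J" by (rule space_prod_subset[OF subspace_J]) (simp add: J_left)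
  then show ?case by simp
next
  case (3 n)
  have "v * w \<in> Jp (Suc (Suc n))" if "v \<in> J" "w \<in> Jp (Suc (Suc n))" for v w
    unfolding Jp.simps(3) by (rule space_prodI[OF that(1)]) (use that(2) 3 in blast)
  then have "space_prod scale J (Jp (Suc (Suc n))) \<subseteq> Jp (Suc (Suc n))"
    by (rule space_prod_subset[OF subspace_Jp])
  then show ?case by (simp only: Jp.simps(3)[of "Suc n"])
qed auto

lemma Jp_antimono: "m \<le> n \<Longrightarrow> Jp n \<subseteq> Jp m"
  using lift_Suc_antimono_le[of Jp] Jp_Suc_subset by auto

text \<open>Nakayama: for a maximal left ideal \<open>M\<close> properly inside \<open>I\<close>, quasi-regularity forces \<open>J I \<subseteq> M\<close>.\<close>

lemma J_nakayama:
  assumes I: "left_ideal scale I" "I \<subseteq> space_prod scale J I"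
  shows "I = {0}"
proof (rule ccontr)
  assume "I \<noteq> {0}"
  have sI: "subspace I" and lI: "\<And>a x. x \<in> I \<Longrightarrow> a * x \<in> I" using I by (auto simp: left_ideal_def)
  define P where "P = (\<lambda>L. left_ideal scale L \<and> L \<subseteq> I \<and> L \<noteq> I)"
  have "P {0}" using \<open>I \<noteq> {0}\<close> subspace_0[OF sI] by (auto simp: P_def left_ideal_def)
  moreover have "subspace L" if "P L" for L using that by (simp add: P_def left_ideal_def)
  ultimately obtain M where "P M" and maxM: "\<And>L'. P L' \<Longrightarrow> M \<subseteq> L' \<Longrightarrow> L' = M"
    by (rule ex_maximal_left_ideal) auto
  then have M: "left_ideal scale M" "M \<subseteq> I" "M \<noteq> I" by (auto simp: P_def)
  have sM: "subspace M" and lM: "\<And>a x. x \<in> M \<Longrightarrow> a * x \<in> M" using M(1) by (auto simp: left_ideal_def)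
  have "x * v \<in> M" if x: "x \<in> J" and v: "v \<in> I" for x v
  proof (rule ccontr)
    assume nM: "x * v \<notin> M"
    define K where "K = {y * v + m | y m. y \<in> J \<and> m \<in> M}"
    have Kset: "K = {a + b | a b. a \<in> (\<lambda>y. y * v) ` J \<and> b \<in> M}" by (auto simp: K_def)
    interpret l: Vector_Spaces.linear scale scale "\<lambda>x. x * v" by (rule linear_mult_right)
    have sK: "subspace K" unfolding Kset
      by (intro subspace_sums l.subspace_image subspace_J sM)
    have "left_ideal scale K" unfolding left_ideal_def
    proof (intro conjI sK allI ballI)
      fix a z assume "z \<in> K"
      then obtain y m where "z = y * v + m" "y \<in> J" "m \<in> M" by (auto simp: K_def)
      then have "a * z = (a * y) * v + a * m" "a * y \<in> J" "a * m \<in> M"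
        by (auto simp: algebra_simps J_left lM)
      then show "a * z \<in> K" by (auto simp: K_def)
    qed
    moreover have "K \<subseteq> I" using v M(2) by (auto simp: K_def intro!: subspace_add[OF sI] lI)
    moreover have "M \<subseteq> K"
    proof
      fix m assume "m \<in> M"
      then show "m \<in> K" unfolding K_def using subspace_0[OF subspace_J]
        by (intro CollectI exI[of _ 0] exI[of _ m]) auto
    qed
    moreover have "x * v \<in> K" unfolding K_def using x subspace_0[OF sM] 
      by (intro CollectI exI[of _ x] exI[of _ 0]) auto
    ultimately have "K = I" using maxM[of K] nM unfolding P_def by blast
    \<comment> \<open>Formally \<open>(1 - y) v = m\<close>. Multiplication by the quasi-inverse
      \<open>a\<close> of \<open>y\<close> gives \<open>a m = y v\<close>, so \<open>y v\<close> and
      then \<open>v\<close> itself lie in \<open>M\<close>.\<close>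
    with v obtain y m where ym: "v = y * v + m" "y \<in> J" "m \<in> M" by (auto simp: K_def)
    from J_quasi_regular[OF ym(2)] obtain a where a: "y = a - a * y" by blast
    have "a * m = a * v - a * (y * v)" using ym(1)
      by (metis add_diff_cancel_left' right_diff_distrib)
    also have "\<dots> = y * v" using a by (metis left_diff_distrib mult.assoc)
    finally have "y * v \<in> M" using lM[OF ym(3), of a] by simp
    then have "v \<in> M" using ym subspace_add[OF sM] by metis
    then show False using nM lM by auto
  qed
  then have "space_prod scale J I \<subseteq> M" by (intro space_prod_subset sM)
  with I(2) M show False by auto
qed

text \<open>The powers of \<open>J\<close> are a descending chain of left ideals, so dimension
  forces two consecutive ones to agree; Nakayama then makes the stable one zero.\<close>

lemma J_nilpotent: "\<exists>p. Jp p = {0}"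
proof -
  have "\<exists>k. Jp (Suc (Suc k)) = Jp (Suc k)"
  proof (rule ccontr)
    assume "\<nexists>k. Jp (Suc (Suc k)) = Jp (Suc k)"
    then have "dim (Jp (Suc (Suc k))) < dim (Jp (Suc k))" for k
      using subspace_dim_equal[OF subspace_Jp subspace_Jp Jp_Suc_subset[of "Suc k"]]
      using not_less by blast
    then have step: "dim (Jp (Suc (Suc k))) < dim (Jp (Suc k))" for k .
    have "dim (Jp (Suc k)) + k \<le> dim (Jp (Suc 0))" for k
    proof (induction k)
      case (Suc k)
      with step[of k] show ?case by linarith
    qed simp
    from this[of "Suc (dim (Jp (Suc 0)))"] show False by simp
  qed
  then obtain k where k: "Jp (Suc (Suc k)) = Jp (Suc k)" by blast
  have "left_ideal scale (Jp (Suc k))" by (auto simp: left_ideal_def subspace_Jp Jp_left)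
  moreover have "Jp (Suc k) \<subseteq> space_prod scale J (Jp (Suc k))" using k by simp
  ultimately have "Jp (Suc k) = {0}" by (rule J_nakayama)
  then show ?thesis by blast
qed

end

section \<open>Trace forms\<close>

text \<open>Gaussian elimination, one equation at a time: an unknown \<open>s0\<close> that occurs
  in equation \<open>i\<close> is eliminated from the others, which leaves one equation and one
  unknown less. In this form it serves both for linear dependence and for comparing dimensions in
  the counting arguments.\<close>

lemma underdetermined_system:
  fixes v :: "'s \<Rightarrow> 'i \<Rightarrow> 'k::field"
  assumes "finite I" "finite S" "card I < card S"
  shows "\<exists>c. (\<exists>s\<in>S. c s \<noteq> 0) \<and> (\<forall>i\<in>I. (\<Sum>s\<in>S. c s * v s i) = 0)"
  using assms
proof (induction I arbitrary: S v rule: finite_induct)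
  case empty
  then obtain s where "s \<in> S" by fastforce
  then show ?case by (intro exI[of _ "\<lambda>_. 1"]) auto
next
  case (insert i I)
  show ?case
  proof (cases "\<forall>s\<in>S. v s i = 0")
    case True
    have "card I < card S" using insert by simp
    from insert.IH[OF insert.prems(1) this, of v] True show ?thesis by auto
  next
    case False
    then obtain s0 where s0: "s0 \<in> S" "v s0 i \<noteq> 0" by blast
    define v' where "v' = (\<lambda>s j. v s j - v s i / v s0 i * v s0 j)"
    have "card I < card (S - {s0})" using insert s0 by simp
    from insert.IH[OF _ this, of v'] insert.prems obtain c
      where c: "\<exists>s\<in>S - {s0}. c s \<noteq> 0" "\<And>j. j \<in> I \<Longrightarrow> (\<Sum>s\<in>S - {s0}. c s * v' s j) = 0"
      by auto
    define d where "d = c (s0 := - (\<Sum>s\<in>S - {s0}. c s * v s i / v s0 i))"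
    have split: "(\<Sum>s\<in>S. d s * v s j) = (\<Sum>s\<in>S - {s0}. c s * v' s j)" for j
    proof -
      have "(\<Sum>s\<in>S. d s * v s j) = d s0 * v s0 j + (\<Sum>s\<in>S - {s0}. d s * v s j)"
        using s0 insert.prems by (simp add: sum.remove)
      also have "(\<Sum>s\<in>S - {s0}. d s * v s j) = (\<Sum>s\<in>S - {s0}. c s * v s j)"
        by (intro sum.cong) (auto simp: d_def)
      also have "d s0 * v s0 j + \<dots> = (\<Sum>s\<in>S - {s0}. c s * v' s j)"
        by (simp add: d_def v'_def sum_distrib_right sum_distrib_left sum_negf algebra_simps sum_subtractf)
      finally show ?thesis .
    qed
    have "v' s i = 0" for s using s0 by (simp add: v'_def)
    then have "(\<Sum>s\<in>S. d s * v s j) = 0" if "j \<in> insert i I" for j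
      using that c(2)[of j] split[of j] by (cases "j = i") auto
    moreover have "\<exists>s\<in>S. d s \<noteq> 0" using c(1) by (auto simp: d_def)
    ultimately show ?thesis by blast
  qed
qed

context finite_dimensional_vector_space
begin

definition coord :: "'b \<Rightarrow> 'b \<Rightarrow> 'a" where "coord b x = representation Basis x b"

lemma coord_add: "coord b (x + y) = coord b x + coord b y"
  and coord_scale: "coord b (scale c x) = c * coord b x"
  and coord_zero [simp]: "coord b 0 = 0"
  by (auto simp: coord_def span_Basis independent_Basis representation_add representation_scale representation_zero)

lemma coord_sum: "coord b (\<Sum>i\<in>I. f i) = (\<Sum>i\<in>I. coord b (f i))"
  by (induction I rule: infinite_finite_induct) (auto simp: coord_add)

lemma coord_Basis: "c \<in> Basis \<Longrightarrow> coord b c = (if b = c then 1 else 0)"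
  by (auto simp: coord_def representation_basis independent_Basis)

lemma coord_expand: "(\<Sum>b\<in>Basis. scale (coord b x) b) = x"
  unfolding coord_def
  by (rule sum_representation_eq) (auto simp: span_Basis independent_Basis finite_Basis)

lemma coord_eqI: "(\<And>b. b \<in> Basis \<Longrightarrow> coord b x = coord b y) \<Longrightarrow> x = y"
  using coord_expand[of x] coord_expand[of y] by (metis (no_types, lifting) sum.cong)

lemma ex_dependence:
  assumes "finite S" "card Basis < card S"
  shows "\<exists>c. (\<exists>s\<in>S. c s \<noteq> 0) \<and> (\<Sum>s\<in>S. scale (c s) (v s)) = 0"
proof -
  obtain c where c: "\<exists>s\<in>S. c s \<noteq> 0" "\<forall>b\<in>Basis. (\<Sum>s\<in>S. c s * coord b (v s)) = 0"
    using underdetermined_system[OF finite_Basis assms, of "\<lambda>s b. coord b (v s)"] by blast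
  have "(\<Sum>s\<in>S. scale (c s) (v s)) = 0"
    by (rule coord_eqI) (use c in \<open>auto simp: coord_sum coord_scale\<close>)
  with c show ?thesis by blast
qed

abbreviation "endo f \<equiv> Vector_Spaces.linear scale scale f"

lemma endo_expand: "endo f \<Longrightarrow> f x = (\<Sum>b\<in>Basis. scale (coord b x) (f b))"
proof -
  assume "endo f"
  then interpret f: Vector_Spaces.linear scale scale f .
  have "f x = f (\<Sum>b\<in>Basis. scale (coord b x) b)" by (simp add: coord_expand)
  also have "\<dots> = (\<Sum>b\<in>Basis. scale (coord b x) (f b))" by (simp add: f.sum f.scale)
  finally show ?thesis .
qed

definition trace :: "('b \<Rightarrow> 'b) \<Rightarrow> 'a" where "trace f = (\<Sum>b\<in>Basis. coord b (f b))"

lemma trace_comm: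
  assumes "endo f" "endo g" shows "trace (\<lambda>x. f (g x)) = trace (\<lambda>x. g (f x))"
proof -
  have *: "trace (\<lambda>x. f (g x)) = (\<Sum>b\<in>Basis. \<Sum>c\<in>Basis. coord c (g b) * coord b (f c))"
    if "endo f" for f g
    unfolding trace_def by (subst endo_expand[OF that]) (simp add: coord_sum coord_scale)
  show ?thesis
    unfolding *[OF assms(1)] *[OF assms(2)] by (subst sum.swap) (simp add: mult.commute)
qed

text \<open>With \<open>\<psi>\<close> the coordinates in a basis \<open>W\<close> of the range,
  exchanging the sums over \<open>Basis\<close> and \<open>W\<close> turns the trace of
  \<open>f\<close> into that of its restriction to the range, where it is the identity.\<close>

lemma trace_idempotent:
  assumes f: "endo f" and idem: "\<And>x. f (f x) = f x"
  shows "trace f = of_nat (dim (range f))"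
proof -
  interpret f: Vector_Spaces.linear scale scale f by (rule f)
  have sub: "subspace (range f)" by (rule f.subspace_image) simp
  obtain W where W: "W \<subseteq> range f" "independent W" "range f \<subseteq> span W" "card W = dim (range f)"
    by (rule basis_exists)
  have finW: "finite W" using W(2) by (rule finiteI_independent)
  define \<psi> where "\<psi> = (\<lambda>x. representation W x)"
  have inW: "f x \<in> span W" for x using W(3) by auto
  have fW: "f w = w" if "w \<in> W" for w using W(1) that idem by auto
  have exp: "f x = (\<Sum>w\<in>W. scale (\<psi> (f x) w) w)" for x
    unfolding \<psi>_def by (rule sum_representation_eq[symmetric]) (use W finW inW in auto)
  have "trace f = (\<Sum>b\<in>Basis. \<Sum>w\<in>W. \<psi> (f b) w * coord b w)"
    unfolding trace_def by (subst exp) (simp add: coord_sum coord_scale)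
  also have "\<dots> = (\<Sum>w\<in>W. \<Sum>b\<in>Basis. coord b w * \<psi> (f b) w)"
    by (subst sum.swap) (simp add: mult.commute)
  also have "\<dots> = (\<Sum>w\<in>W. \<psi> (f w) w)"
  proof (rule sum.cong[OF refl])
    fix w assume "w \<in> W"
    have "\<psi> (f w) w = \<psi> (\<Sum>b\<in>Basis. scale (coord b w) (f b)) w"
      by (subst endo_expand[OF f]) simp
    also have "\<dots> = (\<Sum>b\<in>Basis. coord b w * \<psi> (f b) w)"
      unfolding \<psi>_def
      by (subst representation_sum) (auto simp: W(2) inW span_scale representation_scale)
    finally show "(\<Sum>b\<in>Basis. coord b w * \<psi> (f b) w) = \<psi> (f w) w" by simp
  qed
  also have "\<dots> = (\<Sum>w\<in>W. 1)"
    by (intro sum.cong) (auto simp: fW \<psi>_def representation_basis[OF W(2)])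
  finally show ?thesis using W(4) by simp
qed

end

text \<open>\<open>pw x n\<close> is \<open>x\<^sup>n\<^sup>+\<^sup>1\<close>.\<close>

primrec pw :: "'a::ring \<Rightarrow> nat \<Rightarrow> 'a" where
  "pw x 0 = x"
| "pw x (Suc n) = pw x n * x"

lemma pw_mult: "pw x a * pw x b = pw x (Suc (a + b))"
  by (induction b) (auto simp: mult.assoc[symmetric])

section \<open>Nil left ideals, idempotents and the trace form\<close>

context fd_algebra
begin

text \<open>If \<open>N\<close> were not inside some modular maximal left ideal \<open>L\<close>,
  then \<open>N + L = UNIV\<close>, and the right unit \<open>e\<close> modulo \<open>L\<close>
  could be replaced by an \<open>n\<close> in \<open>N\<close>. All powers of \<open>n\<close> are
  congruent to \<open>n\<close> modulo \<open>L\<close>, so a power in \<open>J\<close> drags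
  \<open>n\<close>, then \<open>e\<close>, then everything into \<open>L\<close>. Applied to
  preimages, this excludes nonzero nil left ideals of \<open>A/J\<close>.\<close>

lemma nil_left_ideal_subset_J:
  assumes N: "left_ideal scale N" and nil: "\<And>x. x \<in> N \<Longrightarrow> \<exists>l. pw x l \<in> J"
  shows "N \<subseteq> J"
proof
  fix x assume x: "x \<in> N"
  have sN: "subspace N" and lN: "\<And>a x. x \<in> N \<Longrightarrow> a * x \<in> N" using N by (auto simp: left_ideal_def)
  have "x \<in> L" if L: "maximal_left_ideal scale L" "modular_left_ideal L" for L
  proof (rule ccontr)
    assume "x \<notin> L"
    have sL: "subspace L" and lL: "\<And>a x. x \<in> L \<Longrightarrow> a * x \<in> L" and "L \<noteq> UNIV"
      and maxL: "\<And>L'. left_ideal scale L' \<Longrightarrow> L \<subseteq> L' \<Longrightarrow> L' = L \<or> L' = UNIV"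
      using L(1) by (auto simp: maximal_left_ideal_def left_ideal_def)
    from L(2) obtain e where e: "\<And>a. a - a * e \<in> L" by (auto simp: modular_left_ideal_def)
    define K where "K = {a + b | a b. a \<in> N \<and> b \<in> L}"
    have "left_ideal scale K"
      unfolding left_ideal_def
    proof (intro conjI allI ballI)
      show "subspace K" unfolding K_def by (intro subspace_sums sN sL)
      fix a z assume "z \<in> K"
      then obtain u v where "z = u + v" "u \<in> N" "v \<in> L" by (auto simp: K_def)
      then have "a * z = a * u + a * v" "a * u \<in> N" "a * v \<in> L"
        by (auto simp: distrib_left lN lL)
      then show "a * z \<in> K" by (auto simp: K_def)
    qed
    moreover have "L \<subseteq> K" unfolding K_def using subspace_0[OF sN] by force
    moreover have "x \<in> K" unfolding K_def using subspace_0[OF sL] x by force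
    ultimately have "K = UNIV" using maxL[of K] \<open>x \<notin> L\<close> by auto
    then have "e \<in> K" by simp
    then obtain n l where n: "e = n + l" "n \<in> N" "l \<in> L" by (auto simp: K_def)
    have an: "a - a * n \<in> L" for a
      using subspace_add[OF sL e[of a] lL[OF n(3), of a]] n(1) by (simp add: algebra_simps)
    have pwn: "n - pw n k \<in> L" for k
    proof (induction k)
      case (Suc k)
      from subspace_add[OF sL this an[of "pw n k"]] show ?case by simp
    qed (simp add: subspace_0[OF sL])
    obtain k where "pw n k \<in> J" using nil n(2) by blast
    then have "pw n k \<in> L" using L by (auto simp: jacobson_radical_def)
    from subspace_add[OF sL pwn[of k] this] have "n \<in> L" by simp
    with n subspace_add[OF sL] have "e \<in> L" by simp
    then have "a \<in> L" for a using subspace_add[OF sL e[of a] lL[of e a]] by simp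
    with \<open>L \<noteq> UNIV\<close> show False by auto
  qed
  then show "x \<in> J" by (auto simp: jacobson_radical_def)
qed

text \<open>A dependence between the powers of \<open>y\<close> with lowest term
  \<open>pw y l\<close> yields a polynomial \<open>g\<close> in \<open>y\<close>, without constant
  term, such that right multiplication by \<open>g\<close> fixes \<open>pw y l\<close> and all
  higher powers. A power of \<open>g\<close> that lies in the span of these is fixed by its own
  multiplication, so it is idempotent; it is not 0 because it fixes \<open>pw y l\<close>.\<close>

lemma ex_idempotent:
  assumes nn: "\<And>l. pw y l \<noteq> 0"
  shows "\<exists>f\<in>span (range (pw y)). f \<noteq> 0 \<and> f * f = f"
proof -
  define N where "N = card Basis"
  obtain c where c: "\<exists>k\<in>{..N}. c k \<noteq> 0" "(\<Sum>k\<le>N. scale (c k) (pw y k)) = 0"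
    using ex_dependence[of "{..N}" "pw y"] by (auto simp: N_def)
  define l where "l = (LEAST k. k \<le> N \<and> c k \<noteq> 0)"
  have l: "l \<le> N" "c l \<noteq> 0" using c(1) LeastI_ex[of "\<lambda>k. k \<le> N \<and> c k \<noteq> 0"] by (auto simp: l_def)
  have below: "c k = 0" if "k < l" for k
    using not_less_Least[of k "\<lambda>k. k \<le> N \<and> c k \<noteq> 0"] that l by (auto simp: l_def)
  \<comment> \<open>The relation solved for \<open>pw y l\<close>, with \<open>pw y l\<close>
    factored out. Since \<open>pw y k\<close> is the power \<open>k + 1\<close>, the cofactor has
    index \<open>k - Suc l\<close>.\<close>
  define g where "g = (\<Sum>k\<in>{l<..N}. scale (- c k / c l) (pw y (k - Suc l)))"
  have "0 = (\<Sum>k\<le>N. scale (c k) (pw y k))" using c by simp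
  also have "\<dots> = (\<Sum>k\<in>{l..N}. scale (c k) (pw y k))"
    by (intro sum.mono_neutral_right) (auto simp: below not_le)
  also have "\<dots> = scale (c l) (pw y l) + (\<Sum>k\<in>{l<..N}. scale (c k) (pw y k))"
    using l by (simp add: sum.head)
  finally have rel: "scale (c l) (pw y l) = - (\<Sum>k\<in>{l<..N}. scale (c k) (pw y k))"
    by (simp add: eq_neg_iff_add_eq_0)
  have "pw y l * g = (\<Sum>k\<in>{l<..N}. scale (- c k / c l) (pw y k))"
    by (auto simp: g_def sum_distrib_left scale_mult_right pw_mult intro!: sum.cong)
  also have "\<dots> = scale (1 / c l) (- (\<Sum>k\<in>{l<..N}. scale (c k) (pw y k)))"
    by (simp add: scale_sum_right sum_negf)
  also have "\<dots> = pw y l" using l(2) by (simp flip: rel)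
  finally have lg: "pw y l * g = pw y l" .
  define C where "C = (\<lambda>a. span (pw y ` {a..}))"
  have kg: "pw y k * g = pw y k" if "l \<le> k" for k
  proof (cases "k = l")
    case False
    then have "pw y k = pw y (k - Suc l) * pw y l" using that by (simp add: pw_mult)
    then show ?thesis by (simp add: mult.assoc lg)
  qed (simp add: lg)
  have xg: "x * g = x" if "x \<in> C l" for x
    using that unfolding C_def
    by (induction rule: span_induct_alt) (auto simp: distrib_right scale_mult_left kg)
  then have xpg: "x * pw g j = x" if "x \<in> C l" for x j
    using that by (induction j) (auto simp: mult.assoc[symmetric])
  have Cy: "x * pw y k \<in> C (Suc a)" if "x \<in> C a" for x k a
    using that unfolding C_def
  proof (induction rule: span_induct_alt)
    case base then show ?case by (simp add: span_zero)
  next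
    case (step c x z)
    then obtain m where "x = pw y m" "a \<le> m" by auto
    then have "x * pw y k \<in> span (pw y ` {Suc a..})"
      by (intro span_base) (auto simp: pw_mult simp del: pw.simps)
    with step show ?case by (auto simp: distrib_right scale_mult_left intro!: span_add span_scale)
  qed
  have Cg: "x * g \<in> C (Suc a)" if "x \<in> C a" for x a
    unfolding g_def sum_distrib_left scale_mult_right C_def
    by (intro span_sum span_scale) (use Cy[OF that] in \<open>auto simp: C_def\<close>)
  \<comment> \<open>Each further factor \<open>g\<close> raises the order in \<open>y\<close> by at
    least one.\<close>
  have "pw g j \<in> C j" for j
  proof (induction j)
    case 0
    show ?case unfolding pw.simps C_def g_def by (intro span_sum span_scale span_base imageI) simp
  qed (simp add: Cg)
  then have f: "pw g l \<in> C l" .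
  have "C l \<subseteq> span (range (pw y))" unfolding C_def by (intro span_mono) auto
  moreover have "pw g l \<noteq> 0" using xpg[of "pw y l" l] nn[of l] by (auto simp: C_def span_base)
  ultimately show ?thesis using f xpg[OF f, of l] by blast
qed

text \<open>The trace form of the left regular representation.\<close>

definition tform :: "'a \<Rightarrow> 'a \<Rightarrow> 'f" where "tform a b = trace (\<lambda>x. a * (b * x))"

lemma endo_mult_left: "endo ((*) a)"
  by (rule linear_mult_left)

lemma tform_comm: "tform a b = tform b a"
  unfolding tform_def using trace_comm[OF endo_mult_left endo_mult_left] .

lemma tform_assoc: "tform (a * c) b = tform a (c * b)"
  unfolding tform_def by (simp add: mult.assoc)

lemma tform_add: "tform (a + a') b = tform a b + tform a' b"
  and tform_scale: "tform (scale r a) b = r * tform a b"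
  unfolding tform_def trace_def
  by (auto simp: distrib_right coord_add sum.distrib scale_mult_left coord_scale sum_distrib_left)

lemma tform_add_right: "tform b (a + a') = tform b a + tform b a'"
  and tform_scale_right: "tform b (scale r a) = r * tform b a"
  by (auto simp: tform_comm[of b] tform_add tform_scale)

lemma tform_zero [simp]: "tform 0 b = 0" "tform b 0 = 0"
  using tform_scale[of 0 0 b] tform_scale_right[of b 0 0] by auto

lemma tform_sum_right: "tform b (\<Sum>i\<in>I. f i) = (\<Sum>i\<in>I. tform b (f i))"
  by (induction I rule: infinite_finite_induct) (auto simp: tform_add_right)

lemma tform_sum: "tform (\<Sum>i\<in>I. f i) b = (\<Sum>i\<in>I. tform (f i) b)"
  by (induction I rule: infinite_finite_induct) (auto simp: tform_add)

end

text \<open>Semisimplicity in the form in which it is obtained for \<open>A/J\<close>.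
  Characteristic 0 makes the trace of a nonzero idempotent operator, which is a dimension, different
  from 0.\<close>

locale fd_algebra0 = fd_algebra scale Basis
  for scale :: "'f::field_char_0 \<Rightarrow> 'a::ring \<Rightarrow> 'a" and Basis :: "'a set" +
  assumes nil_ideal_zero: "left_ideal scale N \<Longrightarrow> (\<And>x. x \<in> N \<Longrightarrow> \<exists>l. pw x l = 0) \<Longrightarrow> N = {0}"
begin

text \<open>The radical \<open>R\<close> of the form is a left ideal. A non-nilpotent element in it
  would produce an idempotent \<open>f \<noteq> 0\<close> in \<open>R\<close>, but
  \<open>tform f f\<close> is the rank of left multiplication by \<open>f\<close>, which is not 0.
  So \<open>R\<close> is nil.\<close>

lemma tform_nondegenerate:
  assumes "\<And>z. tform y z = 0" shows "y = 0"
proof -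
  define R where "R = {y. \<forall>z. tform y z = 0}"
  have sR: "subspace R" by (rule subspaceI) (auto simp: R_def tform_add tform_scale)
  have lR: "a * x \<in> R" if "x \<in> R" for a x
    using that unfolding R_def by (auto simp: tform_assoc tform_comm[of a])
  have "R = {0}"
  proof (rule nil_ideal_zero)
    show "left_ideal scale R" using sR lR by (auto simp: left_ideal_def)
    fix x assume x: "x \<in> R"
    show "\<exists>l. pw x l = 0"
    proof (rule ccontr)
      assume "\<nexists>l. pw x l = 0"
      then obtain f where f: "f \<in> span (range (pw x))" "f \<noteq> 0" "f * f = f"
        using ex_idempotent[of x] by blast
      have "pw x l \<in> R" for l by (cases l) (auto simp: x lR)
      then have "f \<in> R" using f(1) span_minimal[OF _ sR, of "range (pw x)"] by auto
      then have "tform f f = 0" by (simp add: R_def)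
      then have "trace (\<lambda>z. f * z) = 0" by (simp add: tform_def mult.assoc[symmetric] f(3))
      moreover have "trace (\<lambda>z. f * z) = of_nat (dim (range (\<lambda>z. f * z)))"
        by (rule trace_idempotent[OF linear_mult_left]) (simp add: mult.assoc[symmetric] f(3))
      ultimately have "dim (range (\<lambda>z. f * z)) = 0" by simp
      then have "range (\<lambda>z. f * z) \<subseteq> {0}" by (simp only: dim_eq_0)
      then have "f * f \<in> {0}" by blast
      then show False using f(2,3) by simp
    qed
  qed
  then show ?thesis using assms by (auto simp: R_def)
qed

text \<open>The operator \<open>T\<close> has the functionals \<open>tform c\<close> as coordinates.
  Nondegeneracy makes it injective, hence surjective, and preimages of the basis vectors form the
  dual basis.\<close>

lemma ex_dual_basis: "\<exists>D. \<forall>b\<in>Basis. \<forall>c\<in>Basis. tform c (D b) = (if c = b then 1 else 0)"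
proof -
  define T where "T = (\<lambda>z. \<Sum>c\<in>Basis. scale (tform c z) c)"
  have lin: "endo T"
    by unfold_locales
      (auto simp: T_def tform_add_right tform_scale_right scale_left_distrib sum.distrib scale_sum_right)
  interpret T: Vector_Spaces.linear scale scale T by (rule lin)
  have coordT: "coord c (T z) = tform c z" if "c \<in> Basis" for c z
    using that by (auto simp: T_def coord_sum coord_scale coord_Basis finite_Basis if_distrib cong: if_cong)
  have "inj T"
  proof (rule T.inj_iff_eq_0[THEN iffD2], intro allI impI)
    fix z assume "T z = 0"
    then have *: "tform c z = 0" if "c \<in> Basis" for c using coordT[OF that, of z] by simp
    have "tform y z = 0" for y
      by (subst coord_expand[of y, symmetric]) (simp add: tform_sum tform_scale *)
    then show "z = 0" using tform_nondegenerate[of z] by (simp add: tform_comm)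
  qed
  then have "surj T" by (rule linear_inj_imp_surj[OF lin])
  then have "\<forall>b. \<exists>z. T z = b" by (metis surjD)
  then obtain D where D: "\<And>b. T (D b) = b" by metis
  show ?thesis
  proof (intro exI[of _ D] ballI)
    fix b c assume "b \<in> Basis" "c \<in> Basis"
    then show "tform c (D b) = (if c = b then 1 else 0)"
      using coordT[of c "D b"] by (simp add: D coord_Basis)
  qed
qed

text \<open>The functional \<open>\<tau>\<close>, the trace of left multiplication, is represented
  by an element \<open>e\<close> through the nondegenerate form. As
  \<open>\<tau> (a * b) = tform a b\<close>, associativity of the form shows that
  \<open>z * e\<close> and \<open>e * z\<close> pair with every element as \<open>z\<close>
  does.\<close>

lemma ex_unit: "\<exists>e::'a. \<forall>z. e * z = z \<and> z * e = z"
proof -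
  obtain D where D: "\<And>b c. b \<in> Basis \<Longrightarrow> c \<in> Basis \<Longrightarrow> tform c (D b) = (if c = b then 1 else 0)"
    using ex_dual_basis by blast
  define \<tau> where "\<tau> = (\<lambda>y. trace (\<lambda>x. y * x))"
  define e where "e = (\<Sum>b\<in>Basis. scale (\<tau> b) (D b))"
  have \<tau>: "\<tau> (y + y') = \<tau> y + \<tau> y'" "\<tau> (scale r y) = r * \<tau> y" for y y' r
    by (auto simp: \<tau>_def trace_def distrib_right coord_add sum.distrib scale_mult_left coord_scale sum_distrib_left)
  then have \<tau>0: "\<tau> 0 = 0" by (metis add_cancel_right_left add.right_neutral)
  have \<tau>s: "\<tau> (\<Sum>i\<in>I. f i) = (\<Sum>i\<in>I. \<tau> (f i))" for f :: "'a \<Rightarrow> 'a" and I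
    by (induction I rule: infinite_finite_induct) (auto simp: \<tau> \<tau>0)
  have "tform c e = \<tau> c" if "c \<in> Basis" for c
  proof -
    have "tform c e = (\<Sum>b\<in>Basis. \<tau> b * (if c = b then 1 else 0))"
      using that by (auto simp: e_def tform_sum_right tform_scale_right D intro!: sum.cong)
    then show ?thesis using that finite_Basis by (simp add: if_distrib cong: if_cong)
  qed
  then have te: "tform y e = \<tau> y" for y
    by (subst (1 2) coord_expand[of y, symmetric]) (simp add: tform_sum tform_scale \<tau> \<tau>s)
  have \<tau>m: "\<tau> (a * b) = tform a b" for a b
    unfolding \<tau>_def tform_def by (rule arg_cong[of _ _ trace]) (auto simp: mult.assoc)
  have eqI: "u = v" if "\<And>y. tform y u = tform y v" for u v
  proof -
    have "tform (u - v) y = 0" for y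
      using that[of y] tform_add_right[of y "u - v" v] by (simp add: tform_comm)
    from tform_nondegenerate[OF this] show ?thesis by simp
  qed
  have "z * e = z" for z
    by (rule eqI) (simp only: tform_assoc[symmetric] te \<tau>m)
  moreover have "e * z = z" for z
  proof (rule eqI)
    fix y
    have "tform y (e * z) = tform (y * e) z" by (simp only: tform_assoc)
    also have "\<dots> = tform z (y * e)" by (rule tform_comm)
    also have "\<dots> = tform (z * y) e" by (simp only: tform_assoc)
    also have "\<dots> = tform y z" unfolding te \<tau>m by (rule tform_comm)
    finally show "tform y (e * z) = tform y z" .
  qed
  ultimately show ?thesis by (intro exI[of _ e]) simp
qed

end

section \<open>Homogeneous components in a graded algebra\<close>

locale graded_algebra = fd_algebra scale Basis
  for scale :: "'f::field \<Rightarrow> 'a::ring \<Rightarrow> 'a" and Basis :: "'a set" +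
  fixes G :: "'t::semigroup_mult \<Rightarrow> 'a set"
  assumes grading: "is_grading scale G"
begin

abbreviation hc :: "'t \<Rightarrow> 'a \<Rightarrow> 'a" where "hc t a \<equiv> hom_component G a t"

lemma subspace_G: "subspace (G t)"
  and G_mult: "x \<in> G r \<Longrightarrow> y \<in> G s \<Longrightarrow> x * y \<in> G (r * s)"
  using grading by (auto simp: is_grading_def)

lemma ex1_decomposition: "\<exists>!f. is_decomposition UNIV G a f"
  using grading by (auto simp: is_grading_def direct_sum_def)

lemma decomposition_hc: "is_decomposition UNIV G a (hom_component G a)"
  unfolding hom_component_def by (rule theI'[OF ex1_decomposition])

lemma hc_in: "hc t a \<in> G t"
  and finite_hc: "finite {t. hc t a \<noteq> 0}"
  and hc_sum: "(\<Sum>t | hc t a \<noteq> 0. hc t a) = a"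
  using decomposition_hc[of a] by (auto simp: is_decomposition_def)

lemma hc_unique: "is_decomposition UNIV G a f \<Longrightarrow> hom_component G a = f"
  using ex1_decomposition[of a] decomposition_hc[of a] by blast

lemma hc_eqI:
  assumes "finite S" "\<And>t. f t \<in> G t" "\<And>t. t \<notin> S \<Longrightarrow> f t = 0" "a = (\<Sum>t\<in>S. f t)"
  shows "hc t a = f t"
proof -
  have sub: "{t. f t \<noteq> 0} \<subseteq> S" using assms(3) by auto
  have "(\<Sum>t\<in>S. f t) = (\<Sum>t | f t \<noteq> 0. f t)"
    by (rule sum.mono_neutral_right[OF assms(1) sub]) auto
  then have "is_decomposition UNIV G a f"
    unfolding is_decomposition_def using assms finite_subset[OF sub assms(1)] by auto
  from hc_unique[OF this] show ?thesis by simp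
qed

lemma hc_sum_superset:
  assumes "finite S" "{t. hc t a \<noteq> 0} \<subseteq> S" shows "(\<Sum>t\<in>S. hc t a) = a"
proof -
  have "(\<Sum>t\<in>S. hc t a) = (\<Sum>t | hc t a \<noteq> 0. hc t a)"
    by (rule sum.mono_neutral_right[OF assms]) auto
  then show ?thesis by (simp add: hc_sum)
qed

lemma endo_hc: "endo (hc t)"
proof unfold_locales
  fix x y :: 'a and c :: 'f
  let ?S = "{t. hc t x \<noteq> 0} \<union> {t. hc t y \<noteq> 0}"
  have fin: "finite ?S" by (simp add: finite_hc)
  show "hc t (x + y) = hc t x + hc t y"
  proof (rule hc_eqI[OF fin])
    show "x + y = (\<Sum>t\<in>?S. hc t x + hc t y)"
      using hc_sum_superset[OF fin, of x] hc_sum_superset[OF fin, of y] by (simp only: sum.distrib) auto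
  qed (auto simp: subspace_add[OF subspace_G] hc_in)
  show "hc t (scale c x) = scale c (hc t x)"
    by (rule hc_eqI[OF finite_hc[of x]])
       (auto simp: hc_in subspace_scale[OF subspace_G] hc_sum simp flip: scale_sum_right)
qed

lemma hc_add: "hc t (x + y) = hc t x + hc t y"
  and hc_scale: "hc t (scale c x) = scale c (hc t x)"
  and hc_zero [simp]: "hc t 0 = 0"
proof -
  interpret l: Vector_Spaces.linear scale scale "hc t" by (rule endo_hc)
  show "hc t (x + y) = hc t x + hc t y" "hc t (scale c x) = scale c (hc t x)" "hc t 0 = 0"
    by (rule l.add l.scale l.zero)+
qed

lemma hc_sum': "hc t (\<Sum>i\<in>I. f i) = (\<Sum>i\<in>I. hc t (f i))"
  by (induction I rule: infinite_finite_induct) (auto simp: hc_add)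

lemma hc_homogeneous: "a \<in> G s \<Longrightarrow> hc t a = (if t = s then a else 0)"
  by (rule hc_eqI[of "{s}"]) (auto simp: subspace_0[OF subspace_G])

text \<open>The semigroup may be infinite; sums over this finite set of degrees replace sums over
  all of it.\<close>

definition Supp :: "'t set" where "Supp = (\<Union>b\<in>Basis. {t. hc t b \<noteq> 0})"

lemma finite_Supp: "finite Supp"
  unfolding Supp_def by (auto simp: finite_Basis finite_hc)

lemma hc_not_Supp: "t \<notin> Supp \<Longrightarrow> hc t a = 0"
  by (subst endo_expand[OF endo_hc]) (auto simp: Supp_def intro!: sum.neutral)

lemma hc_expand: "(\<Sum>t\<in>Supp. hc t a) = a"
  by (rule hc_sum_superset[OF finite_Supp]) (use hc_not_Supp in blast)

lemma hc_mult: "hc t (x * y) = (\<Sum>r\<in>Supp. \<Sum>s\<in>Supp. if r * s = t then hc r x * hc s y else 0)"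
proof -
  have "x * y = (\<Sum>r\<in>Supp. \<Sum>s\<in>Supp. hc r x * hc s y)"
    by (simp add: hc_expand flip: sum_product)
  also have "hc t \<dots> = (\<Sum>r\<in>Supp. \<Sum>s\<in>Supp. hc t (hc r x * hc s y))"
    by (simp add: hc_sum')
  also have "\<dots> = (\<Sum>r\<in>Supp. \<Sum>s\<in>Supp. if r * s = t then hc r x * hc s y else 0)"
    by (intro sum.cong refl) (simp add: hc_homogeneous[OF G_mult[OF hc_in hc_in]])
  finally show ?thesis .
qed

section \<open>Graded multilinear functions\<close>

text \<open>The variable of degree \<open>t\<close> and index \<open>i\<close> takes the component
  of degree \<open>t\<close> of \<open>x i\<close>. So graded substitutions are encoded by
  arbitrary, inhomogeneous elements, one for each index; \<open>identity_iff\<close> shows that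
  nothing is lost.\<close>

definition ev :: "('v \<Rightarrow> 'a) \<Rightarrow> ('t \<times> 'v) list \<Rightarrow> 'a" where
  "ev x w = list_mult (map (\<lambda>(t, i). hc t (x i)) w)"

lemma list_mult_append: "xs \<noteq> [] \<Longrightarrow> ys \<noteq> [] \<Longrightarrow> list_mult (xs @ ys) = list_mult xs * list_mult (ys :: 'r::ring list)"
proof (induction xs rule: list_mult.induct)
  case (2 x) then show ?case by (cases ys) auto
qed (auto simp: mult.assoc)

lemma list_mult_Cons: "xs \<noteq> [] \<Longrightarrow> list_mult (x # xs) = x * list_mult (xs :: 'r::ring list)"
  by (cases xs) auto

lemma ev_append: "v \<noteq> [] \<Longrightarrow> w \<noteq> [] \<Longrightarrow> ev x (v @ w) = ev x v * ev x w"
  by (simp add: ev_def list_mult_append)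

lemma ev_Cons: "w \<noteq> [] \<Longrightarrow> ev x ((t, i) # w) = hc t (x i) * ev x w"
  and ev_single: "ev x [(t, i)] = hc t (x i)"
  by (auto simp: ev_def list_mult_Cons)

lemma ev_cong: "(\<And>i. i \<in> snd ` set w \<Longrightarrow> x i = y i) \<Longrightarrow> ev x w = ev y w"
proof -
  assume *: "\<And>i. i \<in> snd ` set w \<Longrightarrow> x i = y i"
  have "x (snd p) = y (snd p)" if "p \<in> set w" for p
    by (rule *) (use that in simp)
  then have "map (\<lambda>(t, i). hc t (x i)) w = map (\<lambda>(t, i). hc t (y i)) w"
    by (auto simp: case_prod_beta)
  then show ?thesis by (simp only: ev_def)
qed

lemma ev_homogeneous: "w \<noteq> [] \<Longrightarrow> \<exists>s. \<forall>x. ev x w \<in> G s"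
proof (induction w)
  case (Cons a w)
  obtain t i where a: "a = (t, i)" by (cases a)
  show ?case
  proof (cases "w = []")
    case True then show ?thesis by (intro exI[of _ t]) (simp add: a ev_single hc_in)
  next
    case False
    with Cons obtain s where "\<And>x. ev x w \<in> G s" by blast
    with False show ?thesis by (intro exI[of _ "t * s"]) (simp add: a ev_Cons G_mult hc_in)
  qed
qed simp

lemma ev_linear:
  "distinct (map snd w) \<Longrightarrow> i \<in> snd ` set w \<Longrightarrow> endo (\<lambda>a. ev (x(i := a)) w)"
proof (induction w)
  case (Cons p w)
  obtain t j where p: "p = (t, j)" by (cases p)
  show ?case
  proof (cases "w = []")
    case True
    then show ?thesis using Cons.prems endo_hc by (simp add: p ev_single)
  next
    case False
    show ?thesis
    proof (cases "j = i")
      case True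
      then have "ev (x(i := a)) w = ev x w" for a
        using Cons.prems by (intro ev_cong) (auto simp: p)
      then have "(\<lambda>a. ev (x(i := a)) (p # w)) = (\<lambda>a. hc t a * ev x w)"
        using False True by (simp add: p ev_Cons)
      moreover have "endo (\<lambda>a. hc t a * ev x w)"
        by unfold_locales (auto simp: hc_add hc_scale distrib_right scale_mult_left)
      ultimately show ?thesis by (simp only:)
    next
      case False
      then have "endo (\<lambda>a. ev (x(i := a)) w)"
        using Cons.prems by (intro Cons.IH) (auto simp: p)
      then interpret l: Vector_Spaces.linear scale scale "\<lambda>a. ev (x(i := a)) w" .
      have "(\<lambda>a. ev (x(i := a)) (p # w)) = (\<lambda>a. hc t (x j) * ev (x(i := a)) w)"
        using False \<open>w \<noteq> []\<close> by (simp add: p ev_Cons)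
      moreover have "endo (\<lambda>a. hc t (x j) * ev (x(i := a)) w)"
        by unfold_locales (auto simp: l.add l.scale distrib_left scale_mult_right)
      ultimately show ?thesis by (simp only:)
    qed
  qed
qed simp

text \<open>
  \<open>gfun X c F\<close>: the function \<open>F\<close> is multilinear in the variables \<open>X\<close>, and it is a linear combination
  of evaluations of graded multilinear polynomials in \<open>X\<close> and \<open>c\<close> further variables which are
  replaced by elements of the basis.
\<close>

inductive gfun :: "'v set \<Rightarrow> nat \<Rightarrow> (('v \<Rightarrow> 'a) \<Rightarrow> 'a) \<Rightarrow> bool" where
  gfun_Basis: "b \<in> Basis \<Longrightarrow> gfun {} 1 (\<lambda>_. b)"
| gfun_var: "gfun {i} 0 (\<lambda>x. x i)"
| gfun_hc: "gfun X c F \<Longrightarrow> gfun X c (\<lambda>x. hc t (F x))"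
| gfun_mult: "gfun X c F \<Longrightarrow> gfun Y c' H \<Longrightarrow> X \<inter> Y = {} \<Longrightarrow> gfun (X \<union> Y) (c + c') (\<lambda>x. F x * H x)"
| gfun_add: "gfun X c F \<Longrightarrow> gfun X c H \<Longrightarrow> gfun X c (\<lambda>x. F x + H x)"
| gfun_scale: "gfun X c F \<Longrightarrow> gfun X c (\<lambda>x. scale r (F x))"

lemma gfun_finite: "gfun X c F \<Longrightarrow> finite X"
  by (induction rule: gfun.induct) auto

lemma gfun_pos: "gfun X c F \<Longrightarrow> 0 < card X + c"
  by (induction rule: gfun.induct) (auto simp: card_Un_disjoint gfun_finite)

lemma gfun_cong: "gfun X c F \<Longrightarrow> (\<And>i. i \<in> X \<Longrightarrow> x i = y i) \<Longrightarrow> F x = F y"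
proof (induction arbitrary: x y rule: gfun.induct)
  case (gfun_mult X c F Y c' H)
  have "F x = F y" by (rule gfun_mult.IH(1)) (simp add: gfun_mult.prems)
  moreover have "H x = H y" by (rule gfun_mult.IH(2)) (simp add: gfun_mult.prems)
  ultimately show ?case by simp
next
  case (gfun_add X c F H)
  have "F x = F y" by (rule gfun_add.IH(1)) (simp add: gfun_add.prems)
  moreover have "H x = H y" by (rule gfun_add.IH(2)) (simp add: gfun_add.prems)
  ultimately show ?case by simp
next
  case (gfun_hc X c F t)
  have "F x = F y" by (rule gfun_hc.IH) (simp add: gfun_hc.prems)
  then show ?case by simp
next
  case (gfun_scale X c F r)
  have "F x = F y" by (rule gfun_scale.IH) (simp add: gfun_scale.prems)
  then show ?case by simp
qed simp_all

lemma gfun_sum: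
  assumes "finite I" "I \<noteq> {}" "\<And>i. i \<in> I \<Longrightarrow> gfun X c (F i)"
  shows "gfun X c (\<lambda>x. \<Sum>i\<in>I. F i x)"
  using assms
proof (induction I rule: finite_ne_induct)
  case (insert i I)
  have "gfun X c (\<lambda>x. F i x + (\<Sum>i\<in>I. F i x))"
    by (rule gfun_add) (simp_all add: insert)
  with insert show ?case by simp
qed simp

lemma gfun_const:
  assumes "Basis \<noteq> {}" shows "gfun {} 1 (\<lambda>_. a)"
proof -
  have "gfun {} 1 (\<lambda>x. \<Sum>b\<in>Basis. scale (coord b a) b)"
  proof (rule gfun_sum[OF finite_Basis assms])
    fix b assume "b \<in> Basis"
    from gfun_scale[OF gfun_Basis[OF this], of "coord b a"]
    show "gfun {} 1 (\<lambda>x. scale (coord b a) b)" .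
  qed
  then show ?thesis by (simp add: coord_expand)
qed

lemma gfun_subst:
  assumes "gfun X c F" "k \<in> X" "gfun Y c' H" "Y \<inter> (X - {k}) = {}"
  shows "gfun (X - {k} \<union> Y) (c + c') (\<lambda>x. F (x(k := H x)))"
  using assms
proof (induction rule: gfun.induct)
  case (gfun_mult X c F X' c2 F')
  show ?case
  proof (cases "k \<in> X")
    case True
    then have k: "k \<notin> X'" using gfun_mult by auto
    have "F' (x(k := H x)) = F' x" for x
      using gfun_mult.hyps(2) by (rule gfun_cong) (use k in auto)
    moreover have "gfun ((X - {k} \<union> Y) \<union> X') ((c + c') + c2) (\<lambda>x. F (x(k := H x)) * F' x)"
      using True k gfun_mult by (intro gfun.gfun_mult gfun_mult.IH gfun_mult.hyps) auto
    moreover have "(X - {k} \<union> Y) \<union> X' = X \<union> X' - {k} \<union> Y" using k by auto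
    ultimately show ?thesis by (simp only: add_ac)
  next
    case False
    then have k: "k \<in> X'" using gfun_mult by auto
    have "F (x(k := H x)) = F x" for x
      using gfun_mult.hyps(1) by (rule gfun_cong) (use False in auto)
    moreover have "gfun (X \<union> (X' - {k} \<union> Y)) (c + (c2 + c')) (\<lambda>x. F x * F' (x(k := H x)))"
      using False k gfun_mult by (intro gfun.gfun_mult gfun_mult.IH gfun_mult.hyps) auto
    moreover have "X \<union> (X' - {k} \<union> Y) = X \<union> X' - {k} \<union> Y" using False by auto
    ultimately show ?thesis by (simp only: add_ac)
  qed
qed (auto intro: gfun.intros)

lemma gfun_rename:
  assumes "gfun X c F" "inj_on \<rho> X"
  shows "gfun (\<rho> ` X) c (\<lambda>x. F (\<lambda>i. x (\<rho> i)))"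
  using assms
proof (induction rule: gfun.induct)
  case (gfun_Basis b)
  then show ?case using gfun.gfun_Basis[of b] by simp
next
  case (gfun_var i)
  show ?case using gfun.gfun_var[of "\<rho> i"] by simp
next
  case (gfun_mult X c F Y c' H)
  have "inj_on \<rho> X" "inj_on \<rho> Y" "\<rho> ` X \<inter> \<rho> ` Y = {}"
    using gfun_mult by (auto simp: inj_on_Un)
  with gfun_mult show ?case by (simp add: image_Un gfun.gfun_mult)
qed (auto intro: gfun.intros)

section \<open>Linear combinations of monomial functions\<close>

inductive lincomb :: "(('v \<Rightarrow> 'a) \<Rightarrow> bool) \<Rightarrow> ('v \<Rightarrow> 'a) \<Rightarrow> bool" for M where
  lincomb_zero: "lincomb M (\<lambda>_. 0)"
| lincomb_step: "M f \<Longrightarrow> lincomb M g \<Longrightarrow> lincomb M (\<lambda>x. scale c (f x) + g x)"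

lemma lincomb_base: "M f \<Longrightarrow> lincomb M f"
  using lincomb_step[OF _ lincomb_zero, of M f 1] by simp

lemma lincomb_add: "lincomb M f \<Longrightarrow> lincomb M g \<Longrightarrow> lincomb M (\<lambda>x. f x + g x)"
proof (induction rule: lincomb.induct)
  case (lincomb_step f f' c)
  then show ?case using lincomb.lincomb_step[of M f "\<lambda>x. f' x + g x" c] by (simp add: add.assoc)
qed simp

lemma lincomb_scale: "lincomb M f \<Longrightarrow> lincomb M (\<lambda>x. scale c (f x))"
proof (induction rule: lincomb.induct)
  case lincomb_zero show ?case using lincomb.lincomb_zero[of M] by simp
next
  case (lincomb_step f g d)
  then show ?case using lincomb.lincomb_step[of M f "\<lambda>x. scale c (g x)" "c * d"]
    by (simp add: scale_right_distrib)
qed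

lemma lincomb_bind:
  assumes "lincomb M f" "\<And>u. M u \<Longrightarrow> lincomb N (\<lambda>x. L x (u x))" "\<And>x. endo (L x)"
  shows "lincomb N (\<lambda>x. L x (f x))"
  using assms(1)
proof (induction rule: lincomb.induct)
  case lincomb_zero
  have "L x 0 = 0" for x using assms(3)[of x]
    by (auto simp: linear_iff_module_hom dest: module_hom.zero)
  then show ?case using lincomb.lincomb_zero[of N] by simp
next
  case (lincomb_step u g c)
  have "L x (scale c (u x) + g x) = scale c (L x (u x)) + L x (g x)" for x
  proof -
    interpret l: Vector_Spaces.linear scale scale "L x" by (rule assms(3))
    show ?thesis by (simp add: l.add l.scale)
  qed
  then show ?case using lincomb_add[OF lincomb_scale[OF assms(2)[OF lincomb_step(1)], of c] lincomb_step.IH]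
    by simp
qed

lemma lincomb_sum:
  "(\<And>i. i \<in> I \<Longrightarrow> lincomb M (f i)) \<Longrightarrow> lincomb M (\<lambda>x. \<Sum>i\<in>I. f i x)"
proof (induction I rule: infinite_finite_induct)
  case (insert i I)
  have "lincomb M (\<lambda>x. f i x + (\<Sum>i\<in>I. f i x))"
    by (rule lincomb_add) (simp_all add: insert)
  with insert show ?case by simp
qed (simp_all add: lincomb_zero)

text \<open>A single monomial in which each variable occurs once; \<open>Z\<close> names the places
  that are filled with constants.\<close>

definition nform :: "'v set \<Rightarrow> 'v set \<Rightarrow> (('v \<Rightarrow> 'a) \<Rightarrow> 'a) \<Rightarrow> bool" where
  "nform X Z F \<longleftrightarrow> (\<exists>z w. z \<in> Z \<rightarrow> Basis \<and> distinct (map snd w) \<and> snd ` set w = X \<union> Z \<and> w \<noteq> [] \<and>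
     F = (\<lambda>x. ev (\<lambda>i. if i \<in> Z then z i else x i) w))"

text \<open>Variables and constants are split into components and products are expanded. Component
  operators cause no trouble: all values of a monomial lie in one homogeneous component, so such an
  operator either keeps the monomial or kills it.\<close>

lemma gfun_normal_form:
  assumes "gfun X c F" "finite Z" "card Z = c" "Z \<inter> X = {}"
  shows "lincomb (nform X Z) F"
  using assms
proof (induction arbitrary: Z rule: gfun.induct)
  case (gfun_Basis b)
  then obtain \<zeta> where Z: "Z = {\<zeta>}" by (auto simp: card_Suc_eq)
  have "nform {} Z (\<lambda>_. hc t b)" for t
    unfolding nform_def by (intro exI[of _ "\<lambda>_. b"] exI[of _ "[(t, \<zeta>)]"]) (auto simp: Z ev_single gfun_Basis)
  then have "lincomb (nform {} Z) (\<lambda>_. \<Sum>t\<in>Supp. hc t b)"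
    by (intro lincomb_sum lincomb_base)
  then show ?case by (simp add: hc_expand)
next
  case (gfun_var i)
  then have "nform {i} Z (\<lambda>x. hc t (x i))" for t
    unfolding nform_def by (intro exI[of _ "\<lambda>_. undefined"] exI[of _ "[(t, i)]"]) (auto simp: ev_single)
  then have "lincomb (nform {i} Z) (\<lambda>x. \<Sum>t\<in>Supp. hc t (x i))"
    by (intro lincomb_sum lincomb_base)
  then show ?case by (simp add: hc_expand)
next
  case (gfun_hc X c F t)
  have "lincomb (nform X Z) (\<lambda>x. hc t (u x))" if u: "nform X Z u" for u
  proof -
    obtain z w where zw: "w \<noteq> []" "u = (\<lambda>x. ev (\<lambda>i. if i \<in> Z then z i else x i) w)"
      using u by (auto simp: nform_def)
    obtain s where "\<forall>x. ev x w \<in> G s" using ev_homogeneous[OF zw(1)] by blast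
    then have "hc t (u x) = (if t = s then u x else 0)" for x
      unfolding zw(2) by (intro hc_homogeneous) blast
    then show ?thesis using lincomb_base[of "nform X Z", OF u] lincomb_zero[of "nform X Z"]
      by (cases "t = s") auto
  qed
  then show ?case
    by (rule lincomb_bind[OF gfun_hc.IH[OF gfun_hc.prems], where L = "\<lambda>_. hc t", OF _ endo_hc])
next
  case (gfun_mult X c F Y c' H)
  obtain Z1 where Z1: "Z1 \<subseteq> Z" "card Z1 = c" "finite Z1"
    using obtain_subset_with_card_n[of c Z] gfun_mult.prems by auto
  define Z2 where "Z2 = Z - Z1"
  have Z2: "card Z2 = c'" "finite Z2" "Z1 \<union> Z2 = Z" "Z1 \<inter> Z2 = {}"
    using Z1 gfun_mult.prems by (auto simp: Z2_def card_Diff_subset)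
  have base: "nform (X \<union> Y) Z (\<lambda>x. u x * v x)" if "nform X Z1 u" "nform Y Z2 v" for u v
  proof -
    obtain z w where u: "z \<in> Z1 \<rightarrow> Basis" "distinct (map snd w)" "snd ` set w = X \<union> Z1" "w \<noteq> []"
       "u = (\<lambda>x. ev (\<lambda>i. if i \<in> Z1 then z i else x i) w)"
      using \<open>nform X Z1 u\<close> by (auto simp: nform_def)
    obtain z' w' where v: "z' \<in> Z2 \<rightarrow> Basis" "distinct (map snd w')" "snd ` set w' = Y \<union> Z2" "w' \<noteq> []"
       "v = (\<lambda>x. ev (\<lambda>i. if i \<in> Z2 then z' i else x i) w')"
      using \<open>nform Y Z2 v\<close> by (auto simp: nform_def)
    define y where "y = (\<lambda>i. if i \<in> Z1 then z i else z' i)"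
    have "ev (\<lambda>i. if i \<in> Z1 then z i else x i) w = ev (\<lambda>i. if i \<in> Z then y i else x i) w" for x
      by (rule ev_cong) (use u(3) Z2 gfun_mult.prems in \<open>auto simp: y_def\<close>)
    moreover have "ev (\<lambda>i. if i \<in> Z2 then z' i else x i) w' = ev (\<lambda>i. if i \<in> Z then y i else x i) w'" for x
      by (rule ev_cong) (use v(3) Z2 gfun_mult.prems in \<open>auto simp: y_def\<close>)
    ultimately have "(\<lambda>x. u x * v x) = (\<lambda>x. ev (\<lambda>i. if i \<in> Z then y i else x i) (w @ w'))"
      using u(4,5) v(4,5) by (simp add: ev_append)
    moreover have "distinct (map snd (w @ w'))"
    proof -
      have "(X \<union> Z1) \<inter> (Y \<union> Z2) = {}" using Z2 gfun_mult.prems gfun_mult.hyps by auto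
      then show ?thesis using u v by auto
    qed
    moreover have "snd ` set (w @ w') = X \<union> Y \<union> Z" using u v Z2 by auto
    moreover have "y \<in> Z \<rightarrow> Basis" using u(1) v(1) Z2(3) by (auto simp: y_def)
    ultimately show ?thesis unfolding nform_def using u(4)
      by (intro exI[of _ y] exI[of _ "w @ w'"]) auto
  qed
  have "Z1 \<inter> X = {}" "Z2 \<inter> Y = {}" using gfun_mult.prems(3) Z2(3) by auto
  then have F: "lincomb (nform X Z1) F" and H: "lincomb (nform Y Z2) H"
    using gfun_mult.IH Z1(2,3) Z2(1,2) by blast+
  have uH: "lincomb (nform (X \<union> Y) Z) (\<lambda>x. u x * H x)" if u: "nform X Z1 u" for u
  proof (rule lincomb_bind[OF H, where L = "\<lambda>x y. u x * y"])
    show "lincomb (nform (X \<union> Y) Z) (\<lambda>x. u x * v x)" if "nform Y Z2 v" for v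
      by (rule lincomb_base[of "nform (X \<union> Y) Z" "\<lambda>x. u x * v x"]) (rule base[OF u that])
  qed (rule linear_mult_left)
  show ?case
  proof (rule lincomb_bind[OF F, where L = "\<lambda>x y. y * H x"])
    show "lincomb (nform (X \<union> Y) Z) (\<lambda>x. u x * H x)" if "nform X Z1 u" for u
      using that by (rule uH)
  qed (rule linear_mult_right)
next
  case (gfun_add X c F H)
  then show ?case by (simp add: lincomb_add)
next
  case (gfun_scale X c F r)
  then show ?case by (simp add: lincomb_scale)
qed

end

section \<open>Codimensions as numbers of independent functions\<close>

text \<open>A basis of \<open>W\<close> is extended to one of \<open>V\<close>, and the added
  vectors are taken. Codimensions are defined through a chosen system of this kind, so one has to
  exist.\<close>

lemma (in vector_space) ex_quotient_basis:
  assumes "subspace V" "subspace W" "W \<subseteq> V"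
  shows "\<exists>S. quotient_basis scale V W S"
proof -
  obtain C where C: "C \<subseteq> W" "independent C" "W \<subseteq> span C"
    using maximal_independent_subset[of W] by blast
  obtain D where D: "C \<subseteq> D" "D \<subseteq> V" "independent D" "V \<subseteq> span D"
    using maximal_independent_subset_extend[of C V] C assms by blast
  have spC: "span C = W" using C assms(2) by (simp add: span_subspace)
  have "quotient_basis scale V W (D - C)"
    unfolding quotient_basis_def
  proof (intro conjI ballI allI impI)
    show "D - C \<subseteq> V" using D by auto
  next
    fix v assume "v \<in> V"
    then have "v \<in> span ((D - C) \<union> C)" using D by (auto simp: Un_absorb2)
    then obtain x y where "v = x + y" "x \<in> span (D - C)" "y \<in> span C"
      unfolding span_Un by blast
    then show "\<exists>u\<in>span (D - C). v - u \<in> W" using spC by (intro bexI[of _ x]) auto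
  next
    fix S c s assume S: "finite S \<and> S \<subseteq> D - C \<and> (\<Sum>s\<in>S. scale (c s) s) \<in> W" and s: "s \<in> S"
    then have "(\<Sum>s\<in>S. scale (c s) s) \<in> span C" using spC by simp
    then obtain T r where T: "finite T" "T \<subseteq> C" "(\<Sum>s\<in>S. scale (c s) s) = (\<Sum>t\<in>T. scale (r t) t)"
      unfolding span_explicit by blast
    define u where "u = (\<lambda>x. if x \<in> S then c x else - r x)"
    have disj: "S \<inter> T = {}" using S T by auto
    have "(\<Sum>x\<in>S \<union> T. scale (u x) x) = (\<Sum>x\<in>S. scale (u x) x) + (\<Sum>x\<in>T. scale (u x) x)"
      using S T disj by (simp add: sum.union_disjoint)
    also have "(\<Sum>x\<in>S. scale (u x) x) = (\<Sum>s\<in>S. scale (c s) s)"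
      by (intro sum.cong) (auto simp: u_def)
    also have "(\<Sum>x\<in>T. scale (u x) x) = (\<Sum>t\<in>T. - scale (r t) t)"
      by (intro sum.cong) (use disj in \<open>auto simp: u_def\<close>)
    finally have "(\<Sum>x\<in>S \<union> T. scale (u x) x) = 0" using T by (simp add: sum_negf)
    moreover have "S \<union> T \<subseteq> D" "finite (S \<union> T)" using S T D by auto
    ultimately have "u s = 0" using independentD[OF D(3)] s by blast
    then show "c s = 0" using s by (simp add: u_def)
  qed
  then show ?thesis by blast
qed

text \<open>More vectors than functionals admit a nontrivial combination on which all functionals
  vanish, which then lies in \<open>W\<close>. Finiteness of \<open>S\<close> matters as well, since
  an infinite \<open>S\<close> would have cardinality 0.\<close>

lemma (in vector_space) quotient_basis_card_le:
  fixes e :: "'b \<Rightarrow> 'i \<Rightarrow> 'a"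
  assumes S: "quotient_basis scale V W S" and "finite I" and V: "subspace V"
    and lin: "\<And>i. i \<in> I \<Longrightarrow> Vector_Spaces.linear scale (*) (\<lambda>v. e v i)"
    and ker: "\<And>v. v \<in> V \<Longrightarrow> (\<And>i. i \<in> I \<Longrightarrow> e v i = 0) \<Longrightarrow> v \<in> W"
  shows "finite S \<and> card S \<le> card I"
proof -
  have *: "card T \<le> card I" if T: "T \<subseteq> S" "finite T" for T
  proof (rule ccontr)
    assume "\<not> card T \<le> card I"
    then obtain c where c: "\<exists>s\<in>T. c s \<noteq> 0" "\<forall>i\<in>I. (\<Sum>s\<in>T. c s * e s i) = 0"
      using underdetermined_system[OF \<open>finite I\<close> T(2), of e] by (meson not_le)
    have "(\<Sum>s\<in>T. scale (c s) s) \<in> W"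
    proof (rule ker)
      show "(\<Sum>s\<in>T. scale (c s) s) \<in> V"
        using T S V by (intro subspace_sum subspace_scale) (auto simp: quotient_basis_def)
      fix i assume i: "i \<in> I"
      interpret l: Vector_Spaces.linear scale "(*)" "\<lambda>v. e v i" by (rule lin[OF i])
      show "e (\<Sum>s\<in>T. scale (c s) s) i = 0" using c(2) i by (simp add: l.sum l.scale)
    qed
    then have "\<forall>s\<in>T. c s = 0" using S T unfolding quotient_basis_def by blast
    with c show False by auto
  qed
  have "finite S"
  proof (rule ccontr)
    assume "infinite S"
    then obtain T where "T \<subseteq> S" "finite T" "card T = Suc (card I)"
      using infinite_arbitrarily_large by blast
    with *[of T] show False by simp
  qed
  with * show ?thesis by blast
qed

interpretation pvs: vector_space "poly_scale :: 'f::field \<Rightarrow> ('w \<Rightarrow>\<^sub>0 'f) \<Rightarrow> _"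
  by (rule vector_space_poly_scale)

section \<open>Multilinear polynomials evaluated at inhomogeneous tuples\<close>

context graded_algebra
begin

lemma gr_eval_superset:
  "finite S \<Longrightarrow> Poly_Mapping.keys p \<subseteq> S \<Longrightarrow>
    gr_eval scale s p = (\<Sum>w\<in>S. scale (Poly_Mapping.lookup p w) (list_mult (map s w)))"
  unfolding gr_eval_def by (rule sum.mono_neutral_left) (auto simp: in_keys_iff)

lemma linear_gr_eval:
  fixes s :: "'t \<times> nat \<Rightarrow> 'a"
  shows "Vector_Spaces.linear poly_scale scale (gr_eval scale s)"
proof unfold_locales
  fix p q :: "('t, 'f) gr_poly" and c
  let ?S = "Poly_Mapping.keys p \<union> Poly_Mapping.keys q"
  have "gr_eval scale s (p + q) = (\<Sum>w\<in>?S. scale (Poly_Mapping.lookup (p + q) w) (list_mult (map s w)))"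
    by (rule gr_eval_superset) (auto simp: Poly_Mapping.keys_add)
  also have "\<dots> = gr_eval scale s p + gr_eval scale s q"
    by (simp add: gr_eval_superset[of ?S] lookup_add scale_left_distrib sum.distrib)
  finally show "gr_eval scale s (p + q) = gr_eval scale s p + gr_eval scale s q" .
  have "Poly_Mapping.keys (poly_scale c p) \<subseteq> Poly_Mapping.keys p"
    by (auto simp: in_keys_iff)
  then have "gr_eval scale s (poly_scale c p) =
      (\<Sum>w\<in>Poly_Mapping.keys p. scale (Poly_Mapping.lookup (poly_scale c p) w) (list_mult (map s w)))"
    by (intro gr_eval_superset) auto
  also have "\<dots> = scale c (gr_eval scale s p)"
    by (simp add: gr_eval_def scale_sum_right)
  finally show "gr_eval scale s (poly_scale c p) = scale c (gr_eval scale s p)" .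
qed

definition pev :: "(nat \<Rightarrow> 'a) \<Rightarrow> ('t, 'f) gr_poly \<Rightarrow> 'a" where
  "pev x = gr_eval scale (\<lambda>(t, i). hc t (x i))"

lemma linear_pev: "Vector_Spaces.linear poly_scale scale (pev x)"
  unfolding pev_def by (rule linear_gr_eval)

lemma pev_single: "pev x (Poly_Mapping.single w 1) = ev x w"
  unfolding pev_def by (subst gr_eval_superset[of "{w}"]) (auto simp: ev_def)

definition gmonomials :: "nat \<Rightarrow> ('t \<times> nat) list set" where
  "gmonomials n = {w. distinct (map snd w) \<and> snd ` set w = {1..n}}"

lemma gmonomials_length: "w \<in> gmonomials n \<Longrightarrow> length w = n"
  using distinct_card[of "map snd w"] by (simp add: gmonomials_def)

lemma gr_multilinear_eq:
  "(gr_multilinear n :: ('t, 'f) gr_poly set) = pvs.span ((\<lambda>w. Poly_Mapping.single w 1) ` gmonomials n)"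
proof -
  have "{map (\<lambda>j. (t j, \<sigma> j)) [1..<Suc n] | (t :: nat \<Rightarrow> 't) \<sigma>. \<sigma> permutes {1..n}} = gmonomials n"
  proof (intro equalityI subsetI)
    fix w assume "w \<in> {map (\<lambda>j. (t j, \<sigma> j)) [1..<Suc n] | (t :: nat \<Rightarrow> 't) \<sigma>. \<sigma> permutes {1..n}}"
    then obtain t :: "nat \<Rightarrow> 't" and \<sigma> where w: "w = map (\<lambda>j. (t j, \<sigma> j)) [1..<Suc n]" "\<sigma> permutes {1..n}" by blast
    have "map snd w = map \<sigma> [1..<Suc n]" by (simp add: w(1) del: upt_Suc)
    moreover have "inj_on \<sigma> {1..n}" using w(2) by (rule permutes_inj_on)
    moreover have "set [1..<Suc n] = {1..n}" by auto
    moreover have "\<sigma> ` {1..n} = {1..n}" using w(2) by (rule permutes_image)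
    ultimately have "distinct (map snd w)" "set (map snd w) = {1..n}"
      by (simp_all add: distinct_map del: upt_Suc)
    then show "w \<in> gmonomials n" by (simp add: gmonomials_def)
  next
    fix w assume w: "w \<in> gmonomials n"
    then have d: "distinct (map snd w)" "snd ` set w = {1..n}" and len: "length w = n"
      by (auto simp: gmonomials_def gmonomials_length)
    define \<sigma> where "\<sigma> = (\<lambda>j. if j \<in> {1..n} then snd (w ! (j - 1)) else j)"
    define t where "t = (\<lambda>j. fst (w ! (j - 1)))"
    have "bij_betw (\<lambda>i. map snd w ! i) {..<n} {1..n}"
      using bij_betw_nth[OF d(1), of "{..<n}" "{1..n}"] d len by simp
    moreover have "bij_betw (\<lambda>j. j - 1) {1..n} {..<n}"
      by (rule bij_betw_byWitness[where f' = Suc]) auto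
    ultimately have "bij_betw ((\<lambda>i. map snd w ! i) \<circ> (\<lambda>j. j - 1)) {1..n} {1..n}"
      by (rule bij_betw_trans[rotated])
    then have "bij_betw \<sigma> {1..n} {1..n}"
      by (rule bij_betw_cong[THEN iffD1, rotated]) (auto simp: \<sigma>_def len)
    then have "\<sigma> permutes {1..n}" by (rule bij_imp_permutes) (auto simp: \<sigma>_def)
    moreover have "w = map (\<lambda>j. (t j, \<sigma> j)) [1..<Suc n]"
      by (rule nth_equalityI) (auto simp: len t_def \<sigma>_def simp del: upt_Suc)
    ultimately show "w \<in> {map (\<lambda>j. (t j, \<sigma> j)) [1..<Suc n] | (t :: nat \<Rightarrow> 't) \<sigma>. \<sigma> permutes {1..n}}" by blast
  qed
  moreover have "{Poly_Mapping.single (map (\<lambda>j. (t j, \<sigma> j)) [1..<Suc n]) (1::'f) | (t :: nat \<Rightarrow> 't) \<sigma>. \<sigma> permutes {1..n}} =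
      (\<lambda>w. Poly_Mapping.single w 1) ` {map (\<lambda>j. (t j, \<sigma> j)) [1..<Suc n] | (t :: nat \<Rightarrow> 't) \<sigma>. \<sigma> permutes {1..n}}"
    by blast
  ultimately show ?thesis unfolding gr_multilinear_def by simp
qed

lemma gr_multilinear_keys:
  fixes p :: "('t, 'f) gr_poly"
  assumes "p \<in> gr_multilinear n" shows "Poly_Mapping.keys p \<subseteq> gmonomials n"
  using assms unfolding gr_multilinear_eq
proof (induction rule: pvs.span_induct_alt)
  case (step c x y)
  then obtain w where w: "w \<in> gmonomials n" "x = Poly_Mapping.single w 1" by blast
  have "Poly_Mapping.keys (poly_scale c x) \<subseteq> {w}" by (auto simp: w(2) in_keys_iff lookup_single when_def split: if_splits)
  with step w(1) show ?case using Poly_Mapping.keys_add[of "poly_scale c x" y] by blast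
qed simp

lemma gr_multilinear_expand:
  "pev x p = (\<Sum>w\<in>Poly_Mapping.keys p. scale (Poly_Mapping.lookup p w) (ev x w))"
  by (simp add: pev_def gr_eval_def ev_def)

lemma identity_iff:
  assumes "p \<in> gr_multilinear n" "1 \<le> n"
  shows "p \<in> gr_identities scale G \<longleftrightarrow> (\<forall>x. pev x p = 0)"
proof
  assume p: "p \<in> gr_identities scale G"
  show "\<forall>x. pev x p = 0"
  proof
    fix x :: "nat \<Rightarrow> 'a"
    have "\<forall>t i. (\<lambda>(t, i). hc t (x i)) (t, i) \<in> G t" by (simp add: hc_in)
    then show "pev x p = 0" using p unfolding gr_identities_def pev_def by blast
  qed
next
  assume p: "\<forall>x. pev x p = 0"
  have "[] \<notin> gmonomials n" using assms(2) by (auto simp: gmonomials_def)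
  then have "[] \<notin> Poly_Mapping.keys p" using gr_multilinear_keys[OF assms(1)] by blast
  moreover have "gr_eval scale s p = 0" if s: "\<forall>t i. s (t, i) \<in> G t" for s
  proof -
    \<comment> \<open>Only finitely many degrees occur in \<open>p\<close>, so the values
      \<open>s (t, i)\<close> with the same \<open>i\<close> can be collected in a single element
      \<open>x i\<close>, whose components give them back.\<close>
    define T where "T = (\<Union>w\<in>Poly_Mapping.keys p. fst ` set w)"
    have fin: "finite T" by (simp add: T_def)
    define x where "x = (\<lambda>i. \<Sum>t\<in>T. s (t, i))"
    have "hc t (x i) = (if t \<in> T then s (t, i) else 0)" for t i
      by (rule hc_eqI[OF fin]) (use s in \<open>auto simp: x_def subspace_0[OF subspace_G]\<close>)
    then have "map (\<lambda>(t, i). hc t (x i)) w = map s w" if "w \<in> Poly_Mapping.keys p" for w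
    proof -
      have "fst v \<in> T" if "v \<in> set w" for v
        unfolding T_def using \<open>w \<in> Poly_Mapping.keys p\<close> that by blast
      then show ?thesis using \<open>\<And>t i. hc t (x i) = (if t \<in> T then s (t, i) else 0)\<close>
        by (auto simp: case_prod_beta)
    qed
    then have "gr_eval scale s p = pev x p"
      unfolding gr_eval_def pev_def by (intro sum.cong) (simp_all only:)
    then show ?thesis using p by simp
  qed
  ultimately show "p \<in> gr_identities scale G" by (simp add: gr_identities_def)
qed

lemma pev_cong:
  assumes "p \<in> gr_multilinear n" "\<And>i. i \<in> {1..n} \<Longrightarrow> x i = y i"
  shows "pev x p = pev y p"
proof -
  have "ev x w = ev y w" if "w \<in> Poly_Mapping.keys p" for w
  proof -
    have "w \<in> gmonomials n" using that gr_multilinear_keys[OF assms(1)] by blast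
    then have "snd ` set w = {1..n}" by (simp add: gmonomials_def)
    then show ?thesis using assms(2) by (intro ev_cong) simp
  qed
  then show ?thesis by (simp add: gr_multilinear_expand)
qed

lemma pev_linear:
  assumes "p \<in> gr_multilinear n" "i \<in> {1..n}" shows "endo (\<lambda>a. pev (x(i := a)) p)"
proof -
  have l: "endo (\<lambda>a. ev (x(i := a)) w)" if "w \<in> Poly_Mapping.keys p" for w
  proof -
    have "w \<in> gmonomials n" using that gr_multilinear_keys[OF assms(1)] by blast
    then show ?thesis using assms(2) by (intro ev_linear) (simp_all add: gmonomials_def)
  qed
  show ?thesis
  proof unfold_locales
    fix a b and c
    have *: "ev (x(i := a + b)) w = ev (x(i := a)) w + ev (x(i := b)) w"
      "ev (x(i := scale c a)) w = scale c (ev (x(i := a)) w)" if "w \<in> Poly_Mapping.keys p" for w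
    proof -
      interpret l: Vector_Spaces.linear scale scale "\<lambda>a. ev (x(i := a)) w" by (rule l[OF that])
      show "ev (x(i := a + b)) w = ev (x(i := a)) w + ev (x(i := b)) w"
        "ev (x(i := scale c a)) w = scale c (ev (x(i := a)) w)" by (rule l.add l.scale)+
    qed
    have "(\<Sum>w\<in>Poly_Mapping.keys p. scale (Poly_Mapping.lookup p w) (ev (x(i := a + b)) w)) =
      (\<Sum>w\<in>Poly_Mapping.keys p. scale (Poly_Mapping.lookup p w) (ev (x(i := a)) w) +
         scale (Poly_Mapping.lookup p w) (ev (x(i := b)) w))"
      by (rule sum.cong) (simp_all only: *(1) scale_right_distrib)
    then show "pev (x(i := a + b)) p = pev (x(i := a)) p + pev (x(i := b)) p"
      by (simp only: gr_multilinear_expand sum.distrib)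
    have "(\<Sum>w\<in>Poly_Mapping.keys p. scale (Poly_Mapping.lookup p w) (ev (x(i := scale c a)) w)) =
      (\<Sum>w\<in>Poly_Mapping.keys p. scale c (scale (Poly_Mapping.lookup p w) (ev (x(i := a)) w)))"
      by (rule sum.cong[OF refl], subst *(2)) (simp_all only: scale_left_commute)
    then show "pev (x(i := scale c a)) p = scale c (pev (x(i := a)) p)"
      by (simp only: gr_multilinear_expand scale_sum_right)
  qed
qed

text \<open>By multilinearity the arguments are replaced one at a time by elements of
  \<open>E\<close>; in the induction, \<open>Y\<close> is the set of indices at which the argument
  is still arbitrary.\<close>

lemma pev_eq_0_spanning:
  assumes p: "p \<in> gr_multilinear n" and E: "span E = UNIV"
    and zero: "\<And>x. x \<in> {1..n} \<rightarrow>\<^sub>E E \<Longrightarrow> pev x p = 0"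
  shows "pev x p = 0"
proof -
  have *: "pev x p = 0" if "finite Y" "Y \<subseteq> {1..n}" "\<And>i. i \<in> {1..n} - Y \<Longrightarrow> x i \<in> E" for Y x
    using that
  proof (induction Y arbitrary: x rule: finite_induct)
    case empty
    have "pev (restrict x {1..n}) p = 0" by (rule zero) (use empty in auto)
    moreover have "pev (restrict x {1..n}) p = pev x p" by (rule pev_cong[OF p]) simp
    ultimately show ?case by simp
  next
    case (insert i Y)
    have i: "i \<in> {1..n}" using insert by simp
    interpret l: Vector_Spaces.linear scale scale "\<lambda>a. pev (x(i := a)) p" by (rule pev_linear[OF p i])
    have "pev (x(i := e)) p = 0" if "e \<in> E" for e
      by (rule insert.IH) (use insert.prems that in auto)
    then have "pev (x(i := a)) p = 0" if "a \<in> span E" for a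
      using l.eq_0_on_span[of E a] that by blast
    from this[of "x i"] show ?case using E by simp
  qed
  show ?thesis by (rule *[of "{1..n}"]) auto
qed

definition qbasis :: "nat \<Rightarrow> ('t, 'f) gr_poly set" where
  "qbasis n = (SOME S. quotient_basis poly_scale (gr_multilinear n) (gr_multilinear n \<inter> gr_identities scale G) S)"

lemma gr_codim_eq: "gr_codim scale G n = card (qbasis n)"
  by (simp add: gr_codim_def quotient_dim_def qbasis_def)

lemma subspace_identities:
  assumes "1 \<le> n" shows "pvs.subspace (gr_multilinear n \<inter> gr_identities scale G)"
proof -
  have eq: "gr_multilinear n \<inter> gr_identities scale G = gr_multilinear n \<inter> {p. \<forall>x. pev x p = 0}"
    using identity_iff[OF _ assms] by blast
  have "pvs.subspace {p. \<forall>x. pev x p = 0}"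
  proof -
    have "pvs.subspace {p. pev x p = 0}" for x
    proof -
      interpret l: Vector_Spaces.linear poly_scale scale "pev x" by (rule linear_pev)
      show ?thesis by (rule l.subspace_kernel)
    qed
    then have "pvs.subspace (\<Inter>x. {p. pev x p = 0})" by (intro pvs.subspace_Inter) auto
    moreover have "(\<Inter>x. {p. pev x p = 0}) = {p. \<forall>x. pev x p = 0}" by auto
    ultimately show ?thesis by simp
  qed
  moreover have "pvs.subspace (gr_multilinear n :: ('t, 'f) gr_poly set)" by (simp add: gr_multilinear_eq)
  ultimately show ?thesis by (subst eq) (rule pvs.subspace_inter)
qed

lemma qbasis:
  assumes "1 \<le> n"
  shows "quotient_basis poly_scale (gr_multilinear n) (gr_multilinear n \<inter> gr_identities scale G) (qbasis n)"
  unfolding qbasis_def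
proof (rule someI_ex, rule pvs.ex_quotient_basis)
  show "pvs.subspace (gr_multilinear n :: ('t, 'f) gr_poly set)" by (simp add: gr_multilinear_eq)
qed (simp_all add: subspace_identities[OF assms])

text \<open>The coordinates of the values at the tuples in \<open>X\<close> are
  \<open>card X * card Basis\<close> functionals that together detect the identities.\<close>

lemma qbasis_card_le:
  assumes "1 \<le> n" "finite X"
    and zero: "\<And>p. p \<in> gr_multilinear n \<Longrightarrow> (\<And>x. x \<in> X \<Longrightarrow> pev x p = 0) \<Longrightarrow> \<forall>x. pev x p = 0"
  shows "finite (qbasis n)" "gr_codim scale G n \<le> card X * card Basis"
proof -
  have lin: "Vector_Spaces.linear poly_scale (*) (\<lambda>p. coord (snd xb) (pev (fst xb) p))" for xb
  proof -
    interpret l: Vector_Spaces.linear poly_scale scale "pev (fst xb)" by (rule linear_pev)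
    show ?thesis by unfold_locales (auto simp: l.add l.scale coord_add coord_scale algebra_simps)
  qed
  have "finite (qbasis n) \<and> card (qbasis n) \<le> card (X \<times> Basis)"
  proof (rule pvs.quotient_basis_card_le[OF qbasis[OF assms(1)],
      where e = "\<lambda>p xb. coord (snd xb) (pev (fst xb) p)"])
    show "finite (X \<times> Basis)" using assms(2) finite_Basis by simp
    show "pvs.subspace (gr_multilinear n :: ('t, 'f) gr_poly set)" by (simp add: gr_multilinear_eq)
    show "Vector_Spaces.linear poly_scale (*) (\<lambda>p. coord (snd xb) (pev (fst xb) p))" for xb by (rule lin)
    fix p assume p: "p \<in> gr_multilinear n"
      and 0: "\<And>i. i \<in> X \<times> Basis \<Longrightarrow> coord (snd i) (pev (fst i) p) = 0"
    have "pev x p = 0" if "x \<in> X" for x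
      by (rule coord_eqI) (use 0[of "(x, _)"] that in simp)
    then show "p \<in> gr_multilinear n \<inter> gr_identities scale G"
      using zero[OF p] p identity_iff[OF p assms(1)] by blast
  qed
  then show "finite (qbasis n)" "gr_codim scale G n \<le> card X * card Basis"
    by (auto simp: gr_codim_eq card_cartesian_product)
qed

lemma finite_qbasis:
  assumes "1 \<le> n" shows "finite (qbasis n)"
proof (rule qbasis_card_le(1)[OF assms])
  show "finite ({1..n} \<rightarrow>\<^sub>E Basis)" by (intro finite_PiE) (auto simp: finite_Basis)
qed (use pev_eq_0_spanning[OF _ span_Basis] in blast)

lemma pev_qbasis:
  assumes "1 \<le> n" "p \<in> gr_multilinear n"
  shows "\<exists>c. \<forall>x. pev x p = (\<Sum>u\<in>qbasis n. scale (c u) (pev x u))"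
proof -
  obtain v where v: "v \<in> pvs.span (qbasis n)" "p - v \<in> gr_multilinear n \<inter> gr_identities scale G"
    using qbasis[OF assms(1)] assms(2) unfolding quotient_basis_def by blast
  obtain c where c: "v = (\<Sum>u\<in>qbasis n. poly_scale (c u) u)"
    using v(1) pvs.span_finite[OF finite_qbasis[OF assms(1)]] by auto
  have "pev x p = (\<Sum>u\<in>qbasis n. scale (c u) (pev x u))" for x
  proof -
    interpret l: Vector_Spaces.linear poly_scale scale "pev x" by (rule linear_pev)
    have "pev x (p - v) = 0" using v(2) identity_iff[of "p - v" n] assms(1) by auto
    then have "pev x p = pev x v" by (simp add: l.diff)
    then show ?thesis by (simp add: c l.sum l.scale)
  qed
  then show ?thesis by blast
qed

text \<open>Every \<open>F s\<close> is a linear combination of functions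
  \<open>pev (ov z x) u\<close> of \<open>x\<close>, with \<open>z\<close> an assignment of basis
  elements to the \<open>c\<close> constants and \<open>u\<close> in a basis modulo identities.
  There are at most \<open>card Basis ^ c * gr_codim scale G (k + c)\<close> of these, so no more of
  the \<open>F s\<close> can be independent.\<close>

lemma codim_lower_bound:
  fixes F :: "'s \<Rightarrow> (nat \<Rightarrow> 'a) \<Rightarrow> 'a"
  assumes "finite S" and gf: "\<And>s. s \<in> S \<Longrightarrow> gfun {1..k} c (F s)" and n: "1 \<le> k + c"
    and indep: "\<And>a. (\<And>x. (\<Sum>s\<in>S. scale (a s) (F s x)) = 0) \<Longrightarrow> \<forall>s\<in>S. a s = 0"
  shows "card S \<le> card Basis ^ c * gr_codim scale G (k + c)"
proof -
  define Z where "Z = {k + 1..k + c}"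
  define Zs where "Zs = Z \<rightarrow>\<^sub>E Basis"
  define ov where "ov = (\<lambda>(z :: nat \<Rightarrow> 'a) x i. if i \<in> Z then z i else x i)"
  let ?S = "qbasis (k + c)"
  have fin: "finite Zs" "finite ?S"
    using finite_qbasis[OF n] finite_Basis by (auto simp: Zs_def Z_def intro!: finite_PiE)
  have cardZs: "card Zs = card Basis ^ c" by (simp add: Zs_def Z_def card_PiE)
  have rep: "\<exists>a. \<forall>x. F s x = (\<Sum>z\<in>Zs. \<Sum>u\<in>?S. scale (a z u) (pev (ov z x) u))" if "s \<in> S" for s
  proof -
    have "lincomb (nform {1..k} Z) (F s)"
      by (rule gfun_normal_form[OF gf[OF that]]) (auto simp: Z_def)
    then show ?thesis
    proof (induction rule: lincomb.induct)
      case lincomb_zero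
      then show ?case by (intro exI[of _ "\<lambda>_ _. 0"]) simp
    next
      case (lincomb_step f g r)
      then obtain a where a: "\<And>x. g x = (\<Sum>z\<in>Zs. \<Sum>u\<in>?S. scale (a z u) (pev (ov z x) u))" by blast
      obtain z w where zw: "z \<in> Z \<rightarrow> Basis" "distinct (map snd w)" "snd ` set w = {1..k} \<union> Z"
          "f = (\<lambda>x. ev (\<lambda>i. if i \<in> Z then z i else x i) w)"
        using lincomb_step(1) by (auto simp: nform_def)
      define z' where "z' = restrict z Z"
      have z': "z' \<in> Zs" using zw(1) by (auto simp: Zs_def z'_def)
      have "{1..k} \<union> Z = {1..k + c}" by (auto simp: Z_def)
      then have w: "w \<in> gmonomials (k + c)" using zw by (auto simp: gmonomials_def)
      then have "Poly_Mapping.single w (1 :: 'f) \<in> gr_multilinear (k + c)"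
        unfolding gr_multilinear_eq by (intro pvs.span_base) blast
      from pev_qbasis[OF n this] obtain b where
        b: "\<And>x. ev x w = (\<Sum>u\<in>?S. scale (b u) (pev x u))" by (auto simp: pev_single)
      have "ov z' x = (\<lambda>i. if i \<in> Z then z i else x i)" for x by (auto simp: ov_def z'_def)
      then have f: "f x = (\<Sum>u\<in>?S. scale (b u) (pev (ov z' x) u))" for x
        unfolding zw(4) by (subst b) simp
      define a' where "a' = (\<lambda>y u. (if y = z' then r * b u else 0) + a y u)"
      have "scale r (f x) + g x = (\<Sum>z\<in>Zs. \<Sum>u\<in>?S. scale (a' z u) (pev (ov z x) u))" for x
      proof -
        have "(\<Sum>y\<in>Zs. \<Sum>u\<in>?S. scale (if y = z' then r * b u else 0) (pev (ov y x) u)) =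
          (\<Sum>y\<in>Zs. if y = z' then \<Sum>u\<in>?S. scale (r * b u) (pev (ov z' x) u) else 0)"
          by (intro sum.cong) auto
        also have "\<dots> = scale r (f x)" using fin z' by (simp add: f scale_sum_right)
        finally show ?thesis by (simp add: a'_def scale_left_distrib sum.distrib a)
      qed
      then show ?case by blast
    qed
  qed
  then have "\<forall>s\<in>S. \<exists>a. \<forall>x. F s x = (\<Sum>z\<in>Zs. \<Sum>u\<in>?S. scale (a z u) (pev (ov z x) u))" by blast
  from bchoice[OF this] obtain a where
    a: "\<And>s x. s \<in> S \<Longrightarrow> F s x = (\<Sum>z\<in>Zs. \<Sum>u\<in>?S. scale (a s z u) (pev (ov z x) u))" by blast
  show ?thesis
  proof (rule ccontr)
    assume "\<not> ?thesis"
    then have "card (Zs \<times> ?S) < card S" by (simp add: gr_codim_eq cardZs card_cartesian_product)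
    then obtain d where d: "\<exists>s\<in>S. d s \<noteq> 0" "\<forall>zu\<in>Zs \<times> ?S. (\<Sum>s\<in>S. d s * a s (fst zu) (snd zu)) = 0"
      using underdetermined_system[OF _ assms(1), of "Zs \<times> ?S" "\<lambda>s zu. a s (fst zu) (snd zu)"] fin by auto
    have "(\<Sum>s\<in>S. scale (d s) (F s x)) = 0" for x
    proof -
      have "(\<Sum>s\<in>S. scale (d s) (F s x)) =
          (\<Sum>s\<in>S. \<Sum>z\<in>Zs. \<Sum>u\<in>?S. scale (d s * a s z u) (pev (ov z x) u))"
        by (intro sum.cong refl) (simp add: a scale_sum_right)
      also have "\<dots> = (\<Sum>z\<in>Zs. \<Sum>s\<in>S. \<Sum>u\<in>?S. scale (d s * a s z u) (pev (ov z x) u))"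
        by (rule sum.swap)
      also have "\<dots> = (\<Sum>z\<in>Zs. \<Sum>u\<in>?S. \<Sum>s\<in>S. scale (d s * a s z u) (pev (ov z x) u))"
        by (intro sum.cong refl sum.swap)
      also have "\<dots> = (\<Sum>z\<in>Zs. \<Sum>u\<in>?S. scale (\<Sum>s\<in>S. d s * a s z u) (pev (ov z x) u))"
        by (simp add: scale_sum_left)
      also have "\<dots> = 0" using d(2) by (intro sum.neutral ballI) auto
      finally show ?thesis .
    qed
    from indep[OF this] d(1) show False by blast
  qed
qed

end

section \<open>The rank of permutation incidence vectors\<close>

lemma square_sum_le:
  fixes f :: "'i \<Rightarrow> real"
  assumes "finite I" shows "(\<Sum>i\<in>I. f i)\<^sup>2 \<le> real (card I) * (\<Sum>i\<in>I. (f i)\<^sup>2)"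
proof -
  have "0 \<le> (\<Sum>i\<in>I. \<Sum>j\<in>I. (f i - f j)\<^sup>2)" by (intro sum_nonneg) simp
  also have "\<dots> = (\<Sum>i\<in>I. \<Sum>j\<in>I. (f i)\<^sup>2 + (f j)\<^sup>2 - 2 * (f i * f j))"
    by (intro sum.cong refl) (simp add: power2_diff)
  also have "\<dots> = 2 * (real (card I) * (\<Sum>i\<in>I. (f i)\<^sup>2)) - 2 * (\<Sum>i\<in>I. \<Sum>j\<in>I. f i * f j)"
    by (simp add: sum_subtractf sum.distrib sum_distrib_left)
  also have "(\<Sum>i\<in>I. \<Sum>j\<in>I. f i * f j) = (\<Sum>i\<in>I. f i)\<^sup>2"
    by (simp add: power2_eq_square sum_product)
  finally show ?thesis by simp
qed

text \<open>Gram-Schmidt: the vectors \<open>u\<close> are an orthonormal basis of the span of all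
  \<open>v s\<close>, and \<open>S\<close> collects the indices at which the process meets a new
  direction.\<close>

lemma ex_orthonormal_coordinates:
  fixes v :: "'s \<Rightarrow> 'x \<Rightarrow> real"
  assumes "finite X" "finite S0"
  shows "\<exists>S u a. S \<subseteq> S0 \<and>
    (\<forall>c. (\<forall>x\<in>X. (\<Sum>s\<in>S. c s * v s x) = 0) \<longrightarrow> (\<forall>s\<in>S. c s = 0)) \<and>
    (\<forall>s\<in>S0. \<forall>x\<in>X. v s x = (\<Sum>k<card S. a s k * u k x)) \<and>
    (\<forall>k<card S. \<forall>l<card S. (\<Sum>x\<in>X. u k x * u l x) = (if k = l then 1 else 0))"
  using assms(2)
proof (induction S0 rule: finite_induct)
  case empty
  show ?case by (intro exI[of _ "{}"]) auto
next
  case (insert s0 S0)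
  then obtain S u a where IH: "S \<subseteq> S0"
    "\<And>c. (\<forall>x\<in>X. (\<Sum>s\<in>S. c s * v s x) = 0) \<Longrightarrow> (\<forall>s\<in>S. c s = 0)"
    "\<And>s x. s \<in> S0 \<Longrightarrow> x \<in> X \<Longrightarrow> v s x = (\<Sum>k<card S. a s k * u k x)"
    "\<And>k l. k < card S \<Longrightarrow> l < card S \<Longrightarrow> (\<Sum>x\<in>X. u k x * u l x) = (if k = l then 1 else 0)"
    by blast
  define r where "r = card S"
  have finS: "finite S" using IH(1) insert(1) by (rule finite_subset)
  define b where "b = (\<lambda>k. \<Sum>x\<in>X. v s0 x * u k x)"
  define w where "w = (\<lambda>x. v s0 x - (\<Sum>k<r. b k * u k x))"
  show ?case
  proof (cases "\<forall>x\<in>X. w x = 0")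
    case True
    define a' where "a' = a(s0 := b)"
    have "v s x = (\<Sum>k<card S. a' s k * u k x)" if "s \<in> insert s0 S0" "x \<in> X" for s x
      using that True IH(3)[of s x] by (cases "s = s0") (auto simp: a'_def w_def r_def)
    with IH show ?thesis by (intro exI[of _ S] exI[of _ u] exI[of _ a']) auto
  next
    case False
    then obtain x0 where x0: "x0 \<in> X" "w x0 \<noteq> 0" by blast
    define N where "N = (\<Sum>x\<in>X. w x * w x)"
    have "0 < w x0 * w x0" using x0(2) by (simp add: zero_less_mult_iff) linarith
    also have "\<dots> \<le> N" unfolding N_def by (rule member_le_sum) (use x0 assms in auto)
    finally have N: "0 < N" .
    have s0: "s0 \<notin> S" using IH(1) insert(2) by auto
    then have card: "card (insert s0 S) = Suc r" using finS by (simp add: r_def)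
    define u' where "u' = u(r := (\<lambda>x. w x / sqrt N))"
    define a' where "a' = (\<lambda>s k. if s = s0 then (if k = r then sqrt N else b k) else if k = r then 0 else a s k)"
    have wu: "(\<Sum>x\<in>X. w x * u l x) = 0" if "l < r" for l
    proof -
      have "(\<Sum>x\<in>X. w x * u l x) = b l - (\<Sum>x\<in>X. \<Sum>k<r. b k * (u k x * u l x))"
        by (simp add: w_def left_diff_distrib sum_subtractf b_def sum_distrib_right mult.assoc)
      also have "(\<Sum>x\<in>X. \<Sum>k<r. b k * (u k x * u l x)) = (\<Sum>k<r. b k * (\<Sum>x\<in>X. u k x * u l x))"
        by (subst sum.swap) (simp add: sum_distrib_left)
      also have "\<dots> = (\<Sum>k<r. if k = l then b k else 0)"
        by (intro sum.cong refl) (use that IH(4) in \<open>auto simp: r_def\<close>)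
      also have "\<dots> = b l" using that by simp
      finally show ?thesis by simp
    qed
    have orth: "(\<Sum>x\<in>X. u' k x * u' l x) = (if k = l then 1 else 0)" if kl: "k < Suc r" "l < Suc r" for k l
    proof -
      consider "k < r" "l < r" | "k = r" "l < r" | "k < r" "l = r" | "k = r" "l = r"
        using kl by (auto simp: less_Suc_eq)
      then show ?thesis
      proof cases
        case 1 then show ?thesis using IH(4)[of k l] by (simp add: u'_def r_def)
      next
        case 2
        then have "(\<Sum>x\<in>X. u' k x * u' l x) = (\<Sum>x\<in>X. w x * u l x) / sqrt N"
          by (simp add: u'_def sum_divide_distrib)
        then show ?thesis using 2 wu by simp
      next
        case 3
        then have "(\<Sum>x\<in>X. u' k x * u' l x) = (\<Sum>x\<in>X. w x * u k x) / sqrt N"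
          by (simp add: u'_def sum_divide_distrib mult.commute)
        then show ?thesis using 3 wu by simp
      next
        case 4
        then have "(\<Sum>x\<in>X. u' k x * u' l x) = (\<Sum>x\<in>X. w x * w x) / (sqrt N * sqrt N)"
          by (simp add: u'_def sum_divide_distrib)
        then show ?thesis using 4 N unfolding N_def[symmetric] by simp
      qed
    qed
    have rep: "v s x = (\<Sum>k<Suc r. a' s k * u' k x)" if "s \<in> insert s0 S0" "x \<in> X" for s x
    proof (cases "s = s0")
      case True
      have "(\<Sum>k<Suc r. a' s k * u' k x) = (\<Sum>k<r. a' s k * u' k x) + w x"
        using N by (simp add: a'_def u'_def True)
      also have "(\<Sum>k<r. a' s k * u' k x) = (\<Sum>k<r. b k * u k x)"
        by (intro sum.cong) (auto simp: a'_def u'_def True)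
      finally show ?thesis by (simp add: True w_def)
    next
      case False
      have "(\<Sum>k<Suc r. a' s k * u' k x) = (\<Sum>k<r. a' s k * u' k x)"
        by (simp add: a'_def False)
      also have "\<dots> = (\<Sum>k<r. a s k * u k x)"
        by (intro sum.cong) (auto simp: a'_def u'_def False)
      finally show ?thesis using IH(3)[of s x] that False by (simp add: r_def)
    qed
    have indep: "\<forall>s\<in>insert s0 S. c s = 0" if c: "\<forall>x\<in>X. (\<Sum>s\<in>insert s0 S. c s * v s x) = 0" for c
    proof -
      have c': "c s0 * v s0 x + (\<Sum>s\<in>S. c s * v s x) = 0" if "x \<in> X" for x
        using c that s0 finS by simp
      have "c s0 * w x = 0 * w x" if x: "x \<in> X" for x
      proof -
        define e where "e = (\<lambda>k. c s0 * b k + (\<Sum>s\<in>S. c s * a s k))"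
        have e: "c s0 * w y + (\<Sum>k<r. e k * u k y) = 0" if "y \<in> X" for y
        proof -
          have "(\<Sum>s\<in>S. c s * v s y) = (\<Sum>s\<in>S. \<Sum>k<r. c s * a s k * u k y)"
            using IH(1) by (intro sum.cong refl) (auto simp: IH(3)[OF _ that] r_def sum_distrib_left mult.assoc)
          also have "\<dots> = (\<Sum>k<r. (\<Sum>s\<in>S. c s * a s k) * u k y)"
            by (subst sum.swap) (simp add: sum_distrib_right)
          finally have "(\<Sum>k<r. e k * u k y) = c s0 * (\<Sum>k<r. b k * u k y) + (\<Sum>s\<in>S. c s * v s y)"
            by (simp add: e_def distrib_right sum.distrib sum_distrib_left mult.assoc)
          then show ?thesis using c'[OF that] by (simp add: w_def algebra_simps)
        qed
        \<comment> \<open>Pairing the relation with \<open>w\<close>, which is orthogonal to all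
          earlier \<open>u k\<close>, isolates the coefficient of \<open>s0\<close>.\<close>
        have "0 = (\<Sum>y\<in>X. w y * (c s0 * w y + (\<Sum>k<r. e k * u k y)))" by (simp add: e)
        also have "\<dots> = c s0 * N + (\<Sum>y\<in>X. \<Sum>k<r. e k * (w y * u k y))"
          by (simp add: distrib_left sum.distrib N_def sum_distrib_left algebra_simps)
        also have "(\<Sum>y\<in>X. \<Sum>k<r. e k * (w y * u k y)) = (\<Sum>k<r. e k * (\<Sum>y\<in>X. w y * u k y))"
          by (subst sum.swap) (simp add: sum_distrib_left)
        also have "\<dots> = 0" by (simp add: wu)
        finally have "c s0 = 0" using N by simp
        then show ?thesis by simp
      qed
      from this[OF x0(1)] have "c s0 = 0" using x0(2) by simp
      moreover from this have "\<forall>x\<in>X. (\<Sum>s\<in>S. c s * v s x) = 0" using c' by simp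
      ultimately show ?thesis using IH(2)[of c] by auto
    qed
    have "insert s0 S \<subseteq> insert s0 S0" using IH(1) by auto
    then show ?thesis using indep rep orth unfolding card[symmetric]
      by (intro exI[of _ "insert s0 S"] exI[of _ u'] exI[of _ a']) blast
  qed
qed

text \<open>The inequality between trace, rank and trace of the square of a Gram matrix. The
  \<open>r\<close> by \<open>r\<close> matrix \<open>M\<close>, built from orthonormal coordinates,
  has the same trace and the same sum of squared entries as the Gram matrix, and for
  \<open>M\<close> the claim is Cauchy-Schwarz on the diagonal.\<close>

lemma rank_lower_bound:
  fixes v :: "'s \<Rightarrow> 'x \<Rightarrow> real"
  assumes "finite X" "finite S0"
  shows "\<exists>S\<subseteq>S0. (\<forall>c. (\<forall>x\<in>X. (\<Sum>s\<in>S. c s * v s x) = 0) \<longrightarrow> (\<forall>s\<in>S. c s = 0)) \<and>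
    (\<Sum>s\<in>S0. \<Sum>x\<in>X. v s x * v s x)\<^sup>2
      \<le> real (card S) * (\<Sum>s\<in>S0. \<Sum>t\<in>S0. (\<Sum>x\<in>X. v s x * v t x)\<^sup>2)"
proof -
  obtain S u a where S: "S \<subseteq> S0"
    "\<forall>c. (\<forall>x\<in>X. (\<Sum>s\<in>S. c s * v s x) = 0) \<longrightarrow> (\<forall>s\<in>S. c s = 0)"
    and v: "\<And>s x. s \<in> S0 \<Longrightarrow> x \<in> X \<Longrightarrow> v s x = (\<Sum>k<card S. a s k * u k x)"
    and u: "\<And>k l. k < card S \<Longrightarrow> l < card S \<Longrightarrow> (\<Sum>x\<in>X. u k x * u l x) = (if k = l then 1 else 0)"
    using ex_orthonormal_coordinates[OF assms, of v] by blast
  define r where "r = card S"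
  have ip: "(\<Sum>x\<in>X. v s x * v t x) = (\<Sum>k<r. a s k * a t k)" if "s \<in> S0" "t \<in> S0" for s t
  proof -
    have "(\<Sum>x\<in>X. v s x * v t x) = (\<Sum>x\<in>X. \<Sum>k<r. \<Sum>l<r. a s k * a t l * (u k x * u l x))"
      by (intro sum.cong refl) (simp add: v that sum_product mult_ac flip: r_def)
    also have "\<dots> = (\<Sum>k<r. \<Sum>x\<in>X. \<Sum>l<r. a s k * a t l * (u k x * u l x))" by (rule sum.swap)
    also have "\<dots> = (\<Sum>k<r. \<Sum>l<r. \<Sum>x\<in>X. a s k * a t l * (u k x * u l x))"
      by (intro sum.cong refl sum.swap)
    also have "\<dots> = (\<Sum>k<r. \<Sum>l<r. if k = l then a s k * a t l else 0)"
      by (intro sum.cong refl) (simp add: u r_def flip: sum_distrib_left)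
    also have "\<dots> = (\<Sum>k<r. a s k * a t k)" by simp
    finally show ?thesis .
  qed
  define M where "M = (\<lambda>k l. \<Sum>s\<in>S0. a s k * a s l)"
  have "(\<Sum>s\<in>S0. \<Sum>x\<in>X. v s x * v s x) = (\<Sum>k<r. M k k)"
    unfolding M_def by (subst sum.swap) (simp add: ip)
  then have "(\<Sum>s\<in>S0. \<Sum>x\<in>X. v s x * v s x)\<^sup>2 \<le> real r * (\<Sum>k<r. (M k k)\<^sup>2)"
    using square_sum_le[of "{..<r}" "\<lambda>k. M k k"] by simp
  also have "(\<Sum>k<r. (M k k)\<^sup>2) \<le> (\<Sum>k<r. \<Sum>l<r. (M k l)\<^sup>2)"
  proof (rule sum_mono)
    fix k assume "k \<in> {..<r}"
    then show "(M k k)\<^sup>2 \<le> (\<Sum>l<r. (M k l)\<^sup>2)"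
      by (intro member_le_sum[where f = "\<lambda>l. (M k l)\<^sup>2"]) auto
  qed
  also have "(\<Sum>k<r. \<Sum>l<r. (M k l)\<^sup>2) = (\<Sum>s\<in>S0. \<Sum>t\<in>S0. (\<Sum>x\<in>X. v s x * v t x)\<^sup>2)"
  proof -
    have "(\<Sum>k<r. \<Sum>l<r. (M k l)\<^sup>2) =
        (\<Sum>k<r. \<Sum>l<r. \<Sum>s\<in>S0. \<Sum>t\<in>S0. a s k * a t k * (a s l * a t l))"
      by (intro sum.cong refl) (simp add: M_def power2_eq_square sum_product mult_ac)
    also have "\<dots> = (\<Sum>k<r. \<Sum>s\<in>S0. \<Sum>l<r. \<Sum>t\<in>S0. a s k * a t k * (a s l * a t l))"
      by (intro sum.cong refl sum.swap)
    also have "\<dots> = (\<Sum>s\<in>S0. \<Sum>k<r. \<Sum>l<r. \<Sum>t\<in>S0. a s k * a t k * (a s l * a t l))"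
      by (rule sum.swap)
    also have "\<dots> = (\<Sum>s\<in>S0. \<Sum>k<r. \<Sum>t\<in>S0. \<Sum>l<r. a s k * a t k * (a s l * a t l))"
      by (intro sum.cong refl sum.swap)
    also have "\<dots> = (\<Sum>s\<in>S0. \<Sum>t\<in>S0. \<Sum>k<r. \<Sum>l<r. a s k * a t k * (a s l * a t l))"
      by (intro sum.cong refl sum.swap)
    also have "\<dots> = (\<Sum>s\<in>S0. \<Sum>t\<in>S0. (\<Sum>x\<in>X. v s x * v t x)\<^sup>2)"
      by (intro sum.cong refl) (simp add: ip power2_eq_square sum_product)
    finally show ?thesis .
  qed
  finally show ?thesis using S by (intro exI[of _ S]) (simp add: r_def mult_left_mono)
qed

text \<open>A \<open>\<rat>\<close>-linear functional on the field turns a linear relation between integer vectors into a rational one.\<close>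

lemma independent_of_int:
  fixes v :: "'s \<Rightarrow> 'x \<Rightarrow> int" and c :: "'s \<Rightarrow> 'f::field_char_0"
  assumes indep: "\<And>c. (\<forall>x\<in>X. (\<Sum>s\<in>S. c s * real_of_int (v s x)) = 0) \<Longrightarrow> (\<forall>s\<in>S. c s = 0)"
    and zero: "\<And>x. x \<in> X \<Longrightarrow> (\<Sum>s\<in>S. c s * of_int (v s x)) = 0"
  shows "\<forall>s\<in>S. c s = 0"
proof (rule ccontr)
  assume "\<not> ?thesis"
  then obtain s0 where s0: "s0 \<in> S" "c s0 \<noteq> 0" by blast
  define sc :: "rat \<Rightarrow> 'f \<Rightarrow> 'f" where "sc = (\<lambda>r x. of_rat r * x)"
  interpret V: vector_space sc
    by unfold_locales (auto simp: sc_def algebra_simps of_rat_add of_rat_mult)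
  interpret R: vector_space "(*) :: rat \<Rightarrow> rat \<Rightarrow> rat"
    by unfold_locales (auto simp: algebra_simps)
  interpret P: vector_space_pair sc "(*) :: rat \<Rightarrow> rat \<Rightarrow> rat" ..
  have "V.independent {c s0}" using s0(2) by simp
  then obtain g where g: "Vector_Spaces.linear sc (*) g" "g (c s0) = 1"
    using P.linear_independent_extend[of "{c s0}" "\<lambda>_. 1"] by auto
  interpret g: Vector_Spaces.linear sc "(*)" g by (rule g(1))
  have "(\<Sum>s\<in>S. real_of_rat (g (c s)) * real_of_int (v s x)) = 0" if "x \<in> X" for x
  proof -
    have "0 = g (\<Sum>s\<in>S. c s * of_int (v s x))" using zero[OF that] by (simp add: g.zero)
    also have "\<dots> = (\<Sum>s\<in>S. g (sc (of_int (v s x)) (c s)))"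
      by (simp add: g.sum sc_def mult.commute)
    also have "\<dots> = (\<Sum>s\<in>S. of_int (v s x) * g (c s))" by (simp only: g.scale)
    finally have "real_of_rat (\<Sum>s\<in>S. of_int (v s x) * g (c s)) = 0" by simp
    then show ?thesis by (simp add: of_rat_sum of_rat_mult mult.commute)
  qed
  from indep[of "\<lambda>s. real_of_rat (g (c s))"] this have "real_of_rat (g (c s0)) = 0" using s0(1) by blast
  then show False by (simp add: g(2))
qed

text \<open>
  Colourings with the same content are related by a permutation, so a pair of a colouring and a
  permutation fixing it is determined by the content and one permutation.
\<close>

lemma card_fixed_colourings_le:
  fixes E :: "'e set"
  assumes "finite E"
  shows "card {(\<rho>, f). \<rho> permutes {1..m} \<and> f \<in> {1..m} \<rightarrow>\<^sub>E E \<and> (\<forall>j\<in>{1..m}. f (\<rho> j) = f j)}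
    \<le> fact m * (m + 1) ^ card E" (is "card ?P \<le> _")
proof -
  let ?I = "{1..m}" and ?C = "{1..m} \<rightarrow>\<^sub>E E"
  define ct where "ct = (\<lambda>f :: nat \<Rightarrow> 'e. \<lambda>e\<in>E. card {j\<in>?I. f j = e})"
  define rep where "rep = (\<lambda>k. SOME f. f \<in> ?C \<and> ct f = k)"
  have rep: "rep (ct f) \<in> ?C \<and> ct (rep (ct f)) = ct f" if "f \<in> ?C" for f
    unfolding rep_def by (rule someI[of _ f]) (intro conjI that refl)
  have "\<exists>r. r permutes ?I \<and> (\<forall>j\<in>?I. f j = rep (ct f) (r j))" if f: "f \<in> ?C" for f
  proof -
    have cnt: "count (image_mset h (mset_set ?I)) e = (if e \<in> E then ct h e else 0)"
      if h: "h \<in> ?C" for h e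
    proof -
      have "count (image_mset h (mset_set ?I)) e = card {j\<in>?I. h j = e}"
        by (simp add: count_image_mset_eq_card_vimage)
      moreover have "{j\<in>?I. h j = e} = {}" if "e \<notin> E" using h that by auto
      ultimately show ?thesis by (auto simp: ct_def)
    qed
    have "image_mset f (mset_set ?I) = image_mset (rep (ct f)) (mset_set ?I)"
      by (rule multiset_eqI)
         (simp only: cnt[OF f] cnt[OF conjunct1[OF rep[OF f]]] conjunct2[OF rep[OF f]])
    then obtain p where "p permutes ?I" "\<forall>x\<in>?I. f x = rep (ct f) (p x)"
      using image_mset_eq_implies_permutes[of ?I f "rep (ct f)"] by auto
    then show ?thesis by blast
  qed
  then obtain r where r: "\<And>f. f \<in> ?C \<Longrightarrow> r f permutes ?I"
    "\<And>f j. f \<in> ?C \<Longrightarrow> j \<in> ?I \<Longrightarrow> f j = rep (ct f) (r f j)" by metis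
  \<comment> \<open>The permutation \<open>r f\<close> carries \<open>f\<close> to the chosen
    colouring \<open>rep (ct f)\<close>, and so does \<open>r f \<circ> \<rho>\<close> when
    \<open>\<rho>\<close> fixes \<open>f\<close>. The latter together with the content recovers
    \<open>f\<close>, hence \<open>r f\<close>, hence \<open>\<rho>\<close>.\<close>
  define \<Psi> where "\<Psi> = (\<lambda>(\<rho> :: nat \<Rightarrow> nat, f). (r f \<circ> \<rho>, ct f))"
  have key: "f j = rep (ct f) ((r f \<circ> \<rho>) j)"
    if "\<rho> permutes ?I" "f \<in> ?C" "\<forall>j\<in>?I. f (\<rho> j) = f j" "j \<in> ?I" for \<rho> f j
  proof -
    have "\<rho> j \<in> ?I" using that(1,4) by (simp only: permutes_in_image)
    with r(2)[OF that(2), of "\<rho> j"] that(3,4) show ?thesis by simp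
  qed
  have "inj_on \<Psi> ?P"
  proof (rule inj_onI)
    fix x y assume "x \<in> ?P" "y \<in> ?P" "\<Psi> x = \<Psi> y"
    then obtain \<rho> f \<rho>' f' where xy: "x = (\<rho>, f)" "y = (\<rho>', f')"
      and a: "\<rho> permutes ?I" "f \<in> ?C" "\<forall>j\<in>?I. f (\<rho> j) = f j"
      and b: "\<rho>' permutes ?I" "f' \<in> ?C" "\<forall>j\<in>?I. f' (\<rho>' j) = f' j"
      and eq: "\<Psi> (\<rho>, f) = \<Psi> (\<rho>', f')"
      by blast
    from eq have e: "r f \<circ> \<rho> = r f' \<circ> \<rho>'" "ct f = ct f'" by (auto simp: \<Psi>_def)
    have "f j = f' j" if "j \<in> ?I" for j
      using key[OF a that] key[OF b that] e by simp
    with a(2) b(2) have ff: "f = f'" by (rule PiE_ext)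
    have "\<rho> j = \<rho>' j" for j
    proof -
      have "r f (\<rho> j) = r f (\<rho>' j)" using e(1) ff by (metis comp_apply)
      then show ?thesis using permutes_inj[OF r(1)[OF a(2)]] by (simp add: inj_eq)
    qed
    with ff show "x = y" by (auto simp: xy)
  qed
  moreover have "\<Psi> ` ?P \<subseteq> {\<tau>. \<tau> permutes ?I} \<times> (E \<rightarrow>\<^sub>E {0..m})"
  proof
    fix y assume "y \<in> \<Psi> ` ?P"
    then obtain \<rho> f where y: "y = \<Psi> (\<rho>, f)" and a: "\<rho> permutes ?I" "f \<in> ?C" by blast
    have "ct f e \<le> m" if "e \<in> E" for e
    proof -
      have "card {j\<in>?I. f j = e} \<le> card ?I" by (rule card_mono) auto
      then show ?thesis using that by (simp add: ct_def)
    qed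
    moreover have "ct f \<in> extensional E" by (simp add: ct_def)
    ultimately show "y \<in> {\<tau>. \<tau> permutes ?I} \<times> (E \<rightarrow>\<^sub>E {0..m})"
      using permutes_compose[OF a(1) r(1)[OF a(2)]] by (auto simp: y \<Psi>_def PiE_iff)
  qed
  moreover have "finite ({\<tau>. \<tau> permutes ?I} \<times> (E \<rightarrow>\<^sub>E {0..m}))"
    using assms by (intro finite_cartesian_product finite_permutations finite_PiE) auto
  ultimately have "card ?P \<le> card ({\<tau>. \<tau> permutes ?I} \<times> (E \<rightarrow>\<^sub>E {0..m}))"
    by (rule card_inj_on_le)
  also have "\<dots> = fact m * (m + 1) ^ card E"
  proof -
    have "card {\<tau>. \<tau> permutes ?I} = fact m" by (rule card_permutations) auto
    then show ?thesis by (simp only: card_cartesian_product) (simp add: card_PiE assms)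
  qed
  finally show ?thesis .
qed

text \<open>The value of the product of the pairings of \<open>x i\<close> with
  \<open>x (m + \<sigma> i)\<close>, when the first \<open>m\<close> arguments are basis elements
  chosen by \<open>c\<close> and the last \<open>m\<close> are dual basis elements chosen by
  \<open>c'\<close>.\<close>

definition perm_vec :: "nat \<Rightarrow> (nat \<Rightarrow> nat) \<Rightarrow> (nat \<Rightarrow> 'd) \<times> (nat \<Rightarrow> 'd) \<Rightarrow> int" where
  "perm_vec m \<sigma> = (\<lambda>(c, c'). if \<forall>i\<in>{1..m}. c i = c' (\<sigma> i) then 1 else 0)"

text \<open>The Gram matrix entry at \<open>\<sigma>\<close> and \<open>\<tau>\<close> counts the
  colourings fixed by \<open>\<tau> \<circ> inv \<sigma>\<close>, so the squares in each row can be
  summed by counting fixed colourings over all permutations. Both sides of the rank inequality then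
  carry the factor \<open>(fact m)\<^sup>2\<close>, which cancels and leaves only a polynomial
  loss.\<close>

lemma perm_vec_rank:
  fixes D :: "'d set"
  assumes "finite D"
  shows "\<exists>S\<subseteq>{\<sigma>. \<sigma> permutes {1..m}}. card D ^ (2 * m) \<le> card S * (m + 1) ^ (card D)\<^sup>2 \<and>
    (\<forall>a :: (nat \<Rightarrow> nat) \<Rightarrow> 'f::field_char_0.
      (\<forall>x\<in>({1..m} \<rightarrow>\<^sub>E D) \<times> ({1..m} \<rightarrow>\<^sub>E D). (\<Sum>\<sigma>\<in>S. a \<sigma> * of_int (perm_vec m \<sigma> x)) = 0) \<longrightarrow>
      (\<forall>\<sigma>\<in>S. a \<sigma> = 0))"
proof -
  let ?I = "{1..m}" and ?C = "{1..m} \<rightarrow>\<^sub>E D" and ?P = "{\<sigma>. \<sigma> permutes {1..m}}"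
  let ?X = "?C \<times> ?C"
  define v where "v = (\<lambda>\<sigma> x. real_of_int (perm_vec m \<sigma> (x :: (nat \<Rightarrow> 'd) \<times> (nat \<Rightarrow> 'd))))"
  have fin: "finite ?C" "finite ?P"
    using assms by (auto intro!: finite_PiE finite_permutations)
  have finX: "finite ?X" using fin by simp
  obtain S where S: "S \<subseteq> ?P" "\<And>c. (\<forall>x\<in>?X. (\<Sum>s\<in>S. c s * v s x) = 0) \<Longrightarrow> (\<forall>s\<in>S. c s = 0)"
    and ineq: "(\<Sum>s\<in>?P. \<Sum>x\<in>?X. v s x * v s x)\<^sup>2
      \<le> real (card S) * (\<Sum>s\<in>?P. \<Sum>t\<in>?P. (\<Sum>x\<in>?X. v s x * v t x)\<^sup>2)"
    using rank_lower_bound[OF finX fin(2), of v] by blast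
  have ip: "(\<Sum>x\<in>?X. v \<sigma> x * v \<tau> x) = real (card {c\<in>?C. \<forall>i\<in>?I. c (\<sigma> i) = c (\<tau> i)})"
    if "\<sigma> \<in> ?P" "\<tau> \<in> ?P" for \<sigma> \<tau>
  proof -
    let ?A = "{x\<in>?X. \<forall>i\<in>?I. fst x i = snd x (\<sigma> i) \<and> fst x i = snd x (\<tau> i)}"
    have "(\<Sum>x\<in>?X. v \<sigma> x * v \<tau> x) = (\<Sum>x\<in>?X. if x \<in> ?A then 1 else 0)"
    proof (intro sum.cong refl)
      fix x assume "x \<in> ?X"
      then have "x \<in> ?A \<longleftrightarrow> (\<forall>i\<in>?I. fst x i = snd x (\<sigma> i)) \<and> (\<forall>i\<in>?I. fst x i = snd x (\<tau> i))"
        by blast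
      then show "v \<sigma> x * v \<tau> x = (if x \<in> ?A then 1 else 0)"
        by (simp only: v_def perm_vec_def case_prod_beta) simp
    qed
    also have "\<dots> = real (card ?A)" using finX by (simp add: sum.If_cases Int_def)
    also have "bij_betw snd ?A {c\<in>?C. \<forall>i\<in>?I. c (\<sigma> i) = c (\<tau> i)}"
    proof (rule bij_betw_byWitness[where f' = "\<lambda>c. (\<lambda>i\<in>?I. c (\<sigma> i), c)"])
      show "\<forall>a\<in>?A. (\<lambda>i\<in>?I. snd a (\<sigma> i), snd a) = a"
      proof
        fix x assume x: "x \<in> ?A"
        then have "(\<lambda>i\<in>?I. snd x (\<sigma> i)) = fst x"
          by (intro extensionalityI[of _ ?I]) (auto simp: PiE_iff)
        then show "(\<lambda>i\<in>?I. snd x (\<sigma> i), snd x) = x" by simp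
      qed
      show "snd ` ?A \<subseteq> {c\<in>?C. \<forall>i\<in>?I. c (\<sigma> i) = c (\<tau> i)}" by fastforce
      have "\<sigma> i \<in> ?I" if "i \<in> ?I" for i
        using that \<open>\<sigma> \<in> ?P\<close> by (simp only: mem_Collect_eq permutes_in_image)
      then show "(\<lambda>c. (\<lambda>i\<in>?I. c (\<sigma> i), c)) ` {c\<in>?C. \<forall>i\<in>?I. c (\<sigma> i) = c (\<tau> i)} \<subseteq> ?A"
        by (auto simp: PiE_iff extensional_def)
    qed simp
    then have "card ?A = card {c\<in>?C. \<forall>i\<in>?I. c (\<sigma> i) = c (\<tau> i)}" by (rule bij_betw_same_card)
    finally show ?thesis .
  qed
  have cardP: "card ?P = fact m" by (simp add: card_permutations)
  have diag: "(\<Sum>s\<in>?P. \<Sum>x\<in>?X. v s x * v s x) = fact m * real (card D) ^ m"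
  proof -
    have "(\<Sum>x\<in>?X. v s x * v s x) = real (card D) ^ m" if "s \<in> ?P" for s
      by (subst ip[OF that that]) (simp add: card_PiE)
    then have "(\<Sum>s\<in>?P. \<Sum>x\<in>?X. v s x * v s x) = (\<Sum>s\<in>?P. real (card D) ^ m)"
      by (rule sum.cong[OF refl])
    then show ?thesis by (simp only: sum_constant cardP of_nat_fact)
  qed
  have inner: "(\<Sum>\<tau>\<in>?P. (\<Sum>x\<in>?X. v \<sigma> x * v \<tau> x)\<^sup>2) \<le> fact m * (real m + 1) ^ (card D)\<^sup>2"
    if \<sigma>: "\<sigma> \<in> ?P" for \<sigma>
  proof -
    define fx where "fx = (\<lambda>\<rho>. {c\<in>?C. \<forall>j\<in>?I. c (\<rho> j) = c j})"
    have "{c\<in>?C. \<forall>i\<in>?I. c (\<sigma> i) = c (\<tau> i)} = fx (\<tau> \<circ> inv \<sigma>)" for \<tau>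
    proof -
      have img: "\<sigma> ` ?I = ?I" using \<sigma> permutes_image by blast
      have "(\<forall>i\<in>?I. c (\<sigma> i) = c (\<tau> i)) \<longleftrightarrow> (\<forall>j\<in>?I. c (\<tau> (inv \<sigma> j)) = c j)" for c :: "nat \<Rightarrow> 'd"
        by (subst (2) img[symmetric]) (use permutes_inverses(2)[of \<sigma> ?I] \<sigma> in auto)
      then show ?thesis by (simp add: fx_def)
    qed
    then have "(\<Sum>\<tau>\<in>?P. (\<Sum>x\<in>?X. v \<sigma> x * v \<tau> x)\<^sup>2) = (\<Sum>\<tau>\<in>?P. (real (card (fx (\<tau> \<circ> inv \<sigma>))))\<^sup>2)"
      by (intro sum.cong refl) (simp only: ip[OF \<sigma>])
    also have "\<dots> = (\<Sum>\<rho>\<in>?P. (real (card (fx \<rho>)))\<^sup>2)"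
    proof (rule sum.reindex_bij_betw)
      have "inv \<sigma> permutes ?I" using \<sigma> by (simp add: permutes_inv)
      then show "bij_betw (\<lambda>\<tau>. \<tau> \<circ> inv \<sigma>) ?P ?P"
        using \<sigma> permutes_inv_o[of \<sigma> ?I]
        by (intro bij_betw_byWitness[where f' = "\<lambda>\<tau>. \<tau> \<circ> \<sigma>"])
           (auto simp: comp_assoc intro: permutes_compose)
    qed
    also have "\<dots> = real (\<Sum>\<rho>\<in>?P. card (fx \<rho> \<times> fx \<rho>))"
      by (simp add: power2_eq_square card_cartesian_product)
    also have "(\<Sum>\<rho>\<in>?P. card (fx \<rho> \<times> fx \<rho>)) = card (SIGMA \<rho>:?P. fx \<rho> \<times> fx \<rho>)"
      using fin by (subst card_SigmaI) (auto simp: fx_def)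
    \<comment> \<open>Two colourings by \<open>D\<close> fixed by the same permutation are one fixed
      colouring by \<open>D \<times> D\<close>; this is the origin of the exponent
      \<open>(card D)\<^sup>2\<close>.\<close>
    also have "\<dots> \<le> card {(\<rho>, f). \<rho> permutes ?I \<and> f \<in> ?I \<rightarrow>\<^sub>E D \<times> D \<and> (\<forall>j\<in>?I. f (\<rho> j) = f j)}"
    proof (rule card_inj_on_le[where f = "\<lambda>(\<rho>, c, c'). (\<rho>, \<lambda>i\<in>?I. (c i, c' i))"])
      show "inj_on (\<lambda>(\<rho>, c, c'). (\<rho>, \<lambda>i\<in>?I. (c i, c' i))) (SIGMA \<rho>:?P. fx \<rho> \<times> fx \<rho>)"
      proof (rule inj_onI)
        fix x y
        assume "x \<in> (SIGMA \<rho>:?P. fx \<rho> \<times> fx \<rho>)" "y \<in> (SIGMA \<rho>:?P. fx \<rho> \<times> fx \<rho>)"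
          "(\<lambda>(\<rho>, c, c'). (\<rho>, \<lambda>i\<in>?I. (c i, c' i))) x = (\<lambda>(\<rho>, c, c'). (\<rho>, \<lambda>i\<in>?I. (c i, c' i))) y"
        then obtain \<rho> c c' d d' where xy: "x = (\<rho>, c, c')" "y = (\<rho>, d, d')"
          and "c \<in> fx \<rho>" "c' \<in> fx \<rho>" "d \<in> fx \<rho>" "d' \<in> fx \<rho>"
          and eq: "(\<lambda>i\<in>?I. (c i, c' i)) = (\<lambda>i\<in>?I. (d i, d' i))"
          by (cases x, cases y) auto
        have "c i = d i \<and> c' i = d' i" if "i \<in> ?I" for i
          using fun_cong[OF eq, of i] that by simp
        moreover have "c \<in> ?C" "c' \<in> ?C" "d \<in> ?C" "d' \<in> ?C"
          using \<open>c \<in> fx \<rho>\<close> \<open>c' \<in> fx \<rho>\<close> \<open>d \<in> fx \<rho>\<close> \<open>d' \<in> fx \<rho>\<close> by (auto simp: fx_def)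
        ultimately have "c = d" "c' = d'" by (blast intro: PiE_ext)+
        then show "x = y" by (simp add: xy)
      qed
      show "(\<lambda>(\<rho>, c, c'). (\<rho>, \<lambda>i\<in>?I. (c i, c' i))) ` (SIGMA \<rho>:?P. fx \<rho> \<times> fx \<rho>) \<subseteq>
          {(\<rho>, f). \<rho> permutes ?I \<and> f \<in> ?I \<rightarrow>\<^sub>E D \<times> D \<and> (\<forall>j\<in>?I. f (\<rho> j) = f j)}"
      proof
        fix y assume "y \<in> (\<lambda>(\<rho>, c, c'). (\<rho>, \<lambda>i\<in>?I. (c i, c' i))) ` (SIGMA \<rho>:?P. fx \<rho> \<times> fx \<rho>)"
        then obtain \<rho> c c' where y: "y = (\<rho>, \<lambda>i\<in>?I. (c i, c' i))" and \<rho>: "\<rho> permutes ?I"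
          and c: "c \<in> fx \<rho>" "c' \<in> fx \<rho>" by auto
        have "\<rho> j \<in> ?I" if "j \<in> ?I" for j
          using that \<rho> by (simp only: permutes_in_image)
        then have "\<rho> permutes ?I \<and> (\<lambda>i\<in>?I. (c i, c' i)) \<in> ?I \<rightarrow>\<^sub>E D \<times> D \<and>
            (\<forall>j\<in>?I. (\<lambda>i\<in>?I. (c i, c' i)) (\<rho> j) = (\<lambda>i\<in>?I. (c i, c' i)) j)"
          using \<rho> c by (auto simp: fx_def PiE_iff)
        then show "y \<in> {(\<rho>, f). \<rho> permutes ?I \<and> f \<in> ?I \<rightarrow>\<^sub>E D \<times> D \<and> (\<forall>j\<in>?I. f (\<rho> j) = f j)}"
          unfolding y by blast
      qed
      have "finite (?P \<times> (?I \<rightarrow>\<^sub>E D \<times> D))" using assms fin by (auto intro!: finite_PiE)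
      then show "finite {(\<rho>, f). \<rho> permutes ?I \<and> f \<in> ?I \<rightarrow>\<^sub>E D \<times> D \<and> (\<forall>j\<in>?I. f (\<rho> j) = f j)}"
        by (rule rev_finite_subset) auto
    qed
    also have "\<dots> \<le> fact m * (m + 1) ^ card (D \<times> D)"
      using assms by (intro card_fixed_colourings_le) simp
    finally show ?thesis
      by (simp add: card_cartesian_product power2_eq_square add.commute)
  qed
  have "(fact m * real (card D) ^ m)\<^sup>2 \<le> real (card S) * (\<Sum>s\<in>?P. fact m * (real m + 1) ^ (card D)\<^sup>2)"
    using ineq inner unfolding diag
    by (elim order_trans) (intro mult_left_mono sum_mono, auto)
  also have "\<dots> = (fact m)\<^sup>2 * (real (card S) * (real m + 1) ^ (card D)\<^sup>2)"
    by (simp only: sum_constant cardP) (simp add: power2_eq_square)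
  finally have "(fact m)\<^sup>2 * (real (card D) ^ (2 * m)) \<le> (fact m)\<^sup>2 * (real (card S) * (real m + 1) ^ (card D)\<^sup>2)"
    by (simp add: power_mult_distrib power_mult[symmetric] mult.commute)
  then have "real (card D) ^ (2 * m) \<le> real (card S) * (real m + 1) ^ (card D)\<^sup>2"
    by (simp add: mult_le_cancel_left)
  then have "real (card D ^ (2 * m)) \<le> real (card S * (m + 1) ^ (card D)\<^sup>2)"
    by (simp add: add.commute)
  then have "card D ^ (2 * m) \<le> card S * (m + 1) ^ (card D)\<^sup>2" by (simp only: of_nat_le_iff)
  moreover have "\<forall>\<sigma>\<in>S. a \<sigma> = 0"
    if "\<forall>x\<in>?X. (\<Sum>\<sigma>\<in>S. a \<sigma> * of_int (perm_vec m \<sigma> x)) = 0" for a :: "(nat \<Rightarrow> nat) \<Rightarrow> 'f"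
    by (rule independent_of_int[where X = ?X and v = "perm_vec m"])
       (use S(2) that in \<open>auto simp: v_def\<close>)
  ultimately show ?thesis using S(1) by (intro exI[of _ S]) simp
qed

section \<open>Rank one operators on graded-simple algebras\<close>

context finite_dimensional_vector_space
begin

text \<open>The vector \<open>p(g) z\<close>, computed by Horner's scheme.\<close>

definition pact :: "('b \<Rightarrow> 'b) \<Rightarrow> 'b \<Rightarrow> 'a poly \<Rightarrow> 'b" where
  "pact g z p = fold_coeffs (\<lambda>a v. scale a z + g v) p 0"

lemma pact_0 [simp]: "pact g z 0 = 0"
  by (simp add: pact_def)

lemma pact_pCons:
  assumes "endo g" shows "pact g z (pCons a p) = scale a z + g (pact g z p)"
proof -
  interpret g: Vector_Spaces.linear scale scale g by (rule assms)
  show ?thesis by (cases "a = 0 \<and> p = 0") (auto simp: pact_def g.zero)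
qed

lemma pact_add:
  assumes "endo g" shows "pact g z (p + r) = pact g z p + pact g z r"
proof -
  interpret g: Vector_Spaces.linear scale scale g by (rule assms)
  show ?thesis
    by (induction p r rule: poly_induct2) (simp_all add: pact_pCons[OF assms] scale_left_distrib g.add)
qed

lemma pact_smult:
  assumes "endo g" shows "pact g z (smult c p) = scale c (pact g z p)"
proof -
  interpret g: Vector_Spaces.linear scale scale g by (rule assms)
  show ?thesis
    by (induction p) (simp_all add: pact_pCons[OF assms] scale_right_distrib g.scale)
qed

lemma pact_sum:
  assumes "endo g" shows "pact g z (\<Sum>i\<in>I. p i) = (\<Sum>i\<in>I. pact g z (p i))"
  by (induction I rule: infinite_finite_induct) (simp_all add: pact_add[OF assms])

lemma pact_in_subspace:
  assumes "endo g" "subspace S" "z \<in> S" "\<And>x. x \<in> S \<Longrightarrow> g x \<in> S"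
  shows "pact g z p \<in> S"
  by (induction p)
     (simp_all add: pact_pCons[OF assms(1)] subspace_0 subspace_add subspace_scale assms)

lemma dim_image_less:
  assumes f: "endo f" and S: "subspace S" and z: "z \<in> S" "z \<noteq> 0" "f z = 0"
  shows "dim (f ` S) < dim S"
proof -
  interpret f: Vector_Spaces.linear scale scale f by (rule f)
  have "independent {z}" using z by simp
  then obtain C where C: "{z} \<subseteq> C" "C \<subseteq> S" "independent C" "S \<subseteq> span C"
    using maximal_independent_subset_extend[of "{z}" S] z by blast
  have finC: "finite C" using C(3) by (rule finiteI_independent)
  have sp: "span C = S" using C S by (simp add: span_subspace)
  have "f ` C \<subseteq> insert 0 (f ` (C - {z}))" using z(3) by auto
  then have "span (f ` C) \<subseteq> span (f ` (C - {z}))"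
    using span_mono[of "f ` C" "insert 0 (f ` (C - {z}))"] by (simp add: span_insert_0)
  moreover have "f ` S = span (f ` C)" by (simp add: f.span_image flip: sp)
  ultimately have "dim (f ` S) \<le> card (f ` (C - {z}))"
    using finC by (intro dim_le_card) auto
  also have "\<dots> \<le> card (C - {z})" using finC by (intro card_image_le) auto
  also have "\<dots> < card C" using finC C(1) by (intro psubset_card_mono) auto
  also have "card C = dim S" using dim_span_eq_card_independent[OF C(3)] sp by simp
  finally show ?thesis .
qed

end

text \<open>Among the nonzero polynomials that annihilate \<open>z\<close>, one of least degree has
  a root \<open>\<mu>\<close>. By minimality the cofactor of the linear factor sends
  \<open>z\<close> to a nonzero vector, and this is an eigenvector for \<open>\<mu>\<close>.\<close>

lemma (in finite_dimensional_vector_space) ex_eigenvector: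
  assumes ac: "\<And>p :: 'a poly. 0 < degree p \<Longrightarrow> \<exists>x. poly p x = 0"
    and g: "endo g" and S: "subspace S" "\<And>x. x \<in> S \<Longrightarrow> g x \<in> S" and z: "z \<in> S" "z \<noteq> 0"
  shows "\<exists>\<mu> y. y \<in> S \<and> y \<noteq> 0 \<and> g y = scale \<mu> y"
proof -
  define N where "N = card Basis"
  obtain c where c: "\<exists>k\<in>{..N}. c k \<noteq> 0" "(\<Sum>k\<le>N. scale (c k) (pact g z (monom 1 k))) = 0"
    using ex_dependence[of "{..N}" "\<lambda>k. pact g z (monom 1 k)"] by (auto simp: N_def)
  define P where "P = (\<lambda>p. p \<noteq> 0 \<and> pact g z p = 0)"
  define p0 where "p0 = (\<Sum>k\<le>N. smult (c k) (monom 1 k))"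
  have "pact g z p0 = 0" using c(2) by (simp add: p0_def pact_sum[OF g] pact_smult[OF g] del: smult_monom)
  moreover obtain k where k: "k \<le> N" "c k \<noteq> 0" using c(1) by auto
  have "coeff p0 k = c k" using k(1) by (simp add: p0_def coeff_sum smult_monom if_distrib cong: if_cong)
  with k(2) have "p0 \<noteq> 0" by auto
  ultimately have "P p0" by (simp add: P_def)
  then obtain p where p: "P p" "\<And>r. P r \<Longrightarrow> degree p \<le> degree r"
    using ex_has_least_nat[of P p0 degree] by blast
  have "0 < degree p"
  proof (rule ccontr)
    assume "\<not> 0 < degree p"
    then obtain a where a: "p = [:a:]" using degree_eq_zeroE by blast
    interpret g: Vector_Spaces.linear scale scale g by (rule g)
    have "scale a z = 0" using p(1) unfolding P_def a pact_pCons[OF g] by (auto simp: g.zero)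
    then have "a = 0" using z(2) by (simp add: scale_eq_0_iff)
    then show False using p(1) by (simp add: P_def a)
  qed
  then obtain \<mu> where "poly p \<mu> = 0" using ac by blast
  then obtain r where r: "p = [:- \<mu>, 1:] * r" by (auto simp: poly_eq_0_iff_dvd elim: dvdE)
  have r0: "r \<noteq> 0" using p(1) r by (auto simp: P_def)
  have "degree p = Suc (degree r)" unfolding r using r0 by (subst degree_mult_eq) auto
  then have y0: "pact g z r \<noteq> 0" using p(2)[of r] r0 by (auto simp: P_def)
  have "0 = pact g z ([:- \<mu>, 1:] * r)" using p(1) unfolding P_def r by (elim conjE) (simp only:)
  also have "\<dots> = scale (- \<mu>) (pact g z r) + g (pact g z r)"
    by (simp add: mult_pCons_left pact_add[OF g] pact_smult[OF g] pact_pCons[OF g] del: smult_minus_left)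
  finally have "g (pact g z r) = scale \<mu> (pact g z r)" by (simp add: scale_minus_left eq_neg_iff_add_eq_0 add_eq_0_iff)
  then show ?thesis using y0 pact_in_subspace[OF g S(1) z(1) S(2)] by blast
qed

text \<open>The situation of the theorem in the form in which it is used: \<open>idx\<close> indexes
  the graded-simple ideals \<open>B i\<close> of the quotient, and their bases \<open>bas i\<close>
  together form \<open>BQ\<close>. The grading of the quotient enters only through the operators
  that take \<open>u\<close> to \<open>\<pi> (A.hc t (\<kappa> u))\<close>.\<close>

locale codim_setup =
  A: graded_algebra sA BA G + Q: fd_algebra0 sQ BQ
  for sA :: "'f::{alg_closed_field, field_char_0} \<Rightarrow> 'a::ring \<Rightarrow> 'a" and BA :: "'a set"
    and G :: "'t::semigroup_mult \<Rightarrow> 'a set"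
    and sQ :: "'f \<Rightarrow> 'q::ring \<Rightarrow> 'q" and BQ :: "'q set" +
  fixes idx :: "nat set" and bas :: "nat \<Rightarrow> 'q set" and \<pi> :: "'a \<Rightarrow> 'q" and \<kappa> :: "'q \<Rightarrow> 'a" and B :: "nat \<Rightarrow> 'q set"
  assumes finite_idx: "finite idx" and idx_nonempty: "idx \<noteq> {}"
    and BQ_eq: "BQ = (\<Union>i\<in>idx. bas i)"
    and J_right: "x \<in> A.J \<Longrightarrow> x * a \<in> A.J"
    and J_hc: "x \<in> A.J \<Longrightarrow> A.hc t x \<in> A.J"
    and linear_pi: "Vector_Spaces.linear sA sQ \<pi>" and pi_mult: "\<pi> (x * y) = \<pi> x * \<pi> y"
    and pi_ker: "\<pi> x = 0 \<longleftrightarrow> x \<in> A.J"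
    and linear_kappa: "Vector_Spaces.linear sQ sA \<kappa>" and kappa_mult: "\<kappa> (u * v) = \<kappa> u * \<kappa> v"
    and pi_kappa: "\<pi> (\<kappa> u) = u"
    and bas_disjoint: "i \<in> idx \<Longrightarrow> j \<in> idx \<Longrightarrow> i \<noteq> j \<Longrightarrow> bas i \<inter> bas j = {}"
    and span_bas: "i \<in> idx \<Longrightarrow> Q.span (bas i) = B i"
    and B_ideal: "i \<in> idx \<Longrightarrow> u \<in> B i \<Longrightarrow> v * u \<in> B i \<and> u * v \<in> B i"
    and B_disjoint: "i \<in> idx \<Longrightarrow> j \<in> idx \<Longrightarrow> i \<noteq> j \<Longrightarrow> B i \<inter> B j = {0}"
    and B_graded: "i \<in> idx \<Longrightarrow> u \<in> B i \<Longrightarrow> \<pi> (A.hc t (\<kappa> u)) \<in> B i"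
    and B_simple: "i \<in> idx \<Longrightarrow> Q.subspace I \<Longrightarrow> I \<subseteq> B i \<Longrightarrow>
      (\<And>u t. u \<in> I \<Longrightarrow> \<pi> (A.hc t (\<kappa> u)) \<in> I) \<Longrightarrow>
      (\<And>u v. u \<in> I \<Longrightarrow> v \<in> B i \<Longrightarrow> v * u \<in> I \<and> u * v \<in> I) \<Longrightarrow> I = {0} \<or> I = B i"
    and B_nontrivial: "i \<in> idx \<Longrightarrow> B i \<noteq> {0}"
begin

sublocale pi: Vector_Spaces.linear sA sQ \<pi> by (rule linear_pi)
sublocale kappa: Vector_Spaces.linear sQ sA \<kappa> by (rule linear_kappa)

lemma bas_BQ: "i \<in> idx \<Longrightarrow> b \<in> bas i \<Longrightarrow> b \<in> BQ"
  by (auto simp: BQ_eq)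

definition hq :: "'t \<Rightarrow> 'q \<Rightarrow> 'q" where "hq t u = \<pi> (A.hc t (\<kappa> u))"

lemma kappa_pi_J: "a - \<kappa> (\<pi> a) \<in> A.J"
  by (simp add: pi.diff pi_kappa flip: pi_ker)

text \<open>The elements \<open>a\<close> and \<open>\<kappa> (\<pi> a)\<close> differ by an element
  of \<open>J\<close>, and \<open>J\<close> is closed under components. So \<open>hq\<close> does
  not depend on the choice of the lift.\<close>

lemma hq_pi: "hq t (\<pi> a) = \<pi> (A.hc t a)"
proof -
  interpret h: Vector_Spaces.linear sA sA "A.hc t" by (rule A.endo_hc)
  have "A.hc t (a - \<kappa> (\<pi> a)) \<in> A.J" by (rule J_hc[OF kappa_pi_J])
  then have "\<pi> (A.hc t a) - \<pi> (A.hc t (\<kappa> (\<pi> a))) = 0"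
    by (simp add: h.diff flip: pi_ker pi.diff)
  then show ?thesis by (simp add: hq_def)
qed

lemma endo_hq: "Q.endo (hq t)"
  unfolding hq_def by unfold_locales (simp_all add: kappa.add A.hc_add pi.add kappa.scale A.hc_scale pi.scale)

sublocale hq: Vector_Spaces.linear sQ sQ "hq t" by (rule endo_hq)

lemma hq_expand: "(\<Sum>t\<in>A.Supp. hq t u) = u"
  by (simp add: hq_def A.hc_expand pi_kappa flip: pi.sum)

lemma hq_mult: "hq t (u * v) = (\<Sum>r\<in>A.Supp. \<Sum>s\<in>A.Supp. if r * s = t then hq r u * hq s v else 0)"
  unfolding hq_def kappa_mult A.hc_mult
  by (simp add: pi.sum pi_mult if_distrib pi.zero cong: if_cong)

lemma hq_hq: "hq s (hq t u) = (if s = t then hq t u else 0)"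
proof -
  have "hq s (\<pi> (A.hc t (\<kappa> u))) = \<pi> (A.hc s (A.hc t (\<kappa> u)))" by (rule hq_pi)
  also have "\<dots> = (if s = t then hq t u else 0)"
    by (simp add: A.hc_homogeneous[OF A.hc_in] hq_def)
  finally show ?thesis by (simp add: hq_def)
qed

lemma hq_B: "i \<in> idx \<Longrightarrow> u \<in> B i \<Longrightarrow> hq t u \<in> B i"
  unfolding hq_def by (rule B_graded)

lemma subspace_B: "i \<in> idx \<Longrightarrow> Q.subspace (B i)"
  using Q.subspace_span[of "bas i"] span_bas by simp

lemma bas_B: "i \<in> idx \<Longrightarrow> b \<in> bas i \<Longrightarrow> b \<in> B i"
  using span_bas[of i] Q.span_base[of b "bas i"] by blast

lemma finite_bas: "i \<in> idx \<Longrightarrow> finite (bas i)"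
  by (rule finite_subset[OF _ Q.finite_Basis]) (auto simp: BQ_eq)

lemma independent_bas: "i \<in> idx \<Longrightarrow> Q.independent (bas i)"
  by (rule Q.independent_mono[OF Q.independent_Basis]) (auto simp: BQ_eq)

lemma B_mult_zero:
  assumes "i \<in> idx" "j \<in> idx" "i \<noteq> j" "u \<in> B i" "v \<in> B j" shows "u * v = 0"
  using B_ideal[OF assms(1,4), of v] B_ideal[OF assms(2,5), of u] B_disjoint[OF assms(1-3)] by blast

section \<open>Projections onto the ideals \<open>B i\<close>\<close>

definition proj :: "nat \<Rightarrow> 'q \<Rightarrow> 'q" where "proj i u = (\<Sum>b\<in>bas i. sQ (Q.coord b u) b)"

lemma proj_B: "i \<in> idx \<Longrightarrow> proj i u \<in> B i"
  unfolding proj_def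
  by (intro Q.subspace_sum[OF subspace_B] Q.subspace_scale[OF subspace_B] bas_B)

lemma endo_proj: "Q.endo (proj i)"
  unfolding proj_def
  by unfold_locales (simp_all add: Q.coord_add Q.coord_scale Q.scale_left_distrib sum.distrib Q.scale_sum_right)

sublocale proj: Vector_Spaces.linear sQ sQ "proj i" by (rule endo_proj)

lemma proj_expand: "(\<Sum>i\<in>idx. proj i u) = u"
proof -
  define f where "f = (\<lambda>b. sQ (Q.coord b u) b)"
  have "sum f BQ = (\<Sum>i\<in>idx. sum f (bas i))"
    by (subst BQ_eq, rule sum.UNION_disjoint) (auto simp: finite_bas bas_disjoint finite_idx)
  then have "(\<Sum>b\<in>BQ. sQ (Q.coord b u) b) = (\<Sum>i\<in>idx. proj i u)"
    by (simp only: f_def proj_def)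
  then show ?thesis using Q.coord_expand[of u] by simp
qed

lemma proj_self:
  assumes "i \<in> idx" "u \<in> B i" shows "proj i u = u"
proof -
  have "u \<in> Q.span (bas i)" using assms span_bas by simp
  then show ?thesis
  proof (induction rule: Q.span_induct_alt)
    case base then show ?case by (simp add: proj.zero)
  next
    case (step c b y)
    have "b \<in> BQ" using step bas_BQ[OF assms(1)] by blast
    then have "proj i b = (\<Sum>b'\<in>bas i. if b' = b then b else 0)"
      unfolding proj_def by (intro sum.cong refl) (simp add: Q.coord_Basis)
    also have "\<dots> = b" using step finite_bas[OF assms(1)] by simp
    finally show ?case using step by (simp add: proj.add proj.scale)
  qed
qed

lemma proj_other:
  assumes "i \<in> idx" "j \<in> idx" "i \<noteq> j" "u \<in> B j" shows "proj i u = 0"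
proof -
  have "u \<in> Q.span (bas j)" using assms span_bas by simp
  then show ?thesis
  proof (induction rule: Q.span_induct_alt)
    case base then show ?case by (simp add: proj.zero)
  next
    case (step c b y)
    have "b \<in> BQ" using step bas_BQ[OF assms(2)] by blast
    then have "proj i b = (\<Sum>b'\<in>bas i. if b' = b then b else 0)"
      unfolding proj_def by (intro sum.cong refl) (simp add: Q.coord_Basis)
    also have "\<dots> = 0" using step bas_disjoint[OF assms(1-3)] by (intro sum.neutral) auto
    finally show ?case using step by (simp add: proj.add proj.scale)
  qed
qed

lemma B_mult_left: "i \<in> idx \<Longrightarrow> u \<in> B i \<Longrightarrow> u * v = u * proj i v"
  and B_mult_right: "i \<in> idx \<Longrightarrow> u \<in> B i \<Longrightarrow> v * u = proj i v * u"
proof -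
  assume i: "i \<in> idx" and u: "u \<in> B i"
  have "u * (\<Sum>j\<in>idx. proj j v) = (\<Sum>j\<in>idx. if j = i then u * proj i v else 0)"
    unfolding sum_distrib_left
    by (intro sum.cong refl) (use B_mult_zero[OF i _ _ u proj_B] in auto)
  then show "u * v = u * proj i v" using i by (simp add: proj_expand finite_idx)
  have "(\<Sum>j\<in>idx. proj j v) * u = (\<Sum>j\<in>idx. if j = i then proj i v * u else 0)"
    unfolding sum_distrib_right
    by (intro sum.cong refl) (use B_mult_zero[OF _ i _ proj_B u] in auto)
  then show "v * u = proj i v * u" using i by (simp add: proj_expand finite_idx)
qed

lemma proj_mult:
  assumes i: "i \<in> idx" shows "proj i (u * v) = proj i u * proj i v"
proof -
  have "proj i (proj j u * v) = (if j = i then proj i u * proj i v else 0)" if j: "j \<in> idx" for j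
  proof (cases "j = i")
    case True
    have "proj i (proj i u * v) = proj i u * v"
      by (rule proj_self[OF i]) (simp add: B_ideal i proj_B)
    also have "proj i u * v = proj i u * proj i v" by (rule B_mult_left[OF i proj_B[OF i]])
    finally show ?thesis using True by simp
  next
    case False
    moreover have "proj j u * v \<in> B j" by (simp add: B_ideal j proj_B)
    ultimately show ?thesis using proj_other[OF i j] by simp
  qed
  then have "(\<Sum>j\<in>idx. proj i (proj j u * v)) = proj i u * proj i v" using i by (simp add: finite_idx)
  moreover have "(\<Sum>j\<in>idx. proj i (proj j u * v)) = proj i (u * v)"
    by (simp add: proj_expand flip: proj.sum sum_distrib_right)
  ultimately show ?thesis by simp
qed

lemma proj_hq:
  assumes i: "i \<in> idx" shows "proj i (hq t u) = hq t (proj i u)"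
proof -
  have "proj i (hq t (proj j u)) = (if j = i then hq t (proj i u) else 0)" if j: "j \<in> idx" for j
  proof (cases "j = i")
    case True
    then show ?thesis using proj_self[OF i hq_B[OF i proj_B[OF i]]] by simp
  next
    case False
    then show ?thesis using proj_other[OF i j _ hq_B[OF j proj_B[OF j]]] by simp
  qed
  then have "(\<Sum>j\<in>idx. proj i (hq t (proj j u))) = hq t (proj i u)" using i by (simp add: finite_idx)
  moreover have "(\<Sum>j\<in>idx. proj i (hq t (proj j u))) = proj i (hq t u)"
    by (simp only: proj_expand flip: proj.sum hq.sum)
  ultimately show ?thesis by simp
qed

lemma coord_proj:
  assumes "i \<in> idx" "b \<in> bas i" shows "Q.coord b (proj i u) = Q.coord b u"
proof -
  have "b \<in> BQ" using bas_BQ assms by blast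
  have "Q.coord b (proj i u) = (\<Sum>c\<in>bas i. if c = b then Q.coord b u else 0)"
    unfolding proj_def Q.coord_sum Q.coord_scale
    by (intro sum.cong refl, subst Q.coord_Basis) (use assms bas_BQ in auto)
  then show ?thesis using assms finite_bas by simp
qed

section \<open>Units and graded multiplication operators\<close>

definition e :: 'q where "e = (SOME e. \<forall>z. e * z = z \<and> z * e = z)"

lemma e_left [simp]: "e * u = u" and e_right [simp]: "u * e = u"
  using someI_ex[OF Q.ex_unit] unfolding e_def by blast+

abbreviation "unit i \<equiv> proj i e"

lemma unit_left: "i \<in> idx \<Longrightarrow> u \<in> B i \<Longrightarrow> unit i * u = u"
  and unit_right: "i \<in> idx \<Longrightarrow> u \<in> B i \<Longrightarrow> u * unit i = u"
  using B_mult_right[of i u e] B_mult_left[of i u e] by simp_all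

text \<open>The span of the operators that take a component and multiply it from both sides by
  elements of \<open>B i\<close>. It is closed under composition, and its invariant subspaces in
  \<open>B i\<close> are the graded ideals, so graded simplicity becomes irreducibility.\<close>

inductive Mop :: "nat \<Rightarrow> ('q \<Rightarrow> 'q) \<Rightarrow> bool" for i where
  Mop_base: "b \<in> B i \<Longrightarrow> c \<in> B i \<Longrightarrow> Mop i (\<lambda>u. b * hq t u * c)"
| Mop_add: "Mop i T \<Longrightarrow> Mop i T' \<Longrightarrow> Mop i (\<lambda>u. T u + T' u)"
| Mop_scale: "Mop i T \<Longrightarrow> Mop i (\<lambda>u. sQ r (T u))"

lemma Mop_zero: "i \<in> idx \<Longrightarrow> Mop i (\<lambda>_. 0)"
  using Mop_base[of 0 i 0 undefined] Q.subspace_0[OF subspace_B] by simp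

lemma Mop_sum:
  assumes "i \<in> idx" "\<And>k. k \<in> K \<Longrightarrow> Mop i (T k)" shows "Mop i (\<lambda>u. \<Sum>k\<in>K. T k u)"
  using assms(2)
proof (induction K rule: infinite_finite_induct)
  case (insert k K)
  have "Mop i (\<lambda>u. T k u + (\<Sum>k\<in>K. T k u))" by (rule Mop_add) (simp_all add: insert)
  with insert show ?case by simp
qed (simp_all add: Mop_zero[OF assms(1)])

lemma Mop_endo: "Mop i T \<Longrightarrow> Q.endo T"
proof (induction rule: Mop.induct)
  case (Mop_base b c t)
  show ?case by unfold_locales
    (simp_all add: hq.add hq.scale distrib_left distrib_right Q.scale_mult_left Q.scale_mult_right)
next
  case (Mop_add T T')
  interpret T: Vector_Spaces.linear sQ sQ T by (rule Mop_add.IH(1))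
  interpret T': Vector_Spaces.linear sQ sQ T' by (rule Mop_add.IH(2))
  show ?case by unfold_locales (simp_all add: T.add T'.add T.scale T'.scale Q.scale_right_distrib)
next
  case (Mop_scale T r)
  interpret T: Vector_Spaces.linear sQ sQ T by (rule Mop_scale.IH)
  show ?case by unfold_locales (simp_all add: T.add T.scale Q.scale_right_distrib mult.commute)
qed

lemma Mop_B: "Mop i T \<Longrightarrow> i \<in> idx \<Longrightarrow> T u \<in> B i"
  by (induction rule: Mop.induct)
     (simp_all add: B_ideal Q.subspace_add[OF subspace_B] Q.subspace_scale[OF subspace_B])

lemma Mop_proj: "Mop i T \<Longrightarrow> i \<in> idx \<Longrightarrow> T (proj i u) = T u"
proof (induction rule: Mop.induct)
  case (Mop_base b c t)
  then show ?case using B_mult_left[of i b "hq t u"] by (simp add: proj_hq)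
qed simp_all

lemma Mop_mult_left: "Mop i T \<Longrightarrow> i \<in> idx \<Longrightarrow> v \<in> B i \<Longrightarrow> Mop i (\<lambda>u. v * T u)"
proof (induction rule: Mop.induct)
  case (Mop_base b c t)
  then show ?case using Mop.Mop_base[of "v * b" i c t] by (simp add: B_ideal mult.assoc)
qed (simp_all add: distrib_left Q.scale_mult_right Mop.intros)

lemma Mop_mult_right: "Mop i T \<Longrightarrow> i \<in> idx \<Longrightarrow> v \<in> B i \<Longrightarrow> Mop i (\<lambda>u. T u * v)"
proof (induction rule: Mop.induct)
  case (Mop_base b c t)
  then show ?case using Mop.Mop_base[of b i "c * v" t] by (simp add: B_ideal mult.assoc)
qed (simp_all add: distrib_right Q.scale_mult_left Mop.intros)

text \<open>A component of a product is a sum of products of components. The middle factor is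
  already homogeneous of degree \<open>t\<close>, so only the terms with \<open>y = t\<close>
  survive, and these are again of the basic form.\<close>

lemma Mop_hq:
  assumes "Mop i T" and i: "i \<in> idx" shows "Mop i (\<lambda>u. hq s (T u))"
  using assms(1)
proof (induction rule: Mop.induct)
  case (Mop_base b c t)
  have *: "Mop i (\<lambda>u. if r * r' = s then (\<Sum>x\<in>A.Supp. \<Sum>y\<in>A.Supp. if x * y = r then hq x b * hq y (hq t u) else 0) * hq r' c else 0)"
    for r r'
  proof (cases "r * r' = s")
    case True
    have "Mop i (\<lambda>u. (if x * y = r then hq x b * hq y (hq t u) else 0) * hq r' c)" for x y
    proof (cases "x * y = r \<and> y = t")
      case True
      then show ?thesis
        using Mop.Mop_base[OF hq_B[OF i Mop_base(1)] hq_B[OF i Mop_base(2)], of x t r']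
        by (auto simp: hq_hq)
    next
      case False
      then have "(\<lambda>u. (if x * y = r then hq x b * hq y (hq t u) else 0) * hq r' c) = (\<lambda>_. 0)"
        by (auto simp: hq_hq fun_eq_iff)
      then show ?thesis using Mop_zero[OF i] by (simp only:)
    qed
    then show ?thesis using True by (simp add: sum_distrib_right Mop_sum[OF i])
  qed (simp add: Mop_zero[OF i])
  show ?case unfolding hq_mult by (intro Mop_sum[OF i] *)
next
  case (Mop_add T T')
  then show ?case by (simp add: hq.add Mop.Mop_add)
next
  case (Mop_scale T r)
  then show ?case by (simp add: hq.scale Mop.Mop_scale)
qed

lemma Mop_comp:
  assumes "Mop i T" "Mop i T'" and i: "i \<in> idx" shows "Mop i (\<lambda>u. T (T' u))"
  using assms(1)
proof (induction rule: Mop.induct)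
  case (Mop_base b c t)
  then show ?case using Mop_mult_right[OF Mop_mult_left[OF Mop_hq[OF assms(2) i] i] i] by blast
qed (simp_all add: Mop.intros)

text \<open>The images of \<open>v\<close> form a graded ideal. It contains \<open>v\<close>, since
  multiplying all components by the unit of \<open>B i\<close> from both sides and adding gives the
  identity on \<open>B i\<close>.\<close>

lemma Mop_transitive:
  assumes i: "i \<in> idx" and v: "v \<in> B i" "v \<noteq> 0" and w: "w \<in> B i"
  shows "\<exists>T. Mop i T \<and> T v = w"
proof -
  define I where "I = {T v | T. Mop i T}"
  have II: "T v \<in> I" if "Mop i T" for T unfolding I_def using that by blast
  have "I = {0} \<or> I = B i"
  proof (rule B_simple[OF i])
    show "Q.subspace I"
    proof (rule Q.subspaceI)
      show "0 \<in> I" using II[OF Mop_zero[OF i]] .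
      fix x y c assume "x \<in> I" "y \<in> I"
      then obtain T T' where T: "x = T v" "y = T' v" "Mop i T" "Mop i T'" by (auto simp: I_def)
      show "x + y \<in> I" using II[OF Mop_add[OF T(3,4)]] by (simp add: T(1,2))
      show "sQ c x \<in> I" using II[OF Mop_scale[OF T(3)], of c] by (simp add: T(1))
    qed
    show "I \<subseteq> B i" using Mop_B[OF _ i] by (auto simp: I_def)
    fix u assume "u \<in> I"
    then obtain T where T: "u = T v" "Mop i T" by (auto simp: I_def)
    show "\<pi> (A.hc t (\<kappa> u)) \<in> I" for t
      using II[OF Mop_hq[OF T(2) i, of t]] by (simp add: T(1) hq_def)
    show "x * u \<in> I \<and> u * x \<in> I" if "x \<in> B i" for x
      using II[OF Mop_mult_left[OF T(2) i that]] II[OF Mop_mult_right[OF T(2) i that]] by (simp add: T(1))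
  qed
  moreover have "v \<in> I"
  proof -
    have "Mop i (\<lambda>u. \<Sum>t\<in>A.Supp. unit i * hq t u * unit i)"
      by (intro Mop_sum[OF i] Mop_base proj_B[OF i])
    moreover have "(\<Sum>t\<in>A.Supp. unit i * hq t v * unit i) = v"
      using unit_left[OF i hq_B[OF i v(1)]] unit_right[OF i hq_B[OF i v(1)]] by (simp add: hq_expand)
    ultimately show ?thesis using II by fastforce
  qed
  ultimately have "w \<in> I" using v w by auto
  then show ?thesis by (auto simp: I_def)
qed

text \<open>As in the proof of Burnside's theorem, a nonzero operator \<open>T\<close> of least rank
  is taken. If its range is larger than the line of \<open>y = T x\<close>, some \<open>S\<close>
  moves \<open>y\<close> to a vector that \<open>T\<close> maps off this line; then
  \<open>T S\<close> has an eigenvector in the range of \<open>T\<close>, for an eigenvalue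
  \<open>\<mu>\<close>, and \<open>T S T - \<mu> T\<close> is nonzero of smaller rank.\<close>

lemma Mop_rank_one:
  assumes i: "i \<in> idx"
  shows "\<exists>T y x. Mop i T \<and> x \<in> B i \<and> T x = y \<and> y \<noteq> 0 \<and> range T \<subseteq> Q.span {y}"
proof -
  define P where "P = (\<lambda>T. Mop i T \<and> (\<exists>x. T x \<noteq> 0))"
  obtain v where v: "v \<in> B i" "v \<noteq> 0"
    using B_nontrivial[OF i] Q.subspace_0[OF subspace_B[OF i]] by blast
  obtain T0 where "Mop i T0" "T0 v = v" using Mop_transitive[OF i v v(1)] by blast
  then have "P T0" using v unfolding P_def by metis
  then obtain T where T: "P T" "\<And>T'. P T' \<Longrightarrow> Q.dim (range T) \<le> Q.dim (range T')"
    using ex_has_least_nat[of P T0 "\<lambda>T. Q.dim (range T)"] by blast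
  have MT: "Mop i T" using T by (simp add: P_def)
  interpret T: Vector_Spaces.linear sQ sQ T by (rule Mop_endo[OF MT])
  obtain x0 where "T x0 \<noteq> 0" using T(1) by (auto simp: P_def)
  define x where "x = proj i x0"
  define y where "y = T x"
  have x: "x \<in> B i" and y: "y \<noteq> 0"
    using \<open>T x0 \<noteq> 0\<close> by (auto simp: x_def y_def proj_B[OF i] Mop_proj[OF MT i])
  have "range T \<subseteq> Q.span {y}"
  proof (rule ccontr)
    assume "\<not> ?thesis"
    then obtain x2 where x2: "T x2 \<notin> Q.span {y}" by blast
    obtain S where S: "Mop i S" "S y = proj i x2"
      using Mop_transitive[OF i Mop_B[OF MT i, of x] _ proj_B[OF i]] y unfolding y_def by blast
    interpret S: Vector_Spaces.linear sQ sQ S by (rule Mop_endo[OF S(1)])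
    have TS: "Q.endo (\<lambda>u. T (S u))" by (rule Mop_endo[OF Mop_comp[OF MT S(1) i]])
    have sr: "Q.subspace (range T)" by (rule T.subspace_image) simp
    obtain \<mu> z where z: "z \<in> range T" "z \<noteq> 0" "T (S z) = sQ \<mu> z"
      using Q.ex_eigenvector[OF alg_closed_imp_poly_has_root TS sr, of y] y by (auto simp: y_def)
    define R where "R = (\<lambda>u. T (S u) + sQ (- \<mu>) u)"
    interpret TS: Vector_Spaces.linear sQ sQ "\<lambda>u. T (S u)" by (rule TS)
    have R: "Q.endo R" unfolding R_def
      by unfold_locales
        (simp_all add: TS.add TS.scale Q.scale_right_distrib Q.scale_right_diff_distrib mult.commute)
    define T' where "T' = (\<lambda>u. T (S (T u)) + sQ (- \<mu>) (T u))"
    have "Mop i T'" unfolding T'_def by (intro Mop_add Mop_scale MT Mop_comp[OF MT Mop_comp[OF S(1) MT i] i])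
    moreover have "T' x = T x2 - sQ \<mu> y"
      using S(2) Mop_proj[OF MT i] by (simp add: T'_def y_def)
    then have "T' x \<noteq> 0" using x2 Q.span_scale[OF Q.span_base[of y "{y}"], of \<mu>] by auto
    ultimately have "P T'" by (auto simp: P_def)
    then have "Q.dim (range T) \<le> Q.dim (range T')" by (rule T(2))
    also have "range T' = R ` range T" by (auto simp: T'_def R_def)
    also have "Q.dim (R ` range T) < Q.dim (range T)"
      by (rule Q.dim_image_less[OF R sr z(1,2)]) (simp add: R_def z(3))
    finally show False by simp
  qed
  then show ?thesis using MT x y by (auto simp: y_def)
qed

text \<open>Linear functionals are encoded by the elements of \<open>B i\<close> that have their
  values on \<open>bas i\<close> as coordinates, and \<open>U\<close> collects those realized by an
  operator with values on the line of the unit. If \<open>U\<close> were proper, some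
  \<open>v \<noteq> 0\<close> would be annihilated by all of them; but \<open>v\<close> can be moved
  to the vector \<open>x\<close> on which the rank one operator does not vanish.\<close>

lemma Mop_coord:
  assumes i: "i \<in> idx" and b0: "b0 \<in> bas i"
  shows "\<exists>T. Mop i T \<and> (\<forall>u. T u = sQ (Q.coord b0 u) (unit i))"
proof -
  obtain T0 y x where T0: "Mop i T0" "x \<in> B i" "T0 x = y" "y \<noteq> 0" "range T0 \<subseteq> Q.span {y}"
    using Mop_rank_one[OF i] by blast
  obtain T1 where T1: "Mop i T1" "T1 y = unit i"
    using Mop_transitive[OF i _ T0(4) proj_B[OF i]] Mop_B[OF T0(1) i, of x] T0(3) by blast
  have "\<forall>u. \<exists>r. T0 u = sQ r y" using T0(5) by (auto simp: Q.span_singleton)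
  then obtain \<phi> where \<phi>: "\<And>u. T0 u = sQ (\<phi> u) y" by metis
  define U where "U = {(\<Sum>b\<in>bas i. sQ (f b) b) | f. \<exists>T. Mop i T \<and> (\<forall>u. T u = sQ (f u) (unit i))}"
  interpret T1: Vector_Spaces.linear sQ sQ T1 by (rule Mop_endo[OF T1(1)])
  have UI: "(\<Sum>b\<in>bas i. sQ (f b) b) \<in> U" if "Mop i T" "\<And>u. T u = sQ (f u) (unit i)" for f T
    unfolding U_def using that by blast
  have sub: "Q.subspace U"
  proof (rule Q.subspaceI)
    show "0 \<in> U" using UI[OF Mop_zero[OF i], of "\<lambda>_. 0"] by simp
    fix u v assume "u \<in> U" "v \<in> U"
    then obtain f T g S where u: "u = (\<Sum>b\<in>bas i. sQ (f b) b)" "Mop i T" "\<And>u. T u = sQ (f u) (unit i)"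
      and v: "v = (\<Sum>b\<in>bas i. sQ (g b) b)" "Mop i S" "\<And>u. S u = sQ (g u) (unit i)"
      unfolding U_def by blast
    show "u + v \<in> U"
      using UI[OF Mop_add[OF u(2) v(2)], of "\<lambda>x. f x + g x"]
      by (simp add: u(1,3) v(1,3) Q.scale_left_distrib sum.distrib)
    show "sQ c u \<in> U" for c
      using UI[OF Mop_scale[OF u(2), of c], of "\<lambda>x. c * f x"]
      by (simp add: u(1,3) Q.scale_sum_right)
  qed
  have UB: "U \<subseteq> B i"
    unfolding U_def using bas_B[OF i]
    by (auto intro!: Q.subspace_sum[OF subspace_B[OF i]] Q.subspace_scale[OF subspace_B[OF i]])
  have "U = B i"
  proof (rule ccontr)
    assume "U \<noteq> B i"
    obtain C where C: "C \<subseteq> U" "Q.independent C" "U \<subseteq> Q.span C" "card C = Q.dim U"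
      by (rule Q.basis_exists)
    have finC: "finite C" using C(2) by (rule Q.finiteI_independent)
    have "Q.dim U < Q.dim (B i)"
      using Q.subspace_dim_equal[OF sub subspace_B[OF i] UB] \<open>U \<noteq> B i\<close> by linarith
    also have "Q.dim (B i) = card (bas i)"
      using Q.dim_span_eq_card_independent[OF independent_bas[OF i]] span_bas[OF i] by simp
    finally have "card C < card (bas i)" using C(4) by simp
    from underdetermined_system[OF finC finite_bas[OF i] this, of "\<lambda>b u. Q.coord b u"]
    obtain c where c: "\<exists>b\<in>bas i. c b \<noteq> 0" "\<And>u. u \<in> C \<Longrightarrow> (\<Sum>b\<in>bas i. c b * Q.coord b u) = 0" by blast
    have cU: "(\<Sum>b\<in>bas i. c b * Q.coord b u) = 0" if "u \<in> U" for u
    proof -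
      have "u \<in> Q.span C" using that C(3) by blast
      then show ?thesis
      proof (induction rule: Q.span_induct_alt)
        case (step r x y)
        have "(\<Sum>b\<in>bas i. c b * Q.coord b (sQ r x + y)) =
            r * (\<Sum>b\<in>bas i. c b * Q.coord b x) + (\<Sum>b\<in>bas i. c b * Q.coord b y)"
          by (simp add: Q.coord_add Q.coord_scale sum_distrib_left sum.distrib algebra_simps)
        with step c(2) show ?case by simp
      qed simp
    qed
    define v where "v = (\<Sum>b\<in>bas i. sQ (c b) b)"
    have v0: "v \<noteq> 0"
    proof
      assume "v = 0"
      then have "\<forall>b\<in>bas i. c b = 0"
        using Q.independentD[OF independent_bas[OF i] finite_bas[OF i], of c] unfolding v_def by blast
      with c(1) show False by blast
    qed
    have vB: "v \<in> B i" unfolding v_def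
      by (intro Q.subspace_sum[OF subspace_B[OF i]] Q.subspace_scale[OF subspace_B[OF i]] bas_B[OF i])
    obtain S where S: "Mop i S" "S v = x" using Mop_transitive[OF i vB v0 T0(2)] by blast
    define T where "T = (\<lambda>u. T1 (T0 (S u)))"
    have MT: "Mop i T" unfolding T_def by (rule Mop_comp[OF T1(1) Mop_comp[OF T0(1) S(1) i] i])
    have Tf: "T u = sQ (\<phi> (S u)) (unit i)" for u by (simp add: T_def \<phi> T1.scale T1(2))
    interpret T: Vector_Spaces.linear sQ sQ T by (rule Mop_endo[OF MT])
    have u: "(\<Sum>b\<in>bas i. sQ (\<phi> (S b)) b) \<in> U" by (rule UI[OF MT Tf])
    have "Q.coord b (\<Sum>b\<in>bas i. sQ (\<phi> (S b)) b) = \<phi> (S b)" if "b \<in> bas i" for b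
    proof -
      have "Q.coord b (\<Sum>b\<in>bas i. sQ (\<phi> (S b)) b) = (\<Sum>b'\<in>bas i. if b' = b then \<phi> (S b) else 0)"
        unfolding Q.coord_sum Q.coord_scale
        by (intro sum.cong refl, subst Q.coord_Basis) (use bas_BQ[OF i] in auto)
      then show ?thesis using that finite_bas[OF i] by simp
    qed
    then have "(\<Sum>b\<in>bas i. c b * \<phi> (S b)) = 0" using cU[OF u] by simp
    moreover have "T v = (\<Sum>b\<in>bas i. sQ (c b) (T b))" by (simp add: v_def T.sum T.scale)
    then have "T v = sQ (\<Sum>b\<in>bas i. c b * \<phi> (S b)) (unit i)"
      by (simp add: Tf Q.scale_sum_left)
    ultimately have "T v = 0" by simp
    then have "unit i = 0" using S(2) T0(3) T1(2) by (simp add: T_def)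
    then show False using unit_left[OF i vB] v0 by simp
  qed
  then have "b0 \<in> U" using bas_B[OF i b0] by simp
  then obtain f T where f: "b0 = (\<Sum>b\<in>bas i. sQ (f b) b)" "Mop i T" "\<And>u. T u = sQ (f u) (unit i)"
    unfolding U_def by blast
  interpret T: Vector_Spaces.linear sQ sQ T by (rule Mop_endo[OF f(2)])
  have fb: "f b = Q.coord b0 b" if b: "b \<in> bas i" for b
  proof -
    have "Q.coord b b0 = (\<Sum>b'\<in>bas i. if b' = b then f b else 0)"
      by (subst f(1), unfold Q.coord_sum Q.coord_scale, intro sum.cong refl, subst Q.coord_Basis)
         (use bas_BQ[OF i] in auto)
    then have "f b = Q.coord b b0" using b finite_bas[OF i] by simp
    moreover have "b0 \<in> BQ" "b \<in> BQ" using bas_BQ[OF i] b b0 by blast+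
    ultimately show ?thesis by (simp only: Q.coord_Basis) auto
  qed
  have "T u = sQ (Q.coord b0 u) (unit i)" for u
  proof -
    have "T u = T (\<Sum>b\<in>bas i. sQ (Q.coord b u) b)" using Mop_proj[OF f(2) i, of u] by (simp add: proj_def)
    also have "\<dots> = (\<Sum>b\<in>bas i. sQ (Q.coord b u) (T b))" by (simp only: T.sum T.scale)
    also have "\<dots> = (\<Sum>b\<in>bas i. sQ (Q.coord b u * Q.coord b0 b) (unit i))"
      by (intro sum.cong refl) (simp add: f(3) fb)
    also have "\<dots> = (\<Sum>b\<in>bas i. if b = b0 then sQ (Q.coord b0 u) (unit i) else 0)"
      by (intro sum.cong refl, subst Q.coord_Basis) (use bas_BQ[OF i] in auto)
    also have "\<dots> = sQ (Q.coord b0 u) (unit i)" using b0 finite_bas[OF i] by simp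
    finally show ?thesis .
  qed
  with f(2) show ?thesis by blast
qed

end

section \<open>Products with the largest number of radical factors\<close>

lemma (in fd_algebra) subspace_mult_vimage:
  assumes "subspace S" shows "subspace {x. a * x \<in> S}" "subspace {x. x * a \<in> S}"
proof -
  interpret l: Vector_Spaces.linear scale scale "\<lambda>x. a * x" by (rule linear_mult_left)
  interpret r: Vector_Spaces.linear scale scale "\<lambda>x. x * a" by (rule linear_mult_right)
  show "subspace {x. a * x \<in> S}" "subspace {x. x * a \<in> S}"
    using l.subspace_vimage[OF assms] r.subspace_vimage[OF assms] by (simp_all add: vimage_def)
qed

context codim_setup
begin

lemma Jp_mult: "x \<in> A.Jp m \<Longrightarrow> y \<in> A.Jp n \<Longrightarrow> x * y \<in> A.Jp (m + n)"
proof (induction m arbitrary: x y rule: A.Jp.induct)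
  case 1 then show ?case by (simp add: A.Jp_left)
next
  case 2
  then show ?case by (cases n) (simp_all add: J_right A.space_prodI)
next
  case (3 m)
  have "space_prod sA A.J (A.Jp (Suc m)) \<subseteq> {x. x * y \<in> A.Jp (Suc (Suc m) + n)}"
  proof (rule A.space_prod_subset)
    show "A.subspace {x. x * y \<in> A.Jp (Suc (Suc m) + n)}"
      by (rule A.subspace_mult_vimage[OF A.subspace_Jp])
    fix v w assume v: "v \<in> A.J" and w: "w \<in> A.Jp (Suc m)"
    have "w * y \<in> A.Jp (Suc (m + n))" using "3.IH"[OF w "3.prems"(2)] by simp
    then have "v * (w * y) \<in> space_prod sA A.J (A.Jp (Suc (m + n)))" by (intro A.space_prodI v)
    then show "v * w \<in> {x. x * y \<in> A.Jp (Suc (Suc m) + n)}" by (simp add: mult.assoc)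
  qed
  with "3.prems" show ?case by auto
qed

text \<open>The graded closure of the lift of \<open>B i\<close>; it is the space generated by the
  action of all functions on the semigroup, by \<open>dual_span_eq_W\<close>.\<close>

definition W :: "nat \<Rightarrow> 'a set" where "W i = A.span {A.hc t (\<kappa> b) | t b. b \<in> B i}"

lemma subspace_W: "A.subspace (W i)"
  unfolding W_def by (rule A.subspace_span)

lemma W_hc_kappa: "b \<in> B i \<Longrightarrow> A.hc t (\<kappa> b) \<in> W i"
  unfolding W_def by (rule A.span_base) blast

lemma W_kappa: assumes "b \<in> B i" shows "\<kappa> b \<in> W i"
proof -
  have "(\<Sum>t\<in>A.Supp. A.hc t (\<kappa> b)) \<in> W i"
    by (intro A.subspace_sum[OF subspace_W] W_hc_kappa assms)
  then show ?thesis by (simp add: A.hc_expand)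
qed

lemma W_subset:
  assumes "A.subspace S" "\<And>t b. b \<in> B i \<Longrightarrow> A.hc t (\<kappa> b) \<in> S" shows "W i \<subseteq> S"
  unfolding W_def using assms by (intro A.span_minimal) auto

lemma pi_W: assumes "i \<in> idx" "w \<in> W i" shows "\<pi> w \<in> B i"
proof -
  have "W i \<subseteq> \<pi> -` B i"
    by (intro W_subset pi.subspace_vimage subspace_B assms(1)) (simp add: B_graded assms(1))
  with assms show ?thesis by auto
qed

text \<open>A generator comes from \<open>b = b * unit i\<close>; lifting this product and taking
  components gives products of two elements of \<open>W i\<close>. The two halves leave room for an
  argument between them.\<close>

lemma W_split: assumes "i \<in> idx" shows "W i \<subseteq> A.span {x * y | x y. x \<in> W i \<and> y \<in> W i}"
proof (rule W_subset)
  fix t b assume b: "b \<in> B i"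
  have "A.hc t (\<kappa> b) = A.hc t (\<kappa> b * \<kappa> (unit i))"
    using unit_right[OF assms b] by (simp flip: kappa_mult)
  also have "\<dots> \<in> A.span {x * y | x y. x \<in> W i \<and> y \<in> W i}"
    unfolding A.hc_mult
  proof (intro A.span_sum)
    fix r s :: 't
    have "A.hc r (\<kappa> b) * A.hc s (\<kappa> (unit i)) \<in> A.span {x * y | x y. x \<in> W i \<and> y \<in> W i}"
      by (intro A.span_base) (use W_hc_kappa[OF b] W_hc_kappa[OF proj_B[OF assms]] in blast)
    then show "(if r * s = t then A.hc r (\<kappa> b) * A.hc s (\<kappa> (unit i)) else 0)
        \<in> A.span {x * y | x y. x \<in> W i \<and> y \<in> W i}"
      by (simp add: A.span_zero)
  qed
  finally show "A.hc t (\<kappa> b) \<in> A.span {x * y | x y. x \<in> W i \<and> y \<in> W i}" .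
qed simp

text \<open>Modulo \<open>J\<close> the element \<open>w\<close> lies in \<open>B i\<close>, which
  annihilates the other ideals. So next to a factor from \<open>W i\<close> only the
  \<open>B i\<close> part of an argument is visible.\<close>

lemma W_mult_J:
  assumes "i \<in> idx" "w \<in> W i" "proj i (\<pi> v) = 0" shows "w * v \<in> A.J"
  using B_mult_left[OF assms(1) pi_W[OF assms(1,2)], of "\<pi> v"] assms(3)
  by (simp add: pi_mult flip: pi_ker)

text \<open>\<open>Nch [i\<^sub>1, \<dots>, i\<^sub>r] s\<close> is the sum of all \<open>J\<^sup>s\<^sup>0 W i\<^sub>1 J\<^sup>s\<^sup>1 W i\<^sub>2 \<dots> W i\<^sub>r J\<^sup>s\<^sup>r\<close> with \<open>s0 + \<dots> + sr = s\<close>, where \<open>J\<^sup>0 = A\<close>.\<close>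

primrec Nch :: "nat list \<Rightarrow> nat \<Rightarrow> 'a set" where
  "Nch [] s = A.Jp s"
| "Nch (i # is) s = A.span {y * w * n | y w n a b. y \<in> A.Jp a \<and> w \<in> W i \<and> n \<in> Nch is b \<and> a + b = s}"

lemma subspace_Nch: "A.subspace (Nch is s)"
  by (cases "is") (simp_all add: A.subspace_Jp)

lemma NchI: "y \<in> A.Jp a \<Longrightarrow> w \<in> W i \<Longrightarrow> n \<in> Nch is b \<Longrightarrow> y * w * n \<in> Nch (i # is) (a + b)"
  unfolding Nch.simps by (rule A.span_base) blast

lemma Nch_subset:
  assumes "A.subspace S" 
    and "\<And>y w n a b. y \<in> A.Jp a \<Longrightarrow> w \<in> W i \<Longrightarrow> n \<in> Nch is b \<Longrightarrow> a + b = s \<Longrightarrow> y * w * n \<in> S"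
  shows "Nch (i # is) s \<subseteq> S"
  unfolding Nch.simps by (rule A.span_minimal[OF _ assms(1)]) (use assms(2) in blast)

lemma Nch_mult: "x \<in> A.Jp a \<Longrightarrow> n \<in> Nch is b \<Longrightarrow> x * n \<in> Nch is (a + b)"
proof (cases "is")
  case Nil
  then show "x \<in> A.Jp a \<Longrightarrow> n \<in> Nch is b \<Longrightarrow> x * n \<in> Nch is (a + b)" by (simp add: Jp_mult)
next
  case (Cons i js)
  assume x: "x \<in> A.Jp a" and n: "n \<in> Nch is b"
  have "Nch (i # js) b \<subseteq> {n. x * n \<in> Nch (i # js) (a + b)}"
  proof (rule Nch_subset)
    show "A.subspace {n. x * n \<in> Nch (i # js) (a + b)}"
      by (rule A.subspace_mult_vimage[OF subspace_Nch])
    fix y w n c d assume "y \<in> A.Jp c" "w \<in> W i" "n \<in> Nch js d" "c + d = b"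
    then have "(x * y) * w * n \<in> Nch (i # js) ((a + c) + d)"
      by (intro NchI Jp_mult x)
    with \<open>c + d = b\<close> show "y * w * n \<in> {n. x * n \<in> Nch (i # js) (a + b)}"
      by (simp add: mult.assoc add.assoc del: Nch.simps)
  qed
  with n Cons show "x * n \<in> Nch is (a + b)" by blast
qed

lemma Nch_left: "n \<in> Nch is b \<Longrightarrow> x * n \<in> Nch is b"
  using Nch_mult[of x 0 n "is" b] by simp

lemma Nch_J: "x \<in> A.J \<Longrightarrow> n \<in> Nch is b \<Longrightarrow> x * n \<in> Nch is (Suc b)"
  using Nch_mult[of x 1 n "is" b] by simp

lemma Nch_eventually_zero: "\<exists>S. \<forall>s\<ge>S. Nch is s \<subseteq> {0}"
proof (induction "is")
  case Nil
  obtain p where "A.Jp p = {0}" using A.J_nilpotent by blast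
  then show ?case using A.Jp_antimono[of p] by (intro exI[of _ p]) auto
next
  case (Cons i "is")
  obtain p where p: "A.Jp p = {0}" using A.J_nilpotent by blast
  obtain S where S: "\<And>s. s \<ge> S \<Longrightarrow> Nch is s \<subseteq> {0}" using Cons by blast
  have "Nch (i # is) s \<subseteq> {0}" if s: "p + S \<le> s" for s
  proof (rule Nch_subset)
    fix y w n a b assume y: "y \<in> A.Jp a" and n: "n \<in> Nch is b" and "a + b = s"
    then have "p \<le> a \<or> S \<le> b" using s by linarith
    then have "y = 0 \<or> n = 0" using y n p A.Jp_antimono[of p a] S[of b] by blast
    then show "y * w * n \<in> {0}" by auto
  qed simp
  then show ?case by blast
qed

text \<open>A slot for an argument is inserted inside each factor from \<open>W i\<close>, after writing it as a product of two.\<close>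

inductive SF :: "nat list \<Rightarrow> nat \<Rightarrow> ((nat \<Rightarrow> 'a) \<Rightarrow> 'a) \<Rightarrow> bool" where
  SF_Nil: "y \<in> A.Jp s \<Longrightarrow> SF [] s (\<lambda>_. y)"
| SF_Cons: "y \<in> A.Jp a \<Longrightarrow> w \<in> W i \<Longrightarrow> w' \<in> W i \<Longrightarrow> SF is b f \<Longrightarrow>
    SF (i # is) (a + b) (\<lambda>v. y * w * (v i * (w' * f v)))"

abbreviation "lift_unit \<equiv> (\<lambda>i. \<kappa> (unit i))"

lemma SF_Nch: "SF is s f \<Longrightarrow> f v \<in> Nch is s"
proof (induction rule: SF.induct)
  case (SF_Cons y a w i w' "is" b f)
  then show ?case by (intro NchI Nch_left)
qed simp

text \<open>An argument may be replaced by the multiple of the lifted unit that agrees with it on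
  \<open>B i\<close>: the factor from \<open>W i\<close> to its left turns the difference into an
  element of \<open>J\<close>, so the error has one more radical factor.\<close>

lemma SF_value:
  assumes "SF is s f" "set is \<subseteq> idx" "\<And>i. i \<in> set is \<Longrightarrow> proj i (\<pi> (v i)) = sQ (c i) (unit i)"
  shows "f v - sA (\<Prod>i\<leftarrow>is. c i) (f lift_unit) \<in> Nch is (Suc s)"
  using assms
proof (induction rule: SF.induct)
  case (SF_Nil y s)
  then show ?case by (simp add: A.subspace_0[OF A.subspace_Jp])
next
  case (SF_Cons y a w i w' "is" b f)
  have i: "i \<in> idx" using SF_Cons.prems by simp
  let ?c = "\<Prod>i\<leftarrow>is. c i" and ?u = "lift_unit"
  have uu: "proj i (unit i) = unit i" by (rule proj_self[OF i proj_B[OF i]])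
  have "proj i (\<pi> (v i - sA (c i) (?u i))) = 0"
    using SF_Cons.prems(2)[of i] by (simp add: pi.diff pi.scale pi_kappa proj.diff proj.scale uu)
  then have "w * (v i - sA (c i) (?u i)) \<in> A.J" by (rule W_mult_J[OF i SF_Cons.hyps(2)])
  then have "y * (w * (v i - sA (c i) (?u i))) \<in> A.Jp (a + 1)"
    using Jp_mult[OF SF_Cons.hyps(1), of _ 1] by simp
  then have t1: "(y * (w * (v i - sA (c i) (?u i)))) * w' * f v \<in> Nch (i # is) ((a + 1) + b)"
    by (intro NchI SF_Cons.hyps SF_Nch[OF SF_Cons.hyps(4)])
  have IH: "f v - sA ?c (f ?u) \<in> Nch is (Suc b)" using SF_Cons by simp
  have t2: "y * w * (?u i * (w' * (f v - sA ?c (f ?u)))) \<in> Nch (i # is) (a + Suc b)"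
    by (intro NchI SF_Cons.hyps Nch_left IH)
  have "y * w * (v i * (w' * f v)) - sA (c i * ?c) (y * w * (?u i * (w' * f ?u))) =
      (y * (w * (v i - sA (c i) (?u i)))) * w' * f v
      + sA (c i) (y * w * (?u i * (w' * (f v - sA ?c (f ?u)))))"
    by (simp add: algebra_simps A.scale_mult_left A.scale_mult_right A.scale_right_diff_distrib)
  moreover have "\<dots> \<in> Nch (i # is) (Suc (a + b))"
    using t1 A.subspace_scale[OF subspace_Nch t2, of "c i"]
    by (intro A.subspace_add[OF subspace_Nch]) (simp_all del: Nch.simps)
  ultimately show ?case by (simp del: Nch.simps)
qed

text \<open>Once a factor from \<open>W i\<close> is split in two, a lifted unit can be inserted
  between the halves: it acts there as the identity up to an element of \<open>J\<close>, and this
  error goes into the next layer.\<close>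

lemma Nch_subset_slots:
  assumes "set is \<subseteq> idx"
  shows "Nch is s \<subseteq> A.span ({f lift_unit | f. SF is s f} \<union> Nch is (Suc s))"
  using assms
proof (induction "is" arbitrary: s)
  case Nil
  have "x \<in> {f lift_unit | f. SF [] s f}" if "x \<in> A.Jp s" for x
    using SF_Nil[OF that] by (intro CollectI exI[of _ "\<lambda>_. x"]) simp
  then have "A.Jp s \<subseteq> {f lift_unit | f. SF [] s f} \<union> Nch [] (Suc s)" by blast
  then show ?case unfolding Nch.simps(1)[of s] using A.span_superset by blast
next
  case (Cons i "is")
  have i: "i \<in> idx" using Cons.prems by simp
  let ?u = "lift_unit"
  let ?R = "A.span ({f ?u | f. SF (i # is) s f} \<union> Nch (i # is) (Suc s))"
  have RN: "x \<in> ?R" if "x \<in> Nch (i # is) (Suc s)" for x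
    using that by (intro A.span_base) blast
  show ?case
  proof (rule Nch_subset[OF A.subspace_span])
    fix y w n a b assume y: "y \<in> A.Jp a" and w: "w \<in> W i" and n: "n \<in> Nch is b" and s: "a + b = s"
    have base: "y * (w1 * w2) * n' \<in> ?R" if w12: "w1 \<in> W i" "w2 \<in> W i"
      and n': "n' \<in> {f ?u | f. SF is b f} \<union> Nch is (Suc b)" for w1 w2 n'
    proof (cases "n' \<in> Nch is (Suc b)")
      case True
      then have "y * w1 * (w2 * n') \<in> Nch (i # is) (a + Suc b)" by (intro NchI Nch_left y w12)
      then show ?thesis using s by (intro RN) (simp add: mult.assoc del: Nch.simps)
    next
      case False
      then obtain f where f: "n' = f ?u" "SF is b f" using n' by blast
      have "\<pi> (w2 - ?u i * w2) = 0"
        using unit_left[OF i pi_W[OF i w12(2)]] by (simp add: pi.diff pi_mult pi_kappa)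
      then have "(w2 - ?u i * w2) * n' \<in> Nch is (Suc b)"
        unfolding pi_ker f(1) by (intro Nch_J SF_Nch f)
      then have "y * w1 * ((w2 - ?u i * w2) * n') \<in> Nch (i # is) (a + Suc b)" by (intro NchI y w12)
      then have 1: "y * w1 * ((w2 - ?u i * w2) * n') \<in> ?R" using s by (intro RN) (simp del: Nch.simps)
      have "y * w1 * (?u i * (w2 * f ?u)) \<in> {f ?u | f. SF (i # is) s f}"
        using SF_Cons[OF y w12 f(2)] s
        by (intro CollectI exI[of _ "\<lambda>v. y * w1 * (v i * (w2 * f v))"]) simp
      then have 2: "y * w1 * (?u i * (w2 * f ?u)) \<in> ?R" by (intro A.span_base) blast
      have "y * (w1 * w2) * n' = y * w1 * (?u i * (w2 * f ?u)) + y * w1 * ((w2 - ?u i * w2) * n')"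
        by (simp add: algebra_simps f(1))
      then show ?thesis using A.span_add[OF 2 1] by (simp only:)
    qed
    have step: "y * (w1 * w2) * n \<in> ?R" if w12: "w1 \<in> W i" "w2 \<in> W i" for w1 w2
    proof -
      have "A.span ({f ?u | f. SF is b f} \<union> Nch is (Suc b)) \<subseteq> {n. y * (w1 * w2) * n \<in> ?R}"
        by (rule A.span_minimal)
           (use base[OF w12] A.subspace_mult_vimage[OF A.subspace_span] in blast)+
      moreover have "n \<in> A.span ({f ?u | f. SF is b f} \<union> Nch is (Suc b))"
        using Cons n by auto
      ultimately show ?thesis by blast
    qed
    have "A.subspace {w. y * w * n \<in> ?R}"
    proof -
      have "{w. y * w * n \<in> ?R} = {w. y * w \<in> {x. x * n \<in> ?R}}" by simp
      then show ?thesis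
        using A.subspace_mult_vimage(1)[OF A.subspace_mult_vimage(2)[OF A.subspace_span]] by (simp only:)
    qed
    then have "A.span {x * y | x y. x \<in> W i \<and> y \<in> W i} \<subseteq> {w. y * w * n \<in> ?R}"
      by (intro A.span_minimal) (use step in blast)+
    then show "y * w * n \<in> ?R" using W_split[OF i] w by blast
  qed
qed

text \<open>With \<open>s\<close> the number of radical factors just before the products first
  vanish, all error terms of the next layer are 0. So some slot function is nonzero at the lifted
  units, and its value at other arguments follows without error.\<close>

lemma ex_slot_function:
  assumes "set is \<subseteq> idx" "Nch is 0 \<noteq> {0}"
  shows "\<exists>s f. SF is s f \<and> f lift_unit \<noteq> 0 \<and>
    (\<forall>v c. (\<forall>i\<in>set is. proj i (\<pi> (v i)) = sQ (c i) (unit i)) \<longrightarrow>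
       f v = sA (\<Prod>i\<leftarrow>is. c i) (f lift_unit))"
proof -
  have zero: "0 \<in> Nch is s" for s by (rule A.subspace_0[OF subspace_Nch])
  obtain S where S: "\<And>s. s \<ge> S \<Longrightarrow> Nch is s \<subseteq> {0}" using Nch_eventually_zero by blast
  define s where "s = (LEAST s. Nch is s \<subseteq> {0}) - 1"
  have "Nch is (LEAST s. Nch is s \<subseteq> {0}) \<subseteq> {0}" by (rule LeastI[of _ S]) (simp add: S)
  moreover from this have "(LEAST s. Nch is s \<subseteq> {0}) \<noteq> 0"
    using assms(2) zero[of 0] by (metis empty_iff subset_singletonD)
  ultimately have s: "Nch is (Suc s) \<subseteq> {0}" "\<not> Nch is s \<subseteq> {0}"
    using not_less_Least[of s "\<lambda>s. Nch is s \<subseteq> {0}"] by (auto simp: s_def)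
  have "\<exists>f. SF is s f \<and> f lift_unit \<noteq> 0"
  proof (rule ccontr)
    assume "\<not> ?thesis"
    then have "{f lift_unit | f. SF is s f} \<union> Nch is (Suc s) \<subseteq> {0}" using s(1) by blast
    from A.span_mono[OF this] Nch_subset_slots[OF assms(1), of s] s(2) show False by simp
  qed
  then obtain f where f: "SF is s f" "f lift_unit \<noteq> 0" by blast
  have "f v = sA (\<Prod>i\<leftarrow>is. c i) (f lift_unit)"
    if "\<forall>i\<in>set is. proj i (\<pi> (v i)) = sQ (c i) (unit i)" for v c
    using SF_value[OF f(1) assms(1), of v c] that s(1) by auto
  with f show ?thesis by blast
qed

section \<open>Slot functions and coordinates as polynomial functions\<close>

lemma BA_nonempty: "BA \<noteq> {}"
proof
  assume "BA = {}"
  then have "A.span {} = UNIV" using A.span_Basis by simp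
  then have 0: "x = 0" for x :: 'a by auto
  obtain i where i: "i \<in> idx" using idx_nonempty by blast
  have "u = 0" for u :: 'q using 0[of "\<kappa> u"] pi_kappa[of u] pi.zero by simp
  then show False using B_nontrivial[OF i] Q.subspace_0[OF subspace_B[OF i]] by blast
qed

text \<open>Each factor brings the three constants \<open>y\<close>, \<open>w\<close>,
  \<open>w'\<close>, and the product ends with one more.\<close>

lemma SF_gfun:
  assumes "SF is s f" "distinct is"
    and "\<And>i. i \<in> set is \<Longrightarrow> A.gfun (X i) (c i) (g i)"
    and "\<And>i j. i \<in> set is \<Longrightarrow> j \<in> set is \<Longrightarrow> i \<noteq> j \<Longrightarrow> X i \<inter> X j = {}"
  shows "A.gfun (\<Union>i\<in>set is. X i) ((\<Sum>i\<leftarrow>is. c i) + 3 * length is + 1) (\<lambda>x. f (\<lambda>i. g i x))"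
  using assms
proof (induction rule: SF.induct)
  case (SF_Nil y s)
  then show ?case using A.gfun_const[OF BA_nonempty, of y] by simp
next
  case (SF_Cons y a w i w' "is" b f)
  note const = A.gfun_const[OF BA_nonempty]
  have IH: "A.gfun (\<Union>j\<in>set is. X j) ((\<Sum>i\<leftarrow>is. c i) + 3 * length is + 1) (\<lambda>x. f (\<lambda>i. g i x))"
    by (rule SF_Cons.IH) (use SF_Cons.prems in auto)
  have "A.gfun (({} \<union> {}) \<union> (X i \<union> ({} \<union> (\<Union>j\<in>set is. X j))))
     ((1 + 1) + (c i + (1 + ((\<Sum>i\<leftarrow>is. c i) + 3 * length is + 1))))
     (\<lambda>x. y * w * (g i x * (w' * f (\<lambda>i. g i x))))"
  proof (intro A.gfun_mult const IH)
    show "A.gfun (X i) (c i) (g i)" by (rule SF_Cons.prems(2)) simp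
    show "X i \<inter> ({} \<union> (\<Union>j\<in>set is. X j)) = {}"
      using SF_Cons.prems(1) SF_Cons.prems(3)[of i] by force
  qed auto
  moreover have "(1 + 1) + (c i + (1 + ((\<Sum>i\<leftarrow>is. c i) + 3 * length is + 1))) =
      (\<Sum>i\<leftarrow>i # is. c i) + 3 * length (i # is) + 1" by simp
  moreover have "({} \<union> {}) \<union> (X i \<union> ({} \<union> (\<Union>j\<in>set is. X j))) = (\<Union>j\<in>set (i # is). X j)" by simp
  ultimately show ?case by (simp only:)
qed

lemma Mop_gfun:
  assumes "Mop i T" shows "\<exists>E. A.gfun {k} 2 E \<and> (\<forall>x. \<pi> (E x) = T (\<pi> (x k)))"
  using assms
proof (induction rule: Mop.induct)
  case (Mop_base b c t)
  note const = A.gfun_const[OF BA_nonempty]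
  have "A.gfun (({} \<union> {k}) \<union> {}) ((1 + 0) + 1) (\<lambda>x. \<kappa> b * A.hc t (x k) * \<kappa> c)"
    by (intro A.gfun_mult const A.gfun_hc A.gfun_var) auto
  moreover have "\<pi> (\<kappa> b * A.hc t (x k) * \<kappa> c) = b * hq t (\<pi> (x k)) * c" for x
    by (simp add: pi_mult pi_kappa hq_pi)
  ultimately show ?case by (intro exI[of _ "\<lambda>x. \<kappa> b * A.hc t (x k) * \<kappa> c"]) (simp add: numeral_2_eq_2)
next
  case (Mop_add T T')
  then obtain E E' where "A.gfun {k} 2 E" "A.gfun {k} 2 E'"
    "\<And>x. \<pi> (E x) = T (\<pi> (x k))" "\<And>x. \<pi> (E' x) = T' (\<pi> (x k))" by blast
  then show ?case by (intro exI[of _ "\<lambda>x. E x + E' x"] conjI A.gfun_add) (simp_all add: pi.add)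
next
  case (Mop_scale T r)
  then obtain E where "A.gfun {k} 2 E" "\<And>x. \<pi> (E x) = T (\<pi> (x k))" by blast
  then show ?case by (intro exI[of _ "\<lambda>x. sA r (E x)"] conjI A.gfun_scale) (simp_all add: pi.scale)
qed

text \<open>A coordinate times the unit is a multiplication operator, which is lifted with two
  constants. The product of these multiples of the unit is the unit times the product of the
  coordinates.\<close>

lemma ex_coord_product:
  assumes i: "i \<in> idx" and "bs \<noteq> []" "distinct bs" "set bs \<subseteq> bas i" "inj_on \<nu> (set bs)"
  shows "\<exists>g. A.gfun (\<nu> ` set bs) (2 * length bs) g \<and>
    (\<forall>x. proj i (\<pi> (g x)) = sQ (\<Prod>b\<in>set bs. Q.coord b (\<pi> (x (\<nu> b)))) (unit i))"
  using assms(2-)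
proof (induction bs rule: list_nonempty_induct)
  case (single b)
  obtain T where T: "Mop i T" "\<And>u. T u = sQ (Q.coord b u) (unit i)"
    using Mop_coord[OF i, of b] single by auto
  obtain E where E: "A.gfun {\<nu> b} 2 E" "\<And>x. \<pi> (E x) = T (\<pi> (x (\<nu> b)))"
    using Mop_gfun[OF T(1), of "\<nu> b"] by blast
  then show ?case using proj_self[OF i proj_B[OF i]] by (intro exI[of _ E]) (simp add: T(2) proj.scale)
next
  case (cons b bs)
  obtain T where T: "Mop i T" "\<And>u. T u = sQ (Q.coord b u) (unit i)"
    using Mop_coord[OF i, of b] cons by auto
  obtain E where E: "A.gfun {\<nu> b} 2 E" "\<And>x. \<pi> (E x) = T (\<pi> (x (\<nu> b)))"
    using Mop_gfun[OF T(1), of "\<nu> b"] by blast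
  obtain g where g: "A.gfun (\<nu> ` set bs) (2 * length bs) g"
    "\<And>x. proj i (\<pi> (g x)) = sQ (\<Prod>b\<in>set bs. Q.coord b (\<pi> (x (\<nu> b)))) (unit i)"
    using cons by auto
  have "\<nu> b \<notin> \<nu> ` set bs" using cons.prems by auto
  then have "A.gfun ({\<nu> b} \<union> \<nu> ` set bs) (2 + 2 * length bs) (\<lambda>x. E x * g x)"
    by (intro A.gfun_mult E g) auto
  moreover have "proj i (\<pi> (E x * g x)) = sQ (\<Prod>b\<in>set (b # bs). Q.coord b (\<pi> (x (\<nu> b)))) (unit i)" for x
  proof -
    have "proj i (\<pi> (E x * g x)) = proj i (\<pi> (E x)) * proj i (\<pi> (g x))"
      by (simp add: pi_mult proj_mult[OF i])
    also have "\<dots> = sQ (Q.coord b (\<pi> (x (\<nu> b)))) (unit i) * sQ (\<Prod>b\<in>set bs. Q.coord b (\<pi> (x (\<nu> b)))) (unit i)"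
      using proj_self[OF i proj_B[OF i]] by (simp add: g(2) E(2) T(2) proj.scale)
    also have "\<dots> = sQ (\<Prod>b\<in>set (b # bs). Q.coord b (\<pi> (x (\<nu> b)))) (unit i)"
      using cons.prems unit_left[OF i proj_B[OF i]]
      by (simp add: Q.scale_mult_left Q.scale_mult_right)
    finally show ?thesis .
  qed
  ultimately show ?case by (intro exI[of _ "\<lambda>x. E x * g x"]) simp
qed

end

section \<open>Determinants and trace functions\<close>

definition ldet :: "'k set \<Rightarrow> ('k \<Rightarrow> 'k \<Rightarrow> 'r::field_char_0) \<Rightarrow> 'r" where
  "ldet D M = (\<Sum>\<tau> | \<tau> permutes D. of_int (sign \<tau>) * (\<Prod>b\<in>D. M b (\<tau> b)))"

text \<open>Composition with the transposition of \<open>j\<close> and \<open>l\<close> changes only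
  the sign, so the sum equals its own negative and vanishes in characteristic 0.\<close>

lemma ldet_repeated_row:
  fixes M :: "'k \<Rightarrow> 'k \<Rightarrow> 'r::field_char_0"
  assumes "finite D" "j \<in> D" "l \<in> D" "l \<noteq> j"
  shows "(\<Sum>\<tau> | \<tau> permutes D. of_int (sign \<tau>) * (M l (\<tau> j) * (\<Prod>b\<in>D - {j}. M b (\<tau> b)))) = 0"
proof -
  define t where "t = transpose j l"
  have t: "t permutes D" unfolding t_def by (rule permutes_swap_id) (use assms in auto)
  let ?f = "\<lambda>\<tau>. of_int (sign \<tau>) * (M l (\<tau> j) * (\<Prod>b\<in>D - {j}. M b (\<tau> b)))"
  have split: "(\<Prod>b\<in>D - {j}. M b (\<tau> b)) = M l (\<tau> l) * (\<Prod>b\<in>D - {j} - {l}. M b (\<tau> b))" for \<tau>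
    using assms by (subst prod.remove[of _ l]) auto
  have "?f (\<tau> \<circ> t) = - ?f \<tau>" if "\<tau> permutes D" for \<tau>
  proof -
    have "sign (\<tau> \<circ> t) = sign \<tau> * sign t"
      using that t assms(1) permutation_permutes by (intro sign_compose) blast+
    moreover have "sign t = - 1" using assms(4) by (simp add: t_def sign_swap_id)
    moreover have "(\<Prod>b\<in>D - {j} - {l}. M b ((\<tau> \<circ> t) b)) = (\<Prod>b\<in>D - {j} - {l}. M b (\<tau> b))"
      by (intro prod.cong refl) (auto simp: t_def transpose_def)
    ultimately show ?thesis unfolding split by (simp add: t_def)
  qed
  then have "sum (\<lambda>\<tau>. ?f (\<tau> \<circ> t)) {\<tau>. \<tau> permutes D} = - sum ?f {\<tau>. \<tau> permutes D}"
    by (simp add: sum_negf)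
  moreover have "sum ?f {\<tau>. \<tau> permutes D} = sum (\<lambda>\<tau>. ?f (\<tau> \<circ> t)) {\<tau>. \<tau> permutes D}"
    by (rule sum_permutations_compose_right[OF t])
  ultimately have "sum ?f {\<tau>. \<tau> permutes D} = - sum ?f {\<tau>. \<tau> permutes D}" by (simp only:)
  then show ?thesis by (simp add: eq_neg_iff_add_eq_0 flip: mult_2)
qed

text \<open>An endomorphism acts on a top degree alternating form, as a derivation, by its trace.\<close>

lemma ldet_derivation:
  fixes M :: "'k \<Rightarrow> 'k \<Rightarrow> 'r::field_char_0"
  assumes D: "finite D"
  shows "(\<Sum>k\<in>D. ldet D (\<lambda>b k'. if k' = k then \<Sum>l\<in>D. H b l * M l k else M b k')) =
    (\<Sum>b\<in>D. H b b) * ldet D M"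
proof -
  let ?P = "{\<tau>. \<tau> permutes D}"
  have "(\<Sum>k\<in>D. ldet D (\<lambda>b k'. if k' = k then \<Sum>l\<in>D. H b l * M l k else M b k')) =
      (\<Sum>\<tau>\<in>?P. \<Sum>k\<in>D. of_int (sign \<tau>) * (\<Prod>b\<in>D. if \<tau> b = k then \<Sum>l\<in>D. H b l * M l k else M b (\<tau> b)))"
    unfolding ldet_def by (rule sum.swap)
  also have "\<dots> = (\<Sum>\<tau>\<in>?P. \<Sum>j\<in>D. \<Sum>l\<in>D. H j l * (of_int (sign \<tau>) * (M l (\<tau> j) * (\<Prod>b\<in>D - {j}. M b (\<tau> b)))))"
  proof (rule sum.cong[OF refl])
    fix \<tau> assume "\<tau> \<in> ?P"
    then have \<tau>: "\<tau> permutes D" by simp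
    have "(\<Sum>k\<in>D. of_int (sign \<tau>) * (\<Prod>b\<in>D. if \<tau> b = k then \<Sum>l\<in>D. H b l * M l k else M b (\<tau> b))) =
        (\<Sum>j\<in>D. of_int (sign \<tau>) * (\<Prod>b\<in>D. if \<tau> b = \<tau> j then \<Sum>l\<in>D. H b l * M l (\<tau> j) else M b (\<tau> b)))"
      by (rule sum.reindex_bij_betw[symmetric]) (rule permutes_imp_bij[OF \<tau>])
    also have "\<dots> = (\<Sum>j\<in>D. \<Sum>l\<in>D. H j l * (of_int (sign \<tau>) * (M l (\<tau> j) * (\<Prod>b\<in>D - {j}. M b (\<tau> b)))))"
    proof (rule sum.cong[OF refl])
      fix j assume j: "j \<in> D"
      have "(\<Prod>b\<in>D. if \<tau> b = \<tau> j then \<Sum>l\<in>D. H b l * M l (\<tau> j) else M b (\<tau> b)) =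
          (\<Sum>l\<in>D. H j l * M l (\<tau> j)) * (\<Prod>b\<in>D - {j}. if \<tau> b = \<tau> j then \<Sum>l\<in>D. H b l * M l (\<tau> j) else M b (\<tau> b))"
        using D j by (subst prod.remove[of D j]) auto
      also have "(\<Prod>b\<in>D - {j}. if \<tau> b = \<tau> j then \<Sum>l\<in>D. H b l * M l (\<tau> j) else M b (\<tau> b)) =
          (\<Prod>b\<in>D - {j}. M b (\<tau> b))"
        by (intro prod.cong refl) (use permutes_inj[OF \<tau>] in \<open>auto dest: injD\<close>)
      finally show "of_int (sign \<tau>) * (\<Prod>b\<in>D. if \<tau> b = \<tau> j then \<Sum>l\<in>D. H b l * M l (\<tau> j) else M b (\<tau> b)) =
          (\<Sum>l\<in>D. H j l * (of_int (sign \<tau>) * (M l (\<tau> j) * (\<Prod>b\<in>D - {j}. M b (\<tau> b)))))"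
        by (simp add: sum_distrib_right sum_distrib_left mult_ac)
    qed
    finally show "(\<Sum>k\<in>D. of_int (sign \<tau>) * (\<Prod>b\<in>D. if \<tau> b = k then \<Sum>l\<in>D. H b l * M l k else M b (\<tau> b))) =
        (\<Sum>j\<in>D. \<Sum>l\<in>D. H j l * (of_int (sign \<tau>) * (M l (\<tau> j) * (\<Prod>b\<in>D - {j}. M b (\<tau> b)))))" .
  qed
  also have "\<dots> = (\<Sum>j\<in>D. \<Sum>\<tau>\<in>?P. \<Sum>l\<in>D. H j l * (of_int (sign \<tau>) * (M l (\<tau> j) * (\<Prod>b\<in>D - {j}. M b (\<tau> b)))))"
    by (rule sum.swap)
  also have "\<dots> = (\<Sum>j\<in>D. \<Sum>l\<in>D. \<Sum>\<tau>\<in>?P. H j l * (of_int (sign \<tau>) * (M l (\<tau> j) * (\<Prod>b\<in>D - {j}. M b (\<tau> b)))))"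
    by (intro sum.cong refl sum.swap)
  also have "\<dots> = (\<Sum>j\<in>D. \<Sum>l\<in>D. if l = j then H j j * ldet D M else 0)"
  proof (intro sum.cong refl)
    fix j l assume j: "j \<in> D" and l: "l \<in> D"
    show "(\<Sum>\<tau>\<in>?P. H j l * (of_int (sign \<tau>) * (M l (\<tau> j) * (\<Prod>b\<in>D - {j}. M b (\<tau> b))))) =
        (if l = j then H j j * ldet D M else 0)"
    proof (cases "l = j")
      case True
      then have "(\<Sum>\<tau>\<in>?P. of_int (sign \<tau>) * (M l (\<tau> j) * (\<Prod>b\<in>D - {j}. M b (\<tau> b)))) = ldet D M"
        unfolding ldet_def using D j by (simp add: prod.remove[of D j])
      then show ?thesis using True by (simp flip: sum_distrib_left)
    next
      case False
      then show ?thesis using ldet_repeated_row[OF D j l False, of M] by (simp flip: sum_distrib_left)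
    qed
  qed
  also have "\<dots> = (\<Sum>b\<in>D. H b b) * ldet D M"
    using D by (simp add: sum_distrib_right)
  finally show ?thesis .
qed

lemma ldet_identity:
  assumes "finite D" "\<And>b k. b \<in> D \<Longrightarrow> k \<in> D \<Longrightarrow> M b k = (if b = k then 1 else 0)"
  shows "ldet D M = 1"
proof -
  have "(\<Prod>b\<in>D. M b (\<tau> b)) = 0" if \<tau>: "\<tau> permutes D" "\<tau> \<noteq> id" for \<tau>
  proof -
    obtain b where "\<tau> b \<noteq> b" using \<tau>(2) by (metis eq_id_iff)
    then have "b \<in> D" "M b (\<tau> b) = 0"
      using assms(2)[of b "\<tau> b"] permutes_in_image[OF \<tau>(1), of b] permutes_not_in[OF \<tau>(1), of b]
      by auto
    then show ?thesis using assms(1) by auto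
  qed
  then have "ldet D M = (\<Sum>\<tau> | \<tau> permutes D. if \<tau> = id then 1 else 0)"
    unfolding ldet_def by (intro sum.cong refl) (auto simp: assms(2) permutes_id)
  also have "\<dots> = 1" using finite_permutations[OF assms(1)] by (simp add: permutes_id)
  finally show ?thesis .
qed

lemma (in graded_algebra) gfun_subst_constants:
  assumes "gfun X c F" "finite K" "K \<subseteq> X" "Basis \<noteq> {}"
  shows "gfun (X - K) (c + card K) (\<lambda>x. F (\<lambda>i. if i \<in> K then z i else x i))"
  using assms(2,3)
proof (induction K rule: finite_induct)
  case empty
  then show ?case using assms(1) by simp
next
  case (insert k K)
  have "gfun (X - K - {k} \<union> {}) (c + card K + 1)
      (\<lambda>x. F (\<lambda>i. if i \<in> K then z i else (x(k := z k)) i))"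
    by (rule gfun_subst[OF insert.IH _ gfun_const[OF assms(4)]]) (use insert in auto)
  moreover have "(\<lambda>x. F (\<lambda>i. if i \<in> K then z i else (x(k := z k)) i)) =
      (\<lambda>x. F (\<lambda>i. if i \<in> insert k K then z i else x i))"
    using insert(2) by (intro ext arg_cong[of _ _ F]) auto
  moreover have "X - K - {k} \<union> {} = X - insert k K" by auto
  moreover have "c + card K + 1 = c + card (insert k K)" using insert by simp
  ultimately show ?case by (simp only:)
qed

section \<open>Determinants and traces on a sum of the ideals \<open>B i\<close>\<close>

context codim_setup
begin

definition Dset :: "nat list \<Rightarrow> 'q set" where "Dset js = (\<Union>i\<in>set js. bas i)"

text \<open>There are two kinds of variables: \<open>Inr k\<close>, one for each basis vector
  \<open>k\<close>, are the alternating ones, and \<open>Inl i\<close> are those to be paired in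
  trace forms.\<close>

definition Dt :: "'q set \<Rightarrow> (nat + 'q \<Rightarrow> 'a) \<Rightarrow> 'f" where
  "Dt D x = ldet D (\<lambda>b k. Q.coord b (\<pi> (x (Inr k))))"

text \<open>The trace of left multiplication by \<open>u\<close> on the sum of the chosen
  ideals.\<close>

definition tD :: "'q set \<Rightarrow> 'q \<Rightarrow> 'f" where "tD D u = (\<Sum>b\<in>D. Q.coord b (u * b))"

lemma finite_Dset: "set js \<subseteq> idx \<Longrightarrow> finite (Dset js)"
  unfolding Dset_def using finite_bas by auto

lemma Dset_BQ: "set js \<subseteq> idx \<Longrightarrow> Dset js \<subseteq> BQ"
  unfolding Dset_def BQ_eq by blast

lemma coord_other:
  assumes "i \<in> idx" "j \<in> idx" "i \<noteq> j" "b \<in> bas i" "u \<in> B j" shows "Q.coord b u = 0"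
  using coord_proj[OF assms(1,4), of u] proj_other[OF assms(1-3,5)] by simp

text \<open>Left multiplication preserves every \<open>B i\<close>, so coordinates in the chosen
  ideals depend only on coordinates there. Thus it acts by a matrix on the columns of the
  determinant.\<close>

lemma coord_mult:
  assumes js: "set js \<subseteq> idx" and b: "b \<in> Dset js"
  shows "Q.coord b (a * u) = (\<Sum>l\<in>Dset js. Q.coord b (a * l) * Q.coord l u)"
proof -
  obtain i where i: "i \<in> set js" "b \<in> bas i" using b by (auto simp: Dset_def)
  have ii: "i \<in> idx" using i js by blast
  have "Q.coord b (a * u) = Q.coord b (proj i (a * u))" by (simp add: coord_proj[OF ii i(2)])
  also have "proj i (a * u) = proj i a * proj i (proj i u)"
    using proj_self[OF ii proj_B[OF ii]] by (simp add: proj_mult[OF ii])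
  also have "\<dots> = proj i (a * proj i u)" by (simp add: proj_mult[OF ii])
  also have "Q.coord b (proj i (a * proj i u)) = Q.coord b (a * proj i u)"
    by (rule coord_proj[OF ii i(2)])
  also have "\<dots> = (\<Sum>l\<in>bas i. Q.coord b (a * l) * Q.coord l u)"
    unfolding proj_def by (simp add: sum_distrib_left Q.coord_sum Q.scale_mult_right Q.coord_scale mult.commute)
  also have "\<dots> = (\<Sum>l\<in>Dset js. Q.coord b (a * l) * Q.coord l u)"
  proof (rule sum.mono_neutral_left[OF finite_Dset[OF js]])
    show "bas i \<subseteq> Dset js" using i(1) by (auto simp: Dset_def)
    show "\<forall>l\<in>Dset js - bas i. Q.coord b (a * l) * Q.coord l u = 0"
    proof
      fix l assume l: "l \<in> Dset js - bas i"
      then obtain j where j: "j \<in> set js" "l \<in> bas j" by (auto simp: Dset_def)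
      have jj: "j \<in> idx" and ij: "i \<noteq> j" using j js l by auto
      have "a * l \<in> B j" using B_ideal[OF jj bas_B[OF jj j(2)]] by blast
      then show "Q.coord b (a * l) * Q.coord l u = 0"
        using coord_other[OF ii jj ij i(2)] by simp
    qed
  qed
  finally show ?thesis .
qed

lemma Dt_derivation:
  assumes js: "set js \<subseteq> idx"
  shows "(\<Sum>k\<in>Dset js. Dt (Dset js) (x(Inr k := a * x (Inr k)))) = tD (Dset js) (\<pi> a) * Dt (Dset js) x"
proof -
  let ?D = "Dset js"
  have "Dt ?D (x(Inr k := a * x (Inr k))) = ldet ?D (\<lambda>b k'. if k' = k
      then \<Sum>l\<in>?D. Q.coord b (\<pi> a * l) * Q.coord l (\<pi> (x (Inr k))) else Q.coord b (\<pi> (x (Inr k'))))"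
    if "k \<in> ?D" for k
    unfolding Dt_def ldet_def
  proof (intro sum.cong refl arg_cong2[of _ _ _ _ "(*)"] prod.cong)
    fix \<tau> b assume "b \<in> ?D"
    then show "Q.coord b (\<pi> ((x(Inr k := a * x (Inr k))) (Inr (\<tau> b)))) =
      (if \<tau> b = k then \<Sum>l\<in>?D. Q.coord b (\<pi> a * l) * Q.coord l (\<pi> (x (Inr k)))
       else Q.coord b (\<pi> (x (Inr (\<tau> b)))))"
      using coord_mult[OF js, of b "\<pi> a" "\<pi> (x (Inr k))"] by (simp add: pi_mult)
  qed
  then have "(\<Sum>k\<in>?D. Dt ?D (x(Inr k := a * x (Inr k)))) = (\<Sum>k\<in>?D. ldet ?D (\<lambda>b k'. if k' = k
      then \<Sum>l\<in>?D. Q.coord b (\<pi> a * l) * Q.coord l (\<pi> (x (Inr k))) else Q.coord b (\<pi> (x (Inr k')))))"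
    by (rule sum.cong[OF refl])
  also have "\<dots> = tD ?D (\<pi> a) * Dt ?D x"
    unfolding tD_def Dt_def by (rule ldet_derivation[OF finite_Dset[OF js]])
  finally show ?thesis .
qed

text \<open>For each permutation \<open>\<tau>\<close> the slots are filled with products of
  coordinates, where coordinate \<open>b\<close> is applied to the variable
  \<open>Inr (\<tau> b)\<close>. The signed sum over \<open>\<tau>\<close> is the
  determinant.\<close>

lemma ex_determinant_function:
  assumes js: "set js \<subseteq> idx" "distinct js" "js \<noteq> []" and nz: "Nch js 0 \<noteq> {0}"
  shows "\<exists>C F a0. a0 \<noteq> 0 \<and> A.gfun (Inr ` Dset js) C F \<and> (\<forall>x. F x = sA (Dt (Dset js) x) a0)"
proof -
  let ?D = "Dset js"
  obtain s f where f: "SF js s f" "f lift_unit \<noteq> 0"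
    "\<And>v c. (\<forall>i\<in>set js. proj i (\<pi> (v i)) = sQ (c i) (unit i)) \<Longrightarrow>
       f v = sA (\<Prod>i\<leftarrow>js. c i) (f lift_unit)"
    using ex_slot_function[OF js(1) nz] by blast
  have "\<exists>bs. set bs = bas i \<and> distinct bs" if "i \<in> idx" for i
    using finite_distinct_list[OF finite_bas[OF that]] .
  then obtain bl where bl: "\<And>i. i \<in> idx \<Longrightarrow> set (bl i) = bas i" "\<And>i. i \<in> idx \<Longrightarrow> distinct (bl i)"
    by metis
  have bl_ne: "bl i \<noteq> []" if "i \<in> idx" for i
  proof
    assume "bl i = []"
    then have "B i = {0}" using span_bas[OF that] bl(1)[OF that] by simp
    with B_nontrivial[OF that] show False by simp
  qed
  define good where "good = (\<lambda>\<tau> i g. A.gfun ((\<lambda>b. Inr (\<tau> b) :: nat + 'q) ` set (bl i)) (2 * length (bl i)) g \<and>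
    (\<forall>x. proj i (\<pi> (g x)) = sQ (\<Prod>b\<in>set (bl i). Q.coord b (\<pi> (x (Inr (\<tau> b))))) (unit i)))"
  have "\<exists>g. good \<tau> i g" if "\<tau> permutes ?D" "i \<in> set js" for \<tau> i
    unfolding good_def
  proof (rule ex_coord_product)
    show i: "i \<in> idx" using that js by blast
    show "bl i \<noteq> []" "distinct (bl i)" "set (bl i) \<subseteq> bas i" using bl bl_ne i by auto
    show "inj_on (\<lambda>b. Inr (\<tau> b) :: nat + 'q) (set (bl i))"
      using permutes_inj[OF that(1)] by (auto intro!: inj_onI dest: injD)
  qed
  then have "\<forall>\<tau>. \<forall>i. \<exists>g. \<tau> permutes ?D \<and> i \<in> set js \<longrightarrow> good \<tau> i g" by blast
  then obtain g where g: "\<And>\<tau> i. \<tau> permutes ?D \<Longrightarrow> i \<in> set js \<Longrightarrow> good \<tau> i (g \<tau> i)"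
    by metis
  define C where "C = (\<Sum>i\<leftarrow>js. 2 * length (bl i)) + 3 * length js + 1"
  have gf: "A.gfun (Inr ` ?D) C (\<lambda>x. f (\<lambda>i. g \<tau> i x))" if \<tau>: "\<tau> permutes ?D" for \<tau>
  proof -
    have "A.gfun (\<Union>i\<in>set js. (\<lambda>b. Inr (\<tau> b) :: nat + 'q) ` set (bl i)) C (\<lambda>x. f (\<lambda>i. g \<tau> i x))"
      unfolding C_def
    proof (rule SF_gfun[OF f(1) js(2)])
      show "A.gfun ((\<lambda>b. Inr (\<tau> b) :: nat + 'q) ` set (bl i)) (2 * length (bl i)) (g \<tau> i)" if "i \<in> set js" for i
        using g[OF \<tau> that] by (simp add: good_def)
      fix i j assume ij: "i \<in> set js" "j \<in> set js" "i \<noteq> j"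
      then have "set (bl i) \<inter> set (bl j) = {}" using bl(1) bas_disjoint js(1) by (metis subsetD)
      then show "(\<lambda>b. Inr (\<tau> b) :: nat + 'q) ` set (bl i) \<inter> (\<lambda>b. Inr (\<tau> b)) ` set (bl j) = {}"
        using permutes_inj[OF \<tau>] by (auto dest: injD)
    qed
    moreover have "(\<Union>i\<in>set js. (\<lambda>b. Inr (\<tau> b) :: nat + 'q) ` set (bl i)) = Inr ` \<tau> ` ?D"
    proof -
      have "(\<Union>i\<in>set js. (\<lambda>b. Inr (\<tau> b) :: nat + 'q) ` set (bl i)) = (\<Union>i\<in>set js. (\<lambda>b. Inr (\<tau> b)) ` bas i)"
        using bl(1) js(1) by (intro SUP_cong refl) auto
      then show ?thesis by (simp add: Dset_def image_UN image_image)
    qed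
    ultimately show ?thesis by (simp add: permutes_image[OF \<tau>])
  qed
  have val: "f (\<lambda>i. g \<tau> i x) = sA (\<Prod>b\<in>?D. Q.coord b (\<pi> (x (Inr (\<tau> b))))) (f lift_unit)"
    if \<tau>: "\<tau> permutes ?D" for \<tau> x
  proof -
    have "f (\<lambda>i. g \<tau> i x) = sA (\<Prod>i\<leftarrow>js. \<Prod>b\<in>set (bl i). Q.coord b (\<pi> (x (Inr (\<tau> b))))) (f lift_unit)"
      by (rule f(3)) (use g[OF \<tau>] in \<open>simp add: good_def\<close>)
    also have "(\<Prod>i\<leftarrow>js. \<Prod>b\<in>set (bl i). Q.coord b (\<pi> (x (Inr (\<tau> b))))) =
        (\<Prod>i\<in>set js. \<Prod>b\<in>bas i. Q.coord b (\<pi> (x (Inr (\<tau> b)))))"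
      unfolding prod.distinct_set_conv_list[OF js(2), symmetric]
      by (intro prod.cong refl) (use bl(1) js(1) in auto)
    also have "\<dots> = (\<Prod>b\<in>?D. Q.coord b (\<pi> (x (Inr (\<tau> b)))))"
    proof -
      have "\<forall>i\<in>set js. finite (bas i)" using js(1) finite_bas by blast
      moreover have "\<forall>i\<in>set js. \<forall>j\<in>set js. i \<noteq> j \<longrightarrow> bas i \<inter> bas j = {}"
        using js(1) bas_disjoint by blast
      ultimately show ?thesis unfolding Dset_def by (intro prod.UNION_disjoint[symmetric]) simp_all
    qed
    finally show ?thesis .
  qed
  define F where "F = (\<lambda>x. \<Sum>\<tau> | \<tau> permutes ?D. sA (of_int (sign \<tau>)) (f (\<lambda>i. g \<tau> i x)))"
  have "{\<tau>. \<tau> permutes ?D} \<noteq> {}" using permutes_id by blast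
  then have "A.gfun (Inr ` ?D) C F"
    unfolding F_def
    using finite_permutations[OF finite_Dset[OF js(1)]]
    by (intro A.gfun_sum A.gfun_scale gf) auto
  moreover have "F x = sA (Dt ?D x) (f lift_unit)" for x
    unfolding F_def Dt_def ldet_def A.scale_sum_left
    by (intro sum.cong refl) (simp add: val)
  ultimately show ?thesis using f(2) by blast
qed

text \<open>\<open>H x\<close> is multiplied into one alternating variable at a time and the results
  are added. The factor \<open>h\<close> passes through because it does not depend on these
  variables. The only constants added are those of \<open>H\<close>.\<close>

lemma gfun_derivation:
  assumes js: "set js \<subseteq> idx" "Dset js \<noteq> {}"
    and F: "A.gfun X C F" "Inr ` Dset js \<subseteq> X" "\<And>x. F x = sA (Dt (Dset js) x * h x) a0"
    and h: "\<And>x k z. h (x(Inr k := z)) = h x"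
    and H: "A.gfun Y C' H" "Y \<inter> X = {}" "\<And>x. \<pi> (H x) = u x"
  shows "\<exists>F'. A.gfun (X \<union> Y) (C + C') F' \<and> (\<forall>x. F' x = sA (Dt (Dset js) x * (tD (Dset js) (u x) * h x)) a0)"
proof -
  let ?D = "Dset js"
  define F' where "F' = (\<lambda>x. \<Sum>k\<in>?D. F (x(Inr k := H x * x (Inr k))))"
  have "A.gfun (X \<union> Y) (C + C') (\<lambda>x. F (x(Inr k := H x * x (Inr k))))" if "k \<in> ?D" for k
  proof -
    have k: "Inr k \<in> X" using that F(2) by blast
    have "A.gfun (Y \<union> {Inr k}) (C' + 0) (\<lambda>x. H x * x (Inr k))"
      by (intro A.gfun_mult H A.gfun_var) (use H(2) k in auto)
    from A.gfun_subst[OF F(1) k this]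
    have "A.gfun (X - {Inr k} \<union> (Y \<union> {Inr k})) (C + (C' + 0)) (\<lambda>x. F (x(Inr k := H x * x (Inr k))))"
      using H(2) by blast
    moreover have "X - {Inr k} \<union> (Y \<union> {Inr k}) = X \<union> Y" using k by auto
    ultimately show ?thesis by simp
  qed
  then have "A.gfun (X \<union> Y) (C + C') F'"
    unfolding F'_def using js by (intro A.gfun_sum finite_Dset) auto
  moreover have "F' x = sA (Dt ?D x * (tD ?D (u x) * h x)) a0" for x
  proof -
    have "F' x = sA ((\<Sum>k\<in>?D. Dt ?D (x(Inr k := H x * x (Inr k)))) * h x) a0"
      by (simp add: F'_def F(3) h sum_distrib_right A.scale_sum_left)
    then show ?thesis by (simp add: Dt_derivation[OF js(1)] H(3) mult_ac)
  qed
  ultimately show ?thesis by blast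
qed

text \<open>Each pair is attached by a derivation with \<open>H\<close> the product of two fresh
  variables, which contains no constants. So \<open>C\<close> stays fixed however long
  \<open>ps\<close> is.\<close>

lemma ex_trace_function:
  assumes js: "set js \<subseteq> idx" "Dset js \<noteq> {}"
    and F0: "A.gfun (Inr ` Dset js) C F0" "\<And>x. F0 x = sA (Dt (Dset js) x) a0"
    and "distinct (map fst ps @ map snd ps)"
  shows "\<exists>F. A.gfun (Inr ` Dset js \<union> Inl ` (fst ` set ps \<union> snd ` set ps)) C F \<and>
    (\<forall>x. F x = sA (Dt (Dset js) x * (\<Prod>p\<leftarrow>ps. tD (Dset js) (\<pi> (x (Inl (fst p))) * \<pi> (x (Inl (snd p)))))) a0)"
  using assms(5)
proof (induction ps)
  case Nil
  show ?case by (intro exI[of _ F0] conjI allI) (use F0(1) in simp, use F0(2) in simp)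
next
  case (Cons p ps)
  let ?X = "Inr ` Dset js \<union> Inl ` (fst ` set ps \<union> snd ` set ps)"
  let ?h = "\<lambda>x :: nat + 'q \<Rightarrow> 'a. \<Prod>p\<leftarrow>ps. tD (Dset js) (\<pi> (x (Inl (fst p))) * \<pi> (x (Inl (snd p))))"
  obtain F where F: "A.gfun ?X C F" "\<And>x. F x = sA (Dt (Dset js) x * ?h x) a0"
    using Cons by auto
  let ?Y = "{Inl (fst p)} \<union> {Inl (snd p)} :: (nat + 'q) set"
  have "fst p \<noteq> snd p" "?Y \<inter> ?X = {}" using Cons.prems by auto
  then have H: "A.gfun ?Y (0 + 0) (\<lambda>x. x (Inl (fst p)) * x (Inl (snd p)))"
    by (intro A.gfun_mult A.gfun_var) auto
  have "\<exists>F'. A.gfun (?X \<union> ?Y) (C + (0 + 0)) F' \<and> (\<forall>x. F' x = sA (Dt (Dset js) x *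
      (tD (Dset js) (\<pi> (x (Inl (fst p))) * \<pi> (x (Inl (snd p)))) * ?h x)) a0)"
    by (rule gfun_derivation[OF js F(1) _ F(2) _ H \<open>?Y \<inter> ?X = {}\<close>]) (auto simp: pi_mult)
  then obtain F' where F': "A.gfun (?X \<union> ?Y) (C + (0 + 0)) F'"
    "\<And>x. F' x = sA (Dt (Dset js) x * (tD (Dset js) (\<pi> (x (Inl (fst p))) * \<pi> (x (Inl (snd p)))) * ?h x)) a0"
    by blast
  have "?X \<union> ?Y = Inr ` Dset js \<union> Inl ` (fst ` set (p # ps) \<union> snd ` set (p # ps))" by auto
  with F'(1) have "A.gfun (Inr ` Dset js \<union> Inl ` (fst ` set (p # ps) \<union> snd ` set (p # ps))) C F'" by simp
  then show ?case by (intro exI[of _ F'] conjI allI) (assumption, simp add: F'(2))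
qed

lemma tD_unit:
  assumes "set js \<subseteq> idx" shows "tD (Dset js) e = of_nat (card (Dset js))"
proof -
  have "tD (Dset js) e = (\<Sum>b\<in>Dset js. 1)"
    unfolding tD_def using Dset_BQ[OF assms] by (intro sum.cong refl) (auto simp: Q.coord_Basis)
  then show ?thesis by simp
qed

text \<open>The alternating variables are finally replaced by the lifted basis, where the
  determinant is 1; this costs \<open>card (Dset js)\<close> constants, which are included in the
  new \<open>C\<close>. The switch \<open>r\<close> allows one more constant, so that total degrees
  \<open>2 * m + C + r\<close> of both parities are reached.\<close>

lemma ex_perm_function:
  assumes js: "set js \<subseteq> idx" "distinct js" "js \<noteq> []" and nz: "Nch js 0 \<noteq> {0}" and D: "Dset js \<noteq> {}"
  shows "\<exists>C a0. a0 \<noteq> 0 \<and> (\<forall>(m :: nat) r \<sigma>. r \<le> (1::nat) \<longrightarrow> \<sigma> permutes {1..m} \<longrightarrow>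
    (\<exists>F. A.gfun {1..m + m} (C + r) F \<and>
      (\<forall>x. F x = sA (of_nat (card (Dset js)) ^ r * (\<Prod>i\<in>{1..m}. tD (Dset js) (\<pi> (x i) * \<pi> (x (m + \<sigma> i))))) a0)))"
proof -
  let ?D = "Dset js"
  obtain C F0 a0 where F0: "a0 \<noteq> 0" "A.gfun (Inr ` ?D) C F0" "\<And>x. F0 x = sA (Dt ?D x) a0"
    using ex_determinant_function[OF js nz] by blast
  have "\<exists>F. A.gfun {1..m + m} (C + card ?D + r) F \<and>
      (\<forall>x. F x = sA (of_nat (card ?D) ^ r * (\<Prod>i\<in>{1..m}. tD ?D (\<pi> (x i) * \<pi> (x (m + \<sigma> i))))) a0)"
    if r: "r \<le> (1::nat)" and \<sigma>: "\<sigma> permutes {1..m}" for m r :: nat and \<sigma>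
  proof -
    define ps where "ps = map (\<lambda>i. (i, m + \<sigma> i)) [1..<Suc m]"
    have s1: "set [1..<Suc m] = {1..m}" by auto
    have fst_ps: "map fst ps = [1..<Suc m]" by (simp add: ps_def comp_def del: upt_Suc)
    have snd_ps: "map snd ps = map (\<lambda>i. m + \<sigma> i) [1..<Suc m]" by (simp add: ps_def comp_def del: upt_Suc)
    have \<sigma>im: "\<sigma> ` {1..m} = {1..m}" by (rule permutes_image[OF \<sigma>])
    have "(\<lambda>i. m + \<sigma> i) ` {1..m} = (\<lambda>i. m + i) ` \<sigma> ` {1..m}" by (simp add: image_image)
    also have "\<dots> = {m + 1..m + m}" unfolding \<sigma>im by (simp add: image_add_atLeastAtMost)
    finally have im: "(\<lambda>i. m + \<sigma> i) ` {1..m} = {m + 1..m + m}" .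
    have "inj_on (\<lambda>i. m + \<sigma> i) {1..m}" using permutes_inj_on[OF \<sigma>] by (auto simp: inj_on_def)
    then have dist: "distinct (map fst ps @ map snd ps)"
      unfolding fst_ps snd_ps distinct_append distinct_map set_map s1 im by (auto simp del: upt_Suc)
    have vars: "fst ` set ps \<union> snd ` set ps = {1..m + m}"
    proof -
      have "fst ` set ps = {1..m}" using arg_cong[OF fst_ps, of set] unfolding s1 by simp
      moreover have "snd ` set ps = {m + 1..m + m}"
        using arg_cong[OF snd_ps, of set] unfolding set_map s1 im by simp
      ultimately show ?thesis by auto
    qed
    let ?h = "\<lambda>x :: nat + 'q \<Rightarrow> 'a. \<Prod>p\<leftarrow>ps. tD ?D (\<pi> (x (Inl (fst p))) * \<pi> (x (Inl (snd p))))"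
    let ?X = "Inr ` ?D \<union> Inl ` {1..m + m} :: (nat + 'q) set"
    obtain F1 where F1: "A.gfun ?X C F1" "\<And>x. F1 x = sA (Dt ?D x * ?h x) a0"
      using ex_trace_function[OF js(1) D F0(2,3) dist] unfolding vars by blast
    have "\<exists>F2. A.gfun ?X (C + r) F2 \<and> (\<forall>x. F2 x = sA (Dt ?D x * (of_nat (card ?D) ^ r * ?h x)) a0)"
    proof (cases "r = 0")
      case True then show ?thesis using F1 by (intro exI[of _ F1]) simp
    next
      case False
      then have r1: "r = 1" using r by simp
      \<comment> \<open>A derivation by the lifted unit raises the degree by one; its trace is the
        dimension, which is nonzero in characteristic 0.\<close>
      have "\<exists>F'. A.gfun (?X \<union> {}) (C + 1) F' \<and> (\<forall>x. F' x = sA (Dt ?D x * (tD ?D e * ?h x)) a0)"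
        by (rule gfun_derivation[OF js(1) D F1(1) _ F1(2) _ A.gfun_const[OF BA_nonempty, of "\<kappa> e"]])
           (auto simp: pi_kappa)
      then show ?thesis unfolding r1 by (simp add: tD_unit[OF js(1)])
    qed
    then obtain F2 where F2: "A.gfun ?X (C + r) F2"
      "\<And>x. F2 x = sA (Dt ?D x * (of_nat (card ?D) ^ r * ?h x)) a0" by blast
    define K where "K = (Inr ` ?D :: (nat + 'q) set)"
    define z where "z = (\<lambda>k :: nat + 'q. case k of Inr b \<Rightarrow> \<kappa> b | Inl _ \<Rightarrow> 0)"
    define F3 where "F3 = (\<lambda>x. F2 (\<lambda>i. if i \<in> K then z i else x i))"
    have finK: "finite K" "card K = card ?D"
      using finite_Dset[OF js(1)] by (auto simp: K_def card_image)
    have "A.gfun (?X - K) (C + r + card K) F3"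
      unfolding F3_def by (rule A.gfun_subst_constants[OF F2(1) finK(1) _ BA_nonempty]) (auto simp: K_def)
    moreover have "?X - K = Inl ` {1..m + m}" by (auto simp: K_def)
    ultimately have F3: "A.gfun (Inl ` {1..m + m}) (C + card ?D + r) F3"
      by (simp add: finK add_ac)
    have F3v: "F3 x = sA (of_nat (card ?D) ^ r * ?h x) a0" for x
    proof -
      have "Dt ?D (\<lambda>i. if i \<in> K then z i else x i) = 1"
        unfolding Dt_def
      proof (rule ldet_identity[OF finite_Dset[OF js(1)]])
        fix b k assume "b \<in> ?D" "k \<in> ?D"
        then have "k \<in> BQ" "Inr k \<in> K" using Dset_BQ[OF js(1)] by (auto simp: K_def)
        then show "Q.coord b (\<pi> (if Inr k \<in> K then z (Inr k) else x (Inr k))) = (if b = k then 1 else 0)"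
          by (simp add: z_def pi_kappa Q.coord_Basis)
      qed
      moreover have "?h (\<lambda>i. if i \<in> K then z i else x i) = ?h x"
        by (simp add: K_def image_iff)
      ultimately show ?thesis by (simp only: F3_def F2(2) mult_1)
    qed
    define \<rho> where "\<rho> = (\<lambda>k :: nat + 'q. case k of Inl i \<Rightarrow> i | Inr _ \<Rightarrow> 0)"
    define F where "F = (\<lambda>x. F3 (\<lambda>i. x (\<rho> i)))"
    have "inj_on \<rho> (Inl ` {1..m + m})" by (auto simp: inj_on_def \<rho>_def)
    from A.gfun_rename[OF F3 this] have "A.gfun {1..m + m} (C + card ?D + r) F"
      unfolding F_def by (simp add: image_image \<rho>_def)
    moreover have "F x = sA (of_nat (card ?D) ^ r * (\<Prod>i\<in>{1..m}. tD ?D (\<pi> (x i) * \<pi> (x (m + \<sigma> i))))) a0" for x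
    proof -
      have "?h (\<lambda>i. x (\<rho> i)) = (\<Prod>i\<leftarrow>[1..<Suc m]. tD ?D (\<pi> (x i) * \<pi> (x (m + \<sigma> i))))"
        unfolding ps_def map_map by (simp add: comp_def \<rho>_def del: upt_Suc)
      also have "\<dots> = (\<Prod>i\<in>{1..m}. tD ?D (\<pi> (x i) * \<pi> (x (m + \<sigma> i))))"
        by (subst prod.distinct_set_conv_list[symmetric]) (simp_all only: distinct_upt s1)
      finally show ?thesis by (simp only: F_def F3v)
    qed
    ultimately show ?thesis by blast
  qed
  with F0(1) show ?thesis by (intro exI[of _ "C + card ?D"] exI[of _ a0]) simp
qed

text \<open>The element \<open>b * v\<close> lies in one of the chosen ideals and annihilates all
  other \<open>B j\<close>, so its trace over the chosen part is its trace over the whole of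
  \<open>A/J\<close>.\<close>

lemma tD_dual:
  assumes js: "set js \<subseteq> idx" and b: "b \<in> Dset js"
  shows "tD (Dset js) (b * v) = Q.tform b v"
proof -
  obtain i where i: "i \<in> set js" "b \<in> bas i" using b by (auto simp: Dset_def)
  have ii: "i \<in> idx" using i js by blast
  have "tD (Dset js) (b * v) = (\<Sum>c\<in>BQ. Q.coord c (b * v * c))"
    unfolding tD_def
  proof (rule sum.mono_neutral_left[OF Q.finite_Basis Dset_BQ[OF js]])
    show "\<forall>c\<in>BQ - Dset js. Q.coord c (b * v * c) = 0"
    proof
      fix c assume c: "c \<in> BQ - Dset js"
      then obtain j where j: "j \<in> idx" "c \<in> bas j" by (auto simp: BQ_eq)
      have "i \<noteq> j" using c i j by (auto simp: Dset_def)
      moreover have "b * v \<in> B i" using B_ideal[OF ii bas_B[OF ii i(2)]] by blast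
      ultimately have "b * v * c = 0" using B_mult_zero[OF ii j(1)] bas_B[OF j] by blast
      then show "Q.coord c (b * v * c) = 0" by simp
    qed
  qed
  then show ?thesis by (simp add: Q.tform_def Q.trace_def mult.assoc)
qed

text \<open>At lifted basis elements and lifted dual basis elements the permutation functions become
  the incidence vectors, up to a fixed nonzero scalar and the vector \<open>a0\<close>. So
  independent incidence vectors give independent functions.\<close>

lemma codim_lower_bound_list:
  assumes js: "set js \<subseteq> idx" "distinct js" "js \<noteq> []" and nz: "Nch js 0 \<noteq> {0}"
  shows "\<exists>C. \<forall>m r. r \<le> 1 \<longrightarrow>
    card (Dset js) ^ (2 * m) \<le> card BA ^ (C + 1) * (m + 1) ^ (card (Dset js))\<^sup>2 * gr_codim sA G (2 * m + C + r)"
proof -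
  let ?D = "Dset js"
  let ?d = "card ?D"
  have Dne: "?D \<noteq> {}"
  proof -
    obtain i where i: "i \<in> set js" using js(3) by (cases js) auto
    then have ii: "i \<in> idx" using js by blast
    have "bas i \<noteq> {}" using span_bas[OF ii] B_nontrivial[OF ii] by auto
    then show ?thesis using i by (auto simp: Dset_def)
  qed
  then have d0: "0 < ?d" using finite_Dset[OF js(1)] by (simp add: card_gt_0_iff)
  obtain C a0 where a0: "a0 \<noteq> 0" and Fex: "\<And>(m :: nat) r \<sigma>. r \<le> (1::nat) \<Longrightarrow> \<sigma> permutes {1..m} \<Longrightarrow>
    \<exists>F. A.gfun {1..m + m} (C + r) F \<and>
      (\<forall>x. F x = sA (of_nat ?d ^ r * (\<Prod>i\<in>{1..m}. tD ?D (\<pi> (x i) * \<pi> (x (m + \<sigma> i))))) a0)"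
    using ex_perm_function[OF js nz Dne] by blast
  obtain dual where dual: "\<And>b c. b \<in> BQ \<Longrightarrow> c \<in> BQ \<Longrightarrow> Q.tform c (dual b) = (if c = b then 1 else 0)"
    using Q.ex_dual_basis by blast
  have "?d ^ (2 * m) \<le> card BA ^ (C + 1) * (m + 1) ^ ?d\<^sup>2 * gr_codim sA G (2 * m + C + r)"
    if r: "r \<le> 1" for m r :: nat
  proof -
    let ?P = "{\<sigma>. \<sigma> permutes {1..m}}"
    let ?X = "({1..m} \<rightarrow>\<^sub>E ?D) \<times> ({1..m} \<rightarrow>\<^sub>E ?D)"
    have "\<forall>\<sigma>\<in>?P. \<exists>F. A.gfun {1..m + m} (C + r) F \<and>
      (\<forall>x. F x = sA (of_nat ?d ^ r * (\<Prod>i\<in>{1..m}. tD ?D (\<pi> (x i) * \<pi> (x (m + \<sigma> i))))) a0)"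
      using Fex[OF r] by blast
    from bchoice[OF this] obtain F where F: "\<And>\<sigma>. \<sigma> \<in> ?P \<Longrightarrow> A.gfun {1..m + m} (C + r) (F \<sigma>)"
      "\<And>\<sigma> x. \<sigma> \<in> ?P \<Longrightarrow> F \<sigma> x = sA (of_nat ?d ^ r * (\<Prod>i\<in>{1..m}. tD ?D (\<pi> (x i) * \<pi> (x (m + \<sigma> i))))) a0"
      by blast
    obtain S where S: "S \<subseteq> ?P" "?d ^ (2 * m) \<le> card S * (m + 1) ^ ?d\<^sup>2"
      and indep: "\<And>a :: (nat \<Rightarrow> nat) \<Rightarrow> 'f. (\<forall>x\<in>?X. (\<Sum>\<sigma>\<in>S. a \<sigma> * of_int (perm_vec m \<sigma> x)) = 0) \<Longrightarrow> (\<forall>\<sigma>\<in>S. a \<sigma> = 0)"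
      using perm_vec_rank[OF finite_Dset[OF js(1)], of m] by blast
    have finS: "finite S" using S(1) by (rule finite_subset) (simp add: finite_permutations)
    have "card S \<le> card BA ^ (C + r) * gr_codim sA G ((m + m) + (C + r))"
    proof (rule A.codim_lower_bound[OF finS])
      show "A.gfun {1..m + m} (C + r) (F \<sigma>)" if "\<sigma> \<in> S" for \<sigma> using F(1) S(1) that by blast
      have "A.gfun {1..m + m} (C + r) (F id)" using F(1) permutes_id by blast
      from A.gfun_pos[OF this] show "1 \<le> m + m + (C + r)" by simp linarith
      fix a assume zero: "\<And>x. (\<Sum>\<sigma>\<in>S. sA (a \<sigma>) (F \<sigma> x)) = 0"
      show "\<forall>\<sigma>\<in>S. a \<sigma> = 0"
      proof (rule indep, rule ballI)
        fix cc assume "cc \<in> ?X"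
        then obtain c c' where cc: "cc = (c, c')" and c: "c \<in> {1..m} \<rightarrow>\<^sub>E ?D" "c' \<in> {1..m} \<rightarrow>\<^sub>E ?D" by blast
        define x where "x = (\<lambda>i. if i \<le> m then \<kappa> (c i) else \<kappa> (dual (c' (i - m))))"
        have Fx: "F \<sigma> x = sA (of_nat ?d ^ r * of_int (perm_vec m \<sigma> cc)) a0" if \<sigma>: "\<sigma> \<in> S" for \<sigma>
        proof -
          have \<sigma>P: "\<sigma> permutes {1..m}" using \<sigma> S(1) by blast
          have t: "tD ?D (\<pi> (x i) * \<pi> (x (m + \<sigma> i))) = (if c i = c' (\<sigma> i) then 1 else 0)" if i: "i \<in> {1..m}" for i
          proof -
            have \<sigma>i: "\<sigma> i \<in> {1..m}" using i permutes_in_image[OF \<sigma>P] by blast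
            have ci: "c i \<in> ?D" "c' (\<sigma> i) \<in> ?D" using c i \<sigma>i by blast+
            then have "c i \<in> BQ" "c' (\<sigma> i) \<in> BQ" using Dset_BQ[OF js(1)] by blast+
            then have "Q.tform (c i) (dual (c' (\<sigma> i))) = (if c i = c' (\<sigma> i) then 1 else 0)" by (simp add: dual)
            moreover have "\<pi> (x i) = c i" "\<pi> (x (m + \<sigma> i)) = dual (c' (\<sigma> i))"
              using i \<sigma>i by (auto simp: x_def pi_kappa)
            ultimately show ?thesis by (simp add: tD_dual[OF js(1) ci(1)])
          qed
          have "(\<Prod>i\<in>{1..m}. tD ?D (\<pi> (x i) * \<pi> (x (m + \<sigma> i)))) = (\<Prod>i\<in>{1..m}. if c i = c' (\<sigma> i) then 1 else 0)"
            by (rule prod.cong[OF refl]) (rule t)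
          also have "\<dots> = of_int (perm_vec m \<sigma> cc)"
          proof (cases "\<forall>i\<in>{1..m}. c i = c' (\<sigma> i)")
            case True
            then show ?thesis by (simp add: perm_vec_def cc)
          next
            case False
            then obtain i where "i \<in> {1..m}" "c i \<noteq> c' (\<sigma> i)" by blast
            then have "(\<Prod>i\<in>{1..m}. if c i = c' (\<sigma> i) then 1 else 0 :: 'f) = 0"
              by (intro prod_zero) auto
            then show ?thesis using False by (simp add: perm_vec_def cc)
          qed
          finally show ?thesis using F(2)[of \<sigma> x] \<sigma>P by simp
        qed
        have "0 = (\<Sum>\<sigma>\<in>S. sA (a \<sigma>) (F \<sigma> x))" by (simp add: zero)
        also have "\<dots> = (\<Sum>\<sigma>\<in>S. sA (of_nat ?d ^ r * (a \<sigma> * of_int (perm_vec m \<sigma> cc))) a0)"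
          by (intro sum.cong refl) (simp add: Fx mult_ac)
        also have "\<dots> = sA (of_nat ?d ^ r * (\<Sum>\<sigma>\<in>S. a \<sigma> * of_int (perm_vec m \<sigma> cc))) a0"
          by (simp add: sum_distrib_left A.scale_sum_left)
        finally show "(\<Sum>\<sigma>\<in>S. a \<sigma> * of_int (perm_vec m \<sigma> cc)) = 0"
          using a0 d0 by simp
      qed
    qed
    also have "card BA ^ (C + r) \<le> card BA ^ (C + 1)"
      using r BA_nonempty A.finite_Basis by (intro power_increasing) (simp_all add: Suc_le_eq card_gt_0_iff)
    finally have "card S \<le> card BA ^ (C + 1) * gr_codim sA G (2 * m + C + r)"
      by (simp add: mult_2 add.assoc)
    then have "card S * (m + 1) ^ ?d\<^sup>2 \<le> card BA ^ (C + 1) * gr_codim sA G (2 * m + C + r) * (m + 1) ^ ?d\<^sup>2"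
      by (rule mult_le_mono1)
    with S(2) have "?d ^ (2 * m) \<le> card BA ^ (C + 1) * gr_codim sA G (2 * m + C + r) * (m + 1) ^ ?d\<^sup>2"
      by (rule order_trans)
    then show ?thesis by (simp only: mult_ac)
  qed
  then show ?thesis by (intro exI[of _ C] allI impI) blast
qed

end

section \<open>The upper bound\<close>

context codim_setup
begin

lemma dual_span_eq_W: "dual_span sA G (\<kappa> ` B i) = W i"
proof
  have "dual_act sA G h (\<kappa> b) \<in> W i" if "b \<in> B i" for h b
    unfolding dual_act_def
    by (intro A.subspace_sum[OF subspace_W] A.subspace_scale[OF subspace_W] W_hc_kappa that)
  then show "dual_span sA G (\<kappa> ` B i) \<subseteq> W i"
    unfolding dual_span_def by (intro A.span_minimal subspace_W) auto
  show "W i \<subseteq> dual_span sA G (\<kappa> ` B i)"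
  proof (rule W_subset)
    show "A.subspace (dual_span sA G (\<kappa> ` B i))" unfolding dual_span_def by (rule A.subspace_span)
    fix t b assume b: "b \<in> B i"
    have "dual_act sA G (\<lambda>s. if s = t then 1 else 0) (\<kappa> b) =
        (\<Sum>s | A.hc s (\<kappa> b) \<noteq> 0. if s = t then A.hc t (\<kappa> b) else 0)"
      unfolding dual_act_def by (intro sum.cong refl) simp
    also have "\<dots> = A.hc t (\<kappa> b)" using A.finite_hc[of "\<kappa> b"] by simp
    finally have "A.hc t (\<kappa> b) = dual_act sA G (\<lambda>s. if s = t then 1 else 0) (\<kappa> b)" by simp
    then show "A.hc t (\<kappa> b) \<in> dual_span sA G (\<kappa> ` B i)"
      unfolding dual_span_def using b by (intro A.span_base) blast
  qed
qed

abbreviation "chain js \<equiv> chain_prod sA (map W js)"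

lemma times_plusI: "w \<in> V \<Longrightarrow> w * a + sA c w \<in> times_plus sA V"
  unfolding times_plus_def by (rule A.span_base) blast

lemma times_plus_subset:
  assumes "A.subspace S" "\<And>w a c. w \<in> V \<Longrightarrow> w * a + sA c w \<in> S" shows "times_plus sA V \<subseteq> S"
  unfolding times_plus_def by (rule A.span_minimal[OF _ assms(1)]) (use assms(2) in blast)

lemma times_plus_right: assumes "v \<in> times_plus sA V" shows "v * a \<in> times_plus sA V"
proof -
  have "times_plus sA V \<subseteq> {v. v * a \<in> times_plus sA V}"
  proof (rule times_plus_subset)
    show "A.subspace {v. v * a \<in> times_plus sA V}"
      unfolding times_plus_def by (intro A.subspace_mult_vimage A.subspace_span)
    fix w b c assume "w \<in> V"
    then have "w * (b * a + sA c a) + sA 0 w \<in> times_plus sA V" by (rule times_plusI)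
    then show "w * b + sA c w \<in> {v. v * a \<in> times_plus sA V}"
      by (simp add: distrib_left distrib_right mult.assoc A.scale_mult_left A.scale_mult_right)
  qed
  with assms show ?thesis by blast
qed

text \<open>In \<open>Nch\<close> every factor from \<open>W i\<close> has factors from
  \<open>A\<close> on both sides, while a chain begins and ends in such factors and allows 1 between
  them. Splitting elements of \<open>W i\<close> into products supplies what is missing.\<close>

lemma chain_subset_Nch: "js \<noteq> [] \<Longrightarrow> set js \<subseteq> idx \<Longrightarrow> chain js \<subseteq> Nch js 0"
proof (induction js rule: induct_list012)
  case (2 i)
  then have i: "i \<in> idx" by simp
  have *: "x * w \<in> Nch [i] 0" if x: "x \<in> W i" and w: "w \<in> W i" for x w
  proof -
    have "A.span {y * z | y z. y \<in> W i \<and> z \<in> W i} \<subseteq> {w. x * w \<in> Nch [i] 0}"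
    proof (rule A.span_minimal)
      show "A.subspace {w. x * w \<in> Nch [i] 0}" by (intro A.subspace_mult_vimage subspace_Nch)
      have "x * (y * z) \<in> Nch [i] 0" if "y \<in> W i" "z \<in> W i" for y z
        using NchI[of x 0 y i z "[]" 0] that by (simp add: mult.assoc del: Nch.simps(2))
      then show "{y * z | y z. y \<in> W i \<and> z \<in> W i} \<subseteq> {w. x * w \<in> Nch [i] 0}" by blast
    qed
    then show ?thesis using W_split[OF i] w by blast
  qed
  have "A.span {x * y | x y. x \<in> W i \<and> y \<in> W i} \<subseteq> Nch [i] 0"
    by (rule A.span_minimal[OF _ subspace_Nch]) (use * in blast)
  then show ?case using W_split[OF i] by simp
next
  case (3 i j js)
  then have i: "i \<in> idx" by simp
  have IH: "chain (j # js) \<subseteq> Nch (j # js) 0" using 3 by simp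
  have wn: "w * n \<in> Nch (i # j # js) 0" if w: "w \<in> W i" and n: "n \<in> Nch (j # js) 0" for w n
  proof -
    have "A.span {y * z | y z. y \<in> W i \<and> z \<in> W i} \<subseteq> {w. w * n \<in> Nch (i # j # js) 0}"
    proof (rule A.span_minimal)
      show "A.subspace {w. w * n \<in> Nch (i # j # js) 0}" by (intro A.subspace_mult_vimage subspace_Nch)
      have "y * z * n \<in> Nch (i # j # js) 0" if "y \<in> W i" "z \<in> W i" for y z
        using NchI[of y 0 z i n "j # js" 0] that n by (simp del: Nch.simps(2))
      then show "{y * z | y z. y \<in> W i \<and> z \<in> W i} \<subseteq> {w. w * n \<in> Nch (i # j # js) 0}" by blast
    qed
    then show ?thesis using W_split[OF i] w by blast
  qed
  have "space_prod sA (times_plus sA (W i)) (chain (j # js)) \<subseteq> Nch (i # j # js) 0"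
  proof (rule A.space_prod_subset[OF subspace_Nch])
    fix v n assume v: "v \<in> times_plus sA (W i)" and "n \<in> chain (j # js)"
    then have n: "n \<in> Nch (j # js) 0" using IH by blast
    have "times_plus sA (W i) \<subseteq> {v. v * n \<in> Nch (i # j # js) 0}"
    proof (rule times_plus_subset)
      show "A.subspace {v. v * n \<in> Nch (i # j # js) 0}" by (intro A.subspace_mult_vimage subspace_Nch)
      fix w a c assume w: "w \<in> W i"
      have "w * (a * n) + sA c (w * n) \<in> Nch (i # j # js) 0"
        by (intro A.subspace_add[OF subspace_Nch] A.subspace_scale[OF subspace_Nch] wn w n Nch_left)
      then show "w * a + sA c w \<in> {v. v * n \<in> Nch (i # j # js) 0}"
        by (simp add: distrib_right mult.assoc A.scale_mult_left del: Nch.simps)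
    qed
    with v show "v * n \<in> Nch (i # j # js) 0" by blast
  qed
  then show ?case by simp
qed simp

lemma subspace_chain: "A.subspace (chain js)"
  by (induction js rule: induct_list012) (simp_all add: subspace_W A.subspace_space_prod)

section \<open>Ideals generated by chains and products of labelled factors\<close>

inductive_set idl :: "'a set \<Rightarrow> 'a set" for C where
  idl_base: "c \<in> C \<Longrightarrow> c \<in> idl C"
| idl_add: "x \<in> idl C \<Longrightarrow> y \<in> idl C \<Longrightarrow> x + y \<in> idl C"
| idl_scale: "x \<in> idl C \<Longrightarrow> sA r x \<in> idl C"
| idl_left: "x \<in> idl C \<Longrightarrow> a * x \<in> idl C"
| idl_right: "x \<in> idl C \<Longrightarrow> x * a \<in> idl C"

lemma idl_zero: "x \<in> idl {0} \<Longrightarrow> x = 0"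
  by (induction rule: idl.induct) simp_all

lemma idl_chain:
  assumes "y \<in> idl C" "v \<in> times_plus sA V"
  shows "v * y \<in> idl (space_prod sA (times_plus sA V) C)"
  using assms
proof (induction arbitrary: v rule: idl.induct)
  case (idl_base c)
  then show ?case by (intro idl.idl_base A.space_prodI)
next
  case (idl_left x a)
  have "(v * a) * x \<in> idl (space_prod sA (times_plus sA V) C)"
    by (intro idl_left.IH times_plus_right idl_left.prems)
  then show ?case by (simp add: mult.assoc)
next
  case (idl_right x a)
  have "(v * x) * a \<in> idl (space_prod sA (times_plus sA V) C)"
    by (intro idl.idl_right idl_right.IH idl_right.prems)
  then show ?case by (simp add: mult.assoc)
qed (simp_all add: distrib_left A.scale_mult_right idl.intros)

text \<open>The ideals that occur among the factors, each kept at its last occurrence. The label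
  \<open>None\<close> marks a factor from \<open>J\<close>.\<close>

fun labs :: "(nat option \<times> 'a) list \<Rightarrow> nat list" where
  "labs [] = []"
| "labs ((None, x) # xs) = labs xs"
| "labs ((Some i, x) # xs) = (if i \<in> set (labs xs) then labs xs else i # labs xs)"

definition lab_ok :: "nat option \<times> 'a \<Rightarrow> bool" where
  "lab_ok p = (case fst p of None \<Rightarrow> snd p \<in> A.J | Some i \<Rightarrow> i \<in> idx \<and> snd p \<in> W i)"

lemma distinct_labs: "distinct (labs xs)"
  by (induction xs rule: labs.induct) auto

lemma set_labs: "set (labs xs) = {i. Some i \<in> fst ` set xs}"
  by (induction xs rule: labs.induct) force+

lemma labs_idx: "(\<And>p. p \<in> set xs \<Longrightarrow> lab_ok p) \<Longrightarrow> set (labs xs) \<subseteq> idx"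
  by (force simp: set_labs lab_ok_def)

text \<open>Read from the right, a factor with a new label extends the chain, and every other factor
  is absorbed by the two-sided ideal. So a nonzero product forces the chain of its labels to be
  nonzero.\<close>

lemma labelled_product_chain:
  "xs \<noteq> [] \<Longrightarrow> (\<And>p. p \<in> set xs \<Longrightarrow> lab_ok p) \<Longrightarrow> labs xs \<noteq> [] \<Longrightarrow>
    list_mult (map snd xs) \<in> idl (chain (labs xs))"
proof (induction xs rule: list_nonempty_induct)
  case (single p)
  obtain l x where p: "p = (l, x)" by (cases p)
  show ?case
  proof (cases l)
    case (Some i)
    then have "x \<in> W i" using single(1)[of p] by (simp add: p lab_ok_def)
    then show ?thesis by (simp add: p Some idl.idl_base)
  qed (use single in \<open>simp add: p\<close>)
next
  case (cons p xs)
  obtain l x where p: "p = (l, x)" by (cases p)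
  have prod: "list_mult (map snd (p # xs)) = x * list_mult (map snd xs)"
    using cons(1) by (simp add: p A.list_mult_Cons)
  have IH: "labs xs \<noteq> [] \<Longrightarrow> list_mult (map snd xs) \<in> idl (chain (labs xs))"
    using cons by simp
  show ?case
  proof (cases l)
    case None
    then show ?thesis using cons(4) IH unfolding prod by (simp add: p idl.idl_left)
  next
    case (Some i)
    then have x: "x \<in> W i" using cons(3)[of p] by (simp add: p lab_ok_def)
    consider "i \<in> set (labs xs)" | "labs xs = []" | j js where "i \<notin> set (labs xs)" "labs xs = j # js"
      by (cases "labs xs") auto
    then show ?thesis
    proof cases
      case 1
      then have "labs xs \<noteq> []" by auto
      then show ?thesis using 1 IH unfolding prod by (simp add: p Some idl.idl_left)
    next
      case 2
      then show ?thesis using x unfolding prod by (simp add: p Some idl.idl_right idl.idl_base)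
    next
      case 3
      have "x * 0 + sA 1 x \<in> times_plus sA (W i)" by (rule times_plusI[OF x])
      then have "x \<in> times_plus sA (W i)" by simp
      from idl_chain[OF _ this] IH 3 show ?thesis unfolding prod by (simp add: p Some)
    qed
  qed
qed

lemma labelled_product_Jp:
  "xs \<noteq> [] \<Longrightarrow> (\<And>p. p \<in> set xs \<Longrightarrow> lab_ok p) \<Longrightarrow>
    list_mult (map snd xs) \<in> A.Jp (length (filter (\<lambda>p. fst p = None) xs))"
proof (induction xs rule: list_nonempty_induct)
  case (single p)
  then show ?case by (cases "fst p") (auto simp: lab_ok_def)
next
  case (cons p xs)
  have prod: "list_mult (map snd (p # xs)) = snd p * list_mult (map snd xs)"
    using cons(1) by (simp add: A.list_mult_Cons)
  have IH: "list_mult (map snd xs) \<in> A.Jp (length (filter (\<lambda>p. fst p = None) xs))" using cons by simp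
  show ?case
  proof (cases "fst p")
    case None
    then have "snd p \<in> A.Jp 1" using cons(3)[of p] by (simp add: lab_ok_def)
    from Jp_mult[OF this IH] show ?thesis unfolding prod by (simp add: None)
  next
    case (Some i)
    then show ?thesis unfolding prod using A.Jp_left[OF IH] by simp
  qed
qed

lemma codim_upper_bound:
  assumes d: "1 \<le> d"
    and adm: "\<And>js. js \<noteq> [] \<Longrightarrow> distinct js \<Longrightarrow> set js \<subseteq> idx \<Longrightarrow> chain js \<noteq> {0} \<Longrightarrow>
      card (\<Union>i\<in>set js. bas i) \<le> d"
  shows "\<exists>C p. \<forall>n\<ge>1. gr_codim sA G n \<le> C * n ^ p * d ^ n"
proof -
  obtain p where p: "A.Jp p = {0}" using A.J_nilpotent by blast
  obtain EJ where EJ: "EJ \<subseteq> A.J" "A.independent EJ" "A.J \<subseteq> A.span EJ"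
    using A.maximal_independent_subset[of A.J] by blast
  have finEJ: "finite EJ" using EJ(2) by (rule A.finiteI_independent)
  define E where "E = \<kappa> ` BQ \<union> EJ"
  have finE: "finite E" using finEJ Q.finite_Basis by (simp add: E_def)
  have spanE: "A.span E = UNIV"
  proof -
    have "\<kappa> u \<in> A.span E" for u
    proof -
      have "\<kappa> u = (\<Sum>b\<in>BQ. sA (Q.coord b u) (\<kappa> b))"
        by (subst Q.coord_expand[of u, symmetric]) (simp only: kappa.sum kappa.scale)
      also have "\<dots> \<in> A.span E" by (intro A.span_sum A.span_scale A.span_base) (simp add: E_def)
      finally show ?thesis .
    qed
    moreover have "a - \<kappa> (\<pi> a) \<in> A.span E" for a
      using kappa_pi_J[of a] EJ(3) A.span_mono[of EJ E] by (auto simp: E_def)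
    ultimately have "\<kappa> (\<pi> a) + (a - \<kappa> (\<pi> a)) \<in> A.span E" for a by (intro A.span_add)
    then show ?thesis by auto
  qed
  define lab where "lab = (\<lambda>x. if x \<in> EJ then None else Some (SOME i. i \<in> idx \<and> x \<in> \<kappa> ` bas i))"
  have lab_Some: "i \<in> idx \<and> x \<in> \<kappa> ` bas i" if "x \<in> E" "lab x = Some i" for x i
  proof -
    have "x \<notin> EJ" using that by (auto simp: lab_def split: if_splits)
    then have "\<exists>i. i \<in> idx \<and> x \<in> \<kappa> ` bas i" using that(1) by (auto simp: E_def BQ_eq)
    from someI_ex[OF this] show ?thesis using that(2) \<open>x \<notin> EJ\<close> by (simp add: lab_def)
  qed
  have lab_None: "lab x = None \<longleftrightarrow> x \<in> EJ" for x by (simp add: lab_def)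
  have ok: "lab_ok (lab x, A.hc t x)" if "x \<in> E" for x t
  proof (cases "lab x")
    case None
    then have "x \<in> A.J" using EJ(1) lab_None by blast
    then show ?thesis by (simp add: lab_ok_def None J_hc)
  next
    case (Some i)
    then obtain b where "i \<in> idx" "b \<in> bas i" "x = \<kappa> b"
      using lab_Some[OF \<open>x \<in> E\<close> Some] by blast
    then have "i \<in> idx" "A.hc t x \<in> W i" by (simp_all add: W_hc_kappa bas_B)
    then show ?thesis by (simp add: lab_ok_def Some)
  qed
  \<comment> \<open>Besides the sets of labels of nonzero chains, this contains the empty set, which
    occurs for tuples with all entries in \<open>J\<close>.\<close>
  define Is where "Is = {I. I \<subseteq> idx \<and> card (\<Union>i\<in>I. bas i) \<le> d}"
  have finIs: "finite Is" using finite_idx by (simp add: Is_def)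
  \<comment> \<open>The factor \<open>p\<close>, together with \<open>n ^ p\<close>, bounds the
    choices of the positions with entries in \<open>J\<close>; \<open>card Is\<close> bounds those
    of the ideals and \<open>(card EJ + 1) ^ p\<close> those of the radical entries, where the 1
    keeps the base positive; \<open>card BA\<close> counts the coordinates of a value.\<close>
  define C where "C = p * card Is * (card EJ + 1) ^ p * card BA"
  have "gr_codim sA G n \<le> C * n ^ p * d ^ n" if n: "1 \<le> n" for n
  proof -
    define X where "X = {x \<in> {1..n} \<rightarrow>\<^sub>E E. \<exists>w\<in>A.gmonomials n. A.ev x w \<noteq> 0}"
    define Ks where "Ks = {K. K \<subseteq> {1..n} \<and> card K < p}"
    define T where "T = (\<lambda>K I. \<Pi>\<^sub>E j\<in>{1..n}. if j \<in> K then EJ else \<kappa> ` (\<Union>i\<in>I. bas i))"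
    have "finite ({1..n} \<rightarrow>\<^sub>E E)" using finE by (intro finite_PiE) auto
    then have finX: "finite X" by (rule rev_finite_subset) (auto simp: X_def)
    have XT: "X \<subseteq> (\<Union>K\<in>Ks. \<Union>I\<in>Is. T K I)"
    proof
      fix x assume "x \<in> X"
      then obtain w where x: "x \<in> {1..n} \<rightarrow>\<^sub>E E" and w: "w \<in> A.gmonomials n" "A.ev x w \<noteq> 0"
        by (auto simp: X_def)
      have wd: "distinct (map snd w)" "snd ` set w = {1..n}" using w(1) by (simp_all add: A.gmonomials_def)
      have wne: "w \<noteq> []" using wd(2) n by auto
      define xs where "xs = map (\<lambda>(t, i). (lab (x i), A.hc t (x i))) w"
      have xE: "x i \<in> E" if "i \<in> {1..n}" for i using x that by blast
      have xs_ok: "lab_ok pp" if pp: "pp \<in> set xs" for pp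
      proof -
        obtain t i where "(t, i) \<in> set w" "pp = (lab (x i), A.hc t (x i))" using pp by (auto simp: xs_def)
        moreover from this have "i \<in> {1..n}" using wd(2) by force
        ultimately show ?thesis using ok[OF xE] by simp
      qed
      have "map snd xs = map (\<lambda>(t, i). A.hc t (x i)) w" by (auto simp: xs_def)
      then have nz: "list_mult (map snd xs) \<noteq> 0" using w(2) by (simp add: A.ev_def)
      have xsne: "xs \<noteq> []" using wne by (simp add: xs_def)
      define K where "K = {i \<in> {1..n}. x i \<in> EJ}"
      have "length (filter (\<lambda>p. fst p = None) xs) = length (filter (\<lambda>i. x i \<in> EJ) (map snd w))"
        by (simp add: xs_def filter_map comp_def case_prod_beta lab_None)
      also have "\<dots> = card (set (filter (\<lambda>i. x i \<in> EJ) (map snd w)))"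
        using wd(1) by (intro distinct_card[symmetric] distinct_filter)
      also have "set (filter (\<lambda>i. x i \<in> EJ) (map snd w)) = K" using wd(2) by (auto simp: K_def)
      finally have cK: "length (filter (\<lambda>p. fst p = None) xs) = card K" .
      have "card K < p"
      proof (rule ccontr)
        assume "\<not> card K < p"
        then have "A.Jp (card K) \<subseteq> {0}" using A.Jp_antimono[of p "card K"] p by simp
        then show False using labelled_product_Jp[OF xsne xs_ok] nz cK by auto
      qed
      then have KKs: "K \<in> Ks" by (auto simp: Ks_def K_def)
      define I where "I = set (labs xs)"
      have "card (\<Union>i\<in>I. bas i) \<le> d"
      proof (cases "labs xs = []")
        case False
        have "chain (labs xs) \<noteq> {0}"
          using labelled_product_chain[OF xsne xs_ok False] idl_zero nz by auto
        then show ?thesis unfolding I_def using False distinct_labs labs_idx[OF xs_ok] by (intro adm)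
      qed (simp add: I_def)
      then have IIs: "I \<in> Is" using labs_idx[OF xs_ok] by (simp add: Is_def I_def)
      have "x j \<in> (if j \<in> K then EJ else \<kappa> ` (\<Union>i\<in>I. bas i))" if j: "j \<in> {1..n}" for j
      proof (cases "j \<in> K")
        case True then show ?thesis by (simp add: K_def)
      next
        case False
        then have "lab (x j) \<noteq> None" using j by (simp add: K_def lab_None)
        then obtain i where i: "lab (x j) = Some i" by blast
        obtain t where "(t, j) \<in> set w" using j wd(2) by force
        then have "Some i \<in> fst ` set xs" unfolding xs_def using i by force
        then have "i \<in> I" by (simp add: I_def set_labs)
        then show ?thesis using lab_Some[OF xE[OF j] i] False by auto
      qed
      then have "x \<in> T K I" using x by (auto simp: T_def PiE_iff)
      with KKs IIs show "x \<in> (\<Union>K\<in>Ks. \<Union>I\<in>Is. T K I)" by blast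
    qed
    have finKs: "finite Ks" unfolding Ks_def by simp
    have cardKs: "card Ks \<le> p * n ^ p"
    proof -
      have "Ks = (\<Union>k<p. {K. K \<subseteq> {1..n} \<and> card K = k})" by (auto simp: Ks_def)
      then have "card Ks \<le> (\<Sum>k<p. card {K. K \<subseteq> {1..n} \<and> card K = k})"
        by (simp add: card_UN_le)
      also have "\<dots> \<le> (\<Sum>k<p. n ^ p)"
      proof (rule sum_mono)
        fix k assume "k \<in> {..<p}"
        have "card {K. K \<subseteq> {1..n} \<and> card K = k} = n choose k" using n_subsets[of "{1..n}" k] by simp
        also have "\<dots> \<le> n ^ k"
        proof (cases "k \<le> n")
          case True then show ?thesis by (rule binomial_le_pow)
        qed (simp add: binomial_eq_0)
        also have "\<dots> \<le> n ^ p" using n \<open>k \<in> {..<p}\<close> by (intro power_increasing) auto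
        finally show "card {K. K \<subseteq> {1..n} \<and> card K = k} \<le> n ^ p" .
      qed
      finally show ?thesis by simp
    qed
    have finU: "finite (\<Union>i\<in>I. bas i)" if I: "I \<in> Is" for I
      using I finite_idx finite_bas by (auto simp: Is_def intro: finite_subset)
    have cardT: "card (T K I) \<le> (card EJ + 1) ^ p * d ^ n" if K: "K \<in> Ks" and I: "I \<in> Is" for K I
    proof -
      have Kn: "K \<subseteq> {1..n}" "card K < p" using K by (simp_all add: Ks_def)
      have "card (T K I) = (\<Prod>j\<in>{1..n}. card (if j \<in> K then EJ else \<kappa> ` (\<Union>i\<in>I. bas i)))"
        unfolding T_def by (rule card_PiE) simp
      also have "\<dots> \<le> (\<Prod>j\<in>{1..n}. if j \<in> K then card EJ + 1 else d)"
      proof (rule prod_mono)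
        fix j
        have "card (\<kappa> ` (\<Union>i\<in>I. bas i)) \<le> d"
          using card_image_le[OF finU[OF I], of \<kappa>] I by (simp add: Is_def)
        then show "0 \<le> card (if j \<in> K then EJ else \<kappa> ` (\<Union>i\<in>I. bas i)) \<and>
          card (if j \<in> K then EJ else \<kappa> ` (\<Union>i\<in>I. bas i)) \<le> (if j \<in> K then card EJ + 1 else d)" by simp
      qed
      also have "\<dots> = (card EJ + 1) ^ card K * d ^ card ({1..n} - K)"
      proof -
        have "{1..n} \<inter> {j. j \<in> K} = K" "{1..n} \<inter> - {j. j \<in> K} = {1..n} - K" using Kn(1) by auto
        then show ?thesis by (simp add: prod.If_cases)
      qed
      also have "\<dots> \<le> (card EJ + 1) ^ p * d ^ n"
      proof (rule mult_le_mono)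
        show "(card EJ + 1) ^ card K \<le> (card EJ + 1) ^ p" using Kn(2) by (intro power_increasing) auto
        have "card ({1..n} - K) \<le> n" using card_mono[of "{1..n}" "{1..n} - K"] by simp
        then show "d ^ card ({1..n} - K) \<le> d ^ n" using d by (intro power_increasing) auto
      qed
      finally show ?thesis .
    qed
    have finT: "finite (T K I)" if "I \<in> Is" for K I
      unfolding T_def using finU[OF that] finEJ by (intro finite_PiE) simp_all
    have "card X \<le> card (\<Union>K\<in>Ks. \<Union>I\<in>Is. T K I)"
      using finKs finIs finT by (intro card_mono XT) auto
    also have "\<dots> \<le> (\<Sum>K\<in>Ks. card (\<Union>I\<in>Is. T K I))" by (rule card_UN_le[OF finKs])
    also have "\<dots> \<le> (\<Sum>K\<in>Ks. \<Sum>I\<in>Is. card (T K I))" by (intro sum_mono card_UN_le[OF finIs])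
    also have "\<dots> \<le> (\<Sum>K\<in>Ks. \<Sum>I\<in>Is. (card EJ + 1) ^ p * d ^ n)" by (intro sum_mono cardT)
    also have "\<dots> = card Ks * (card Is * ((card EJ + 1) ^ p * d ^ n))" by simp
    also have "\<dots> \<le> p * n ^ p * (card Is * ((card EJ + 1) ^ p * d ^ n))" by (intro mult_le_mono1 cardKs)
    finally have cX: "card X \<le> p * n ^ p * (card Is * ((card EJ + 1) ^ p * d ^ n))" .
    have "gr_codim sA G n \<le> card X * card BA"
    proof (rule A.qbasis_card_le(2)[OF n finX])
      fix f assume f: "f \<in> gr_multilinear n" and 0: "\<And>x. x \<in> X \<Longrightarrow> A.pev x f = 0"
      have "A.pev x f = 0" if x: "x \<in> {1..n} \<rightarrow>\<^sub>E E" for x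
      proof (cases "x \<in> X")
        case False
        then have "A.ev x w = 0" if "w \<in> Poly_Mapping.keys f" for w
          using that x A.gr_multilinear_keys[OF f] by (auto simp: X_def)
        then show ?thesis by (simp add: A.gr_multilinear_expand)
      qed (rule 0)
      then show "\<forall>x. A.pev x f = 0" using A.pev_eq_0_spanning[OF f spanE] by blast
    qed
    also have "\<dots> \<le> (p * n ^ p * (card Is * ((card EJ + 1) ^ p * d ^ n))) * card BA"
      by (rule mult_le_mono1[OF cX])
    also have "\<dots> = C * n ^ p * d ^ n" by (simp only: C_def mult_ac)
    finally show ?thesis .
  qed
  then show ?thesis by blast
qed

end

section \<open>Exponential growth\<close>

context codim_setup
begin

lemma gfun_list:
  "xs \<noteq> [] \<Longrightarrow> distinct xs \<Longrightarrow> A.gfun (set xs) 0 (\<lambda>x. list_mult (map x xs))"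
proof (induction xs rule: list_nonempty_induct)
  case (single i)
  then show ?case using A.gfun_var[of i] by simp
next
  case (cons i xs)
  have "A.gfun ({i} \<union> set xs) (0 + 0) (\<lambda>x. x i * list_mult (map x xs))"
    by (intro A.gfun_mult A.gfun_var) (use cons in auto)
  then show ?case using cons(1) by (simp add: A.list_mult_Cons)
qed

lemma space_power_span: "space_power sA n \<subseteq> A.span {list_mult xs | xs. length xs = Suc n}"
proof (induction n)
  case 0
  have "x \<in> {list_mult xs | xs. length xs = Suc 0}" for x :: 'a
    by (intro CollectI exI[of _ "[x]"]) simp
  then show ?case by (auto intro: A.span_base)
next
  case (Suc n)
  let ?S = "A.span {list_mult xs | xs :: 'a list. length xs = Suc (Suc n)}"
  have "space_prod sA UNIV (space_power sA n) \<subseteq> ?S"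
  proof (rule A.space_prod_subset[OF A.subspace_span])
    fix x y assume "y \<in> space_power sA n"
    have "A.span {list_mult xs | xs :: 'a list. length xs = Suc n} \<subseteq> {y. x * y \<in> ?S}"
    proof (rule A.span_minimal)
      show "A.subspace {y. x * y \<in> ?S}" by (rule A.subspace_mult_vimage[OF A.subspace_span])
      have "x * list_mult xs \<in> ?S" if "length xs = Suc n" for xs :: "'a list"
      proof (rule A.span_base)
        have "x * list_mult xs = list_mult (x # xs)" using that by (subst A.list_mult_Cons) auto
        then show "x * list_mult xs \<in> {list_mult xs | xs :: 'a list. length xs = Suc (Suc n)}"
          using that by (intro CollectI exI[of _ "x # xs"]) simp
      qed
      then show "{list_mult xs | xs. length xs = Suc n} \<subseteq> {y. x * y \<in> ?S}" by blast
    qed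
    then show "x * y \<in> ?S" using Suc \<open>y \<in> space_power sA n\<close> by blast
  qed
  then show ?case by simp
qed

text \<open>Some product of \<open>n\<close> elements is nonzero, so the product of \<open>n\<close>
  variables is a nonzero function. This is needed for the finitely many \<open>n\<close> that are
  smaller than the number of constants in the lower bound.\<close>

lemma codim_pos:
  assumes nn: "\<not> nilpotent_algebra sA" and n: "1 \<le> n" shows "1 \<le> gr_codim sA G n"
proof -
  have "A.subspace (space_power sA (n - 1))" by (cases "n - 1") (simp_all add: A.subspace_space_prod)
  then have "0 \<in> space_power sA (n - 1)" by (rule A.subspace_0)
  then obtain z where z: "z \<in> space_power sA (n - 1)" "z \<noteq> 0"
    using nn by (auto simp: nilpotent_algebra_def)
  have "\<exists>xs. length xs = n \<and> list_mult xs \<noteq> (0 :: 'a)"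
  proof (rule ccontr)
    assume "\<not> ?thesis"
    then have "{list_mult xs | xs :: 'a list. length xs = Suc (n - 1)} \<subseteq> {0}" using n by auto
    from A.span_mono[OF this] space_power_span[of "n - 1"] z show False by auto
  qed
  then obtain xs where xs: "length xs = n" "list_mult xs \<noteq> (0 :: 'a)" by blast
  define F where "F = (\<lambda>_ :: unit. \<lambda>x :: nat \<Rightarrow> 'a. list_mult (map x [1..<Suc n]))"
  have "map (\<lambda>i. xs ! (i - 1)) [1..<Suc n] = xs"
    by (rule nth_equalityI) (simp_all add: xs(1) del: upt_Suc)
  then have Fnz: "F () (\<lambda>i. xs ! (i - 1)) \<noteq> 0" using xs(2) by (simp add: F_def del: upt_Suc)
  have "card {()} \<le> card BA ^ 0 * gr_codim sA G (n + 0)"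
  proof (rule A.codim_lower_bound[where F = F])
    fix s :: unit
    have "set [1..<Suc n] = {1..n}" by auto
    moreover have "[1..<Suc n] \<noteq> []" using n by simp
    ultimately show "A.gfun {1..n} 0 (F s)"
      using gfun_list[of "[1..<Suc n]"] unfolding F_def by (simp del: upt_Suc)
    fix a assume zero: "\<And>x. (\<Sum>s\<in>{()}. sA (a s) (F s x)) = 0"
    have "sA (a ()) (F () (\<lambda>i. xs ! (i - 1))) = 0" using zero[of "\<lambda>i. xs ! (i - 1)"] by simp
    then show "\<forall>s\<in>{()}. a s = 0" using Fnz by simp
  qed (use n in auto)
  then show ?thesis by simp
qed

lemma codim_growth:
  fixes d :: nat
  assumes nn: "\<not> nilpotent_algebra sA" and d: "1 \<le> d"
    and adm: "\<And>js. js \<noteq> [] \<Longrightarrow> distinct js \<Longrightarrow> set js \<subseteq> idx \<Longrightarrow> chain js \<noteq> {0} \<Longrightarrow>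
      card (\<Union>i\<in>set js. bas i) \<le> d"
    and js: "js \<noteq> []" "distinct js" "set js \<subseteq> idx" "chain js \<noteq> {0}" "card (\<Union>i\<in>set js. bas i) = d"
  shows "\<exists>C\<^sub>1>0. \<exists>C\<^sub>2>0. \<exists>r\<^sub>1 r\<^sub>2 :: real. \<forall>n::nat. n \<ge> 1 \<longrightarrow>
           C\<^sub>1 * real n powr r\<^sub>1 * real d ^ n \<le> real (gr_codim sA G n) \<and>
           real (gr_codim sA G n) \<le> C\<^sub>2 * real n powr r\<^sub>2 * real d ^ n"
proof -
  obtain C p where up: "\<And>n. 1 \<le> n \<Longrightarrow> gr_codim sA G n \<le> C * n ^ p * d ^ n"
    using codim_upper_bound[OF d adm] by blast
  have cd: "card (Dset js) = d" using js(5) by (simp add: Dset_def)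
  have "Nch js 0 \<noteq> {0}"
    using chain_subset_Nch[OF js(1,3)] js(4) A.subspace_0[OF subspace_chain[of js]] by auto
  from codim_lower_bound_list[OF js(3,2,1) this] obtain c where
    low: "\<And>m r. r \<le> 1 \<Longrightarrow> d ^ (2 * m) \<le> card BA ^ (c + 1) * (m + 1) ^ d\<^sup>2 * gr_codim sA G (2 * m + c + r)"
    unfolding cd by blast
  have cBA: "1 \<le> card BA" using BA_nonempty A.finite_Basis by (simp add: Suc_le_eq card_gt_0_iff)
  \<comment> \<open>The factor \<open>d ^ (c + 1)\<close> makes up for the degrees spent on
    constants and parity, and \<open>2 ^ d\<^sup>2\<close> comes from
    \<open>m + 1 \<le> 2 * n\<close>.\<close>
  define M where "M = d ^ (c + 1) * card BA ^ (c + 1) * 2 ^ d\<^sup>2"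
  have M: "1 \<le> M" unfolding M_def using cBA d by simp
  have lower: "d ^ n \<le> M * n ^ d\<^sup>2 * gr_codim sA G n" if n: "1 \<le> n" for n
  proof (cases "c \<le> n")
    case True
    define m r where "m = (n - c) div 2" and "r = (n - c) mod 2"
    have r: "r \<le> 1" and nm: "n = 2 * m + c + r" using True by (auto simp: m_def r_def)
    have "d ^ n = d ^ (c + r) * d ^ (2 * m)" by (simp add: nm power_add)
    also have "\<dots> \<le> d ^ (c + 1) * (card BA ^ (c + 1) * (m + 1) ^ d\<^sup>2 * gr_codim sA G (2 * m + c + r))"
      using r d by (intro mult_le_mono low power_increasing) auto
    also have "\<dots> \<le> d ^ (c + 1) * (card BA ^ (c + 1) * (2 * n) ^ d\<^sup>2 * gr_codim sA G n)"
      unfolding nm[symmetric] using nm n by (intro mult_le_mono power_mono) auto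
    also have "\<dots> = M * n ^ d\<^sup>2 * gr_codim sA G n"
      by (simp only: M_def power_mult_distrib mult_ac)
    finally show ?thesis .
  next
    case False
    then have "d ^ n \<le> d ^ (c + 1)" using d by (intro power_increasing) auto
    also have "\<dots> \<le> d ^ (c + 1) * (card BA ^ (c + 1) * 2 ^ d\<^sup>2 * n ^ d\<^sup>2 * gr_codim sA G n)"
      using cBA n codim_pos[OF nn n] by simp
    also have "\<dots> = M * n ^ d\<^sup>2 * gr_codim sA G n" by (simp only: M_def mult_ac)
    finally show ?thesis .
  qed
  \<comment> \<open>The constant \<open>C + 1\<close> is used because \<open>C\<close> may be 0 and
    a positive constant is required.\<close>
  have "1 / real M * real n powr - real (d\<^sup>2) * real d ^ n \<le> real (gr_codim sA G n) \<and>
      real (gr_codim sA G n) \<le> real (C + 1) * real n powr real p * real d ^ n" if n: "1 \<le> n" for n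
  proof
    have n0: "0 < real n" using n by simp
    have "real d ^ n = real (d ^ n)" by simp
    also have "\<dots> \<le> real (M * n ^ d\<^sup>2 * gr_codim sA G n)" using lower[OF n] by (simp only: of_nat_le_iff)
    finally have "real d ^ n \<le> real M * real n ^ d\<^sup>2 * real (gr_codim sA G n)" by simp
    then show "1 / real M * real n powr - real (d\<^sup>2) * real d ^ n \<le> real (gr_codim sA G n)"
      unfolding powr_minus powr_realpow[OF n0] using M n0 by (simp add: field_simps)
    have "real (gr_codim sA G n) \<le> real (C * n ^ p * d ^ n)" using up[OF n] by (simp only: of_nat_le_iff)
    also have "\<dots> \<le> real (C + 1) * real n powr real p * real d ^ n"
      using n0 by (simp add: powr_realpow mult_right_mono)
    finally show "real (gr_codim sA G n) \<le> real (C + 1) * real n powr real p * real d ^ n" .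
  qed
  moreover have "0 < 1 / real M" "0 < real (C + 1)" using M by auto
  ultimately show ?thesis by blast
qed

end

theorem theorem2:
  fixes sA :: "'f::{alg_closed_field, field_char_0} \<Rightarrow> 'a::ring \<Rightarrow> 'a"
    and sQ :: "'f \<Rightarrow> 'q::ring \<Rightarrow> 'q"
    and G :: "'t::semigroup_mult \<Rightarrow> 'a set"
    and \<pi> :: "'a \<Rightarrow> 'q"
    and \<kappa> :: "'q \<Rightarrow> 'a"
    and B :: "nat \<Rightarrow> 'q set"
    and q :: nat
  assumes "assoc_algebra sA"
    and "fin_dim sA"
    and "\<not> nilpotent_algebra sA"
    and "is_grading sA G"
    and "graded_ideal_of sA G UNIV (jacobson_radical sA)"
    \<comment> \<open>the algebra \<open>'q\<close> is \<open>A/J\<close> and \<open>\<pi>\<close> is the natural projection\<close>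
    and "assoc_algebra sQ"
    and "algebra_hom sA sQ \<pi>"
    and "surj \<pi>"
    and "{a. \<pi> a = 0} = jacobson_radical sA"
    \<comment> \<open>\<open>A/J\<close> carries the grading induced by \<open>\<pi>\<close>\<close>
    and "direct_sum {1..q} B UNIV"
    and "\<And>i. i \<in> {1..q} \<Longrightarrow> graded_ideal_of sQ (\<lambda>t. \<pi> ` G t) UNIV (B i)"
    and "\<And>i. i \<in> {1..q} \<Longrightarrow> graded_simple sQ (\<lambda>t. \<pi> ` G t) (B i)"
    and "algebra_hom sQ sA \<kappa>"
    and "\<pi> \<circ> \<kappa> = id"
  shows "\<exists>C\<^sub>1>0. \<exists>C\<^sub>2>0. \<exists>r\<^sub>1 r\<^sub>2 :: real. \<forall>n::nat. n \<ge> 1 \<longrightarrow>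
           C\<^sub>1 * real n powr r\<^sub>1 * real (graded_exponent sA sQ G \<kappa> q B) ^ n
             \<le> real (gr_codim sA G n) \<and>
           real (gr_codim sA G n)
             \<le> C\<^sub>2 * real n powr r\<^sub>2 * real (graded_exponent sA sQ G \<kappa> q B) ^ n"
proof -
  let ?G' = "\<lambda>t. \<pi> ` G t"
  define idx where "idx = {1..q}"
  have finite_idx: "finite idx" by (simp add: idx_def)
  interpret QQ: assoc_algebra sQ by (rule assms(6))
  obtain BA where BA: "finite_dimensional_vector_space sA BA" using assms(2) by (auto simp: fin_dim_def)
  interpret A: graded_algebra sA BA G
    using assms(1,4) BA by (intro graded_algebra.intro fd_algebra.intro graded_algebra_axioms.intro)
  interpret pi: Vector_Spaces.linear sA sQ \<pi> using assms(7) by (simp add: algebra_hom_def)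
  interpret kappa: Vector_Spaces.linear sQ sA \<kappa> using assms(13) by (simp add: algebra_hom_def)
  have pi_mult: "\<pi> (x * y) = \<pi> x * \<pi> y" for x y using assms(7) by (simp add: algebra_hom_def)
  have kappa_mult: "\<kappa> (x * y) = \<kappa> x * \<kappa> y" for x y using assms(13) by (simp add: algebra_hom_def)
  have pi_ker: "\<pi> x = 0 \<longleftrightarrow> x \<in> A.J" for x using assms(9) by blast
  have pi_kappa: "\<pi> (\<kappa> u) = u" for u using assms(14) by (metis comp_apply id_apply)
  have J_right: "x * a \<in> A.J" if "x \<in> A.J" for x a
    using assms(5) that by (simp add: graded_ideal_of_def)
  have J_hc: "A.hc t x \<in> A.J" if x: "x \<in> A.J" for t x
  proof -
    have "direct_sum UNIV (\<lambda>t. A.J \<inter> G t) A.J"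
      using assms(5) by (simp add: graded_ideal_of_def graded_subspace_def)
    then obtain f where f: "is_decomposition UNIV (\<lambda>t. A.J \<inter> G t) x f"
      using x unfolding direct_sum_def by blast
    then have "is_decomposition UNIV G x f" by (auto simp: is_decomposition_def)
    from A.hc_unique[OF this] f show ?thesis by (auto simp: is_decomposition_def)
  qed
  have hq_pi: "\<pi> (A.hc t (\<kappa> (\<pi> a))) = \<pi> (A.hc t a)" for t a
  proof -
    have "a - \<kappa> (\<pi> a) \<in> A.J" by (simp add: pi.diff pi_kappa flip: pi_ker)
    then have "\<pi> (A.hc t (a - \<kappa> (\<pi> a))) = 0" using J_hc pi_ker by blast
    moreover have "A.hc t a = A.hc t (a - \<kappa> (\<pi> a)) + A.hc t (\<kappa> (\<pi> a))"
      by (simp flip: A.hc_add)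
    ultimately show ?thesis by (simp add: pi.add)
  qed
  \<comment> \<open>The components of \<open>w\<close> are lifted to homogeneous elements, with lift
    0 where they vanish so that the sum stays finite. Uniqueness of components in \<open>A\<close>
    then gives uniqueness in the quotient.\<close>
  have hq_unique: "\<pi> (A.hc t (\<kappa> w)) = f t" if f: "is_decomposition UNIV ?G' w f" for w f t
  proof -
    have "\<forall>t. \<exists>a. f t = \<pi> a \<and> a \<in> G t \<and> (f t = 0 \<longrightarrow> a = 0)"
    proof
      fix t
      have "f t \<in> \<pi> ` G t" using f by (simp add: is_decomposition_def)
      then obtain a where "f t = \<pi> a" "a \<in> G t" by blast
      then show "\<exists>a. f t = \<pi> a \<and> a \<in> G t \<and> (f t = 0 \<longrightarrow> a = 0)"
        using A.subspace_0[OF A.subspace_G, of t]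
        by (cases "f t = 0") (auto intro: exI[of _ 0] simp: pi.zero)
    qed
    then obtain g where g: "\<And>t. f t = \<pi> (g t)" "\<And>t. g t \<in> G t" "\<And>t. f t = 0 \<Longrightarrow> g t = 0" by metis
    define a where "a = (\<Sum>t | f t \<noteq> 0. g t)"
    have "A.hc t a = g t"
      by (rule A.hc_eqI[of "{t. f t \<noteq> 0}"]) (use f g(2,3) in \<open>auto simp: a_def is_decomposition_def\<close>)
    moreover have "\<pi> a = w"
      using f by (simp add: a_def pi.sum is_decomposition_def flip: g(1))
    moreover have "\<pi> (A.hc t (\<kappa> (\<pi> a))) = \<pi> (A.hc t a)" by (rule hq_pi)
    ultimately show ?thesis using g(1)[of t] by simp
  qed
  have ideal: "QQ.subspace (B i)" "\<And>u v. u \<in> B i \<Longrightarrow> v * u \<in> B i \<and> u * v \<in> B i"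
    "\<And>u t. u \<in> B i \<Longrightarrow> \<pi> (A.hc t (\<kappa> u)) \<in> B i" if i: "i \<in> idx" for i
  proof -
    show "QQ.subspace (B i)"
      using assms(11)[folded idx_def, OF i] by (simp add: graded_ideal_of_def graded_subspace_def)
    show "v * u \<in> B i \<and> u * v \<in> B i" if "u \<in> B i" for u v
      using assms(11)[folded idx_def, OF i] that by (simp add: graded_ideal_of_def)
    show "\<pi> (A.hc t (\<kappa> u)) \<in> B i" if u: "u \<in> B i" for u t
    proof -
      have "direct_sum UNIV (\<lambda>t. B i \<inter> ?G' t) (B i)"
        using assms(11)[folded idx_def, OF i] by (simp add: graded_ideal_of_def graded_subspace_def)
      then obtain f where f: "is_decomposition UNIV (\<lambda>t. B i \<inter> ?G' t) u f"
        using u unfolding direct_sum_def by blast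
      then have "is_decomposition UNIV ?G' u f" by (auto simp: is_decomposition_def)
      from hq_unique[OF this] f show ?thesis by (auto simp: is_decomposition_def)
    qed
  qed
  have zero_sum: "w i = 0"
    if w: "\<And>i. i \<in> idx \<Longrightarrow> w i \<in> B i" "(\<Sum>i\<in>idx. w i) = 0" and i: "i \<in> idx" for w i
  proof -
    define f where "f = (\<lambda>i. if i \<in> idx then w i else 0)"
    have "(\<Sum>i | f i \<noteq> 0. f i) = (\<Sum>i\<in>idx. f i)"
      by (rule sum.mono_neutral_left) (auto simp: f_def finite_idx)
    also have "\<dots> = (\<Sum>i\<in>idx. w i)" by (rule sum.cong) (simp_all add: f_def)
    also have "\<dots> = 0" by (rule w(2))
    finally have "(\<Sum>i | f i \<noteq> 0. f i) = 0" .
    moreover have "finite {i. f i \<noteq> 0}" by (rule finite_subset[of _ idx]) (auto simp: f_def finite_idx)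
    moreover have "\<forall>i\<in>idx. f i \<in> B i" using w(1) by (simp add: f_def)
    moreover have "\<forall>i. i \<notin> idx \<longrightarrow> f i = 0" by (simp add: f_def)
    ultimately have "is_decomposition idx B 0 f" unfolding is_decomposition_def by simp
    moreover have "is_decomposition idx B 0 (\<lambda>_. 0)"
      using ideal(1) QQ.subspace_0 by (simp add: is_decomposition_def)
    moreover have "\<exists>!f. is_decomposition idx B 0 f" using assms(10)[folded idx_def] by (simp add: direct_sum_def)
    ultimately have "f = (\<lambda>_. 0)" by blast
    from fun_cong[OF this, of i] show ?thesis using i by (simp add: f_def)
  qed
  have B_disjoint: "B i \<inter> B j = {0}" if ij: "i \<in> idx" "j \<in> idx" "i \<noteq> j" for i j
  proof -
    have "u = 0" if u: "u \<in> B i" "u \<in> B j" for u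
    proof -
      define w where "w = (\<lambda>k. if k = i then u else if k = j then - u else 0)"
      have "w k \<in> B k" if "k \<in> idx" for k
        using u ideal(1)[OF that] QQ.subspace_neg QQ.subspace_0 by (auto simp: w_def)
      moreover have "(\<Sum>k\<in>idx. w k) = (\<Sum>k\<in>{i, j}. w k)"
        by (rule sum.mono_neutral_right) (use ij finite_idx in \<open>auto simp: w_def\<close>)
      then have "(\<Sum>k\<in>idx. w k) = 0" using ij(3) by (simp add: w_def)
      ultimately have "w i = 0" using ij(1) by (rule zero_sum)
      then show ?thesis by (simp add: w_def)
    qed
    then show ?thesis using ideal(1) ij QQ.subspace_0 by blast
  qed
  have span_pi: "QQ.span (\<pi> ` BA) = UNIV"
    using pi.span_image[of BA] A.span_Basis assms(8) by simp
  have "\<exists>C. C \<subseteq> B i \<and> QQ.independent C \<and> QQ.span C = B i \<and> finite C" if i: "i \<in> idx" for i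
  proof -
    obtain C where C: "C \<subseteq> B i" "QQ.independent C" "B i \<subseteq> QQ.span C"
      using QQ.maximal_independent_subset[of "B i"] by blast
    have "QQ.span C = B i" using C ideal(1)[OF i] by (simp add: QQ.span_subspace)
    moreover have "finite C"
      using QQ.independent_span_bound[of "\<pi> ` BA" C] A.finite_Basis C(2) by (simp add: span_pi)
    ultimately show ?thesis using C by blast
  qed
  then have "\<forall>i\<in>idx. \<exists>C. C \<subseteq> B i \<and> QQ.independent C \<and> QQ.span C = B i \<and> finite C" by blast
  from bchoice[OF this] obtain bas where bas: "\<And>i. i \<in> idx \<Longrightarrow> bas i \<subseteq> B i"
    "\<And>i. i \<in> idx \<Longrightarrow> QQ.independent (bas i)" "\<And>i. i \<in> idx \<Longrightarrow> QQ.span (bas i) = B i"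
    "\<And>i. i \<in> idx \<Longrightarrow> finite (bas i)" by blast
  have bas_disjoint: "bas i \<inter> bas j = {}" if ij: "i \<in> idx" "j \<in> idx" "i \<noteq> j" for i j
  proof -
    have "bas i \<inter> bas j \<subseteq> {0}" using bas(1)[OF ij(1)] bas(1)[OF ij(2)] B_disjoint[OF ij] by blast
    moreover have "0 \<notin> bas i" using QQ.dependent_zero bas(2)[OF ij(1)] by blast
    ultimately show ?thesis by blast
  qed
  define BQ where "BQ = (\<Union>i\<in>idx. bas i)"
  have finBQ: "finite BQ" unfolding BQ_def using bas(4) finite_idx by blast
  have indBQ: "QQ.independent BQ"
  proof
    assume "QQ.dependent BQ"
    then obtain u where u: "\<exists>v\<in>BQ. u v \<noteq> 0" "(\<Sum>v\<in>BQ. sQ (u v) v) = 0"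
      using QQ.dependent_finite[OF finBQ] by blast
    have "(\<Sum>v\<in>BQ. sQ (u v) v) = (\<Sum>i\<in>idx. \<Sum>v\<in>bas i. sQ (u v) v)"
      unfolding BQ_def using bas(4) bas_disjoint finite_idx by (intro sum.UNION_disjoint) simp_all
    then have s0: "(\<Sum>i\<in>idx. \<Sum>v\<in>bas i. sQ (u v) v) = 0" using u(2) by simp
    have "u v = 0" if v: "i \<in> idx" "v \<in> bas i" for i v
    proof -
      have "(\<Sum>v\<in>bas i. sQ (u v) v) = 0"
      proof (rule zero_sum[OF _ s0 v(1)])
        fix j assume j: "j \<in> idx"
        show "(\<Sum>v\<in>bas j. sQ (u v) v) \<in> B j"
          using ideal(1)[OF j] bas(1)[OF j] by (intro QQ.subspace_sum QQ.subspace_scale) auto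
      qed
      then show ?thesis using QQ.independentD[OF bas(2)[OF v(1)] bas(4)[OF v(1)] order_refl _ v(2)] by simp
    qed
    then show False using u(1) by (auto simp: BQ_def)
  qed
  have spanBQ: "QQ.span BQ = UNIV"
  proof -
    have "w \<in> QQ.span BQ" for w
    proof -
      obtain f where f: "is_decomposition idx B w f" using assms(10)[folded idx_def] unfolding direct_sum_def by blast
      have "f i \<in> QQ.span BQ" if "f i \<noteq> 0" for i
      proof -
        have i: "i \<in> idx" using f that unfolding is_decomposition_def by blast
        then have "f i \<in> QQ.span (bas i)" using f bas(3) by (simp add: is_decomposition_def)
        moreover have "bas i \<subseteq> BQ" using i by (auto simp: BQ_def)
        ultimately show ?thesis using QQ.span_mono by blast
      qed
      then have "(\<Sum>i | f i \<noteq> 0. f i) \<in> QQ.span BQ" by (intro QQ.span_sum) simp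
      then show ?thesis using f by (simp add: is_decomposition_def)
    qed
    then show ?thesis by blast
  qed
  \<comment> \<open>Without any \<open>B i\<close> the quotient is 0, so the algebra equals its
    radical and is nilpotent. The indices are shifted because \<open>space_power sA n\<close> is the
    power with exponent \<open>n + 1\<close>.\<close>
  have idx_ne: "idx \<noteq> {}"
  proof
    assume "idx = {}"
    then have "BQ = {}" by (simp add: BQ_def)
    then have "u = 0" for u :: 'q using spanBQ by auto
    then have "A.J = UNIV" using pi_ker by blast
    then have "A.Jp (Suc n) = space_power sA n" for n by (induction n) simp_all
    moreover obtain p where "A.Jp p = {0}" using A.J_nilpotent by blast
    then have "A.Jp (Suc p) = {0}"
      using A.Jp_Suc_subset[of p] A.subspace_0[OF A.subspace_Jp[of "Suc p"]] by blast
    ultimately show False using assms(3) by (auto simp: nilpotent_algebra_def)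
  qed
  have pi_pw: "\<pi> (pw x l) = pw (\<pi> x) l" for x l by (induction l) (simp_all add: pi_mult)
  have B_simple: "I = {0} \<or> I = B i"
    if i: "i \<in> idx" and I: "QQ.subspace I" "I \<subseteq> B i" "\<And>u t. u \<in> I \<Longrightarrow> \<pi> (A.hc t (\<kappa> u)) \<in> I"
      "\<And>u v. u \<in> I \<Longrightarrow> v \<in> B i \<Longrightarrow> v * u \<in> I \<and> u * v \<in> I" for i I
  proof -
    \<comment> \<open>Closure under the component operators makes \<open>I\<close> a graded subspace
      for the induced grading, so graded simplicity applies to it.\<close>
    have "direct_sum UNIV (\<lambda>t. I \<inter> ?G' t) I"
      unfolding direct_sum_def
    proof (intro conjI ballI)
      fix w assume w: "w \<in> I"
      show "\<exists>!f. is_decomposition UNIV (\<lambda>t. I \<inter> ?G' t) w f"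
      proof (rule ex1I[of _ "\<lambda>t. \<pi> (A.hc t (\<kappa> w))"])
        let ?f = "\<lambda>t. \<pi> (A.hc t (\<kappa> w))"
        have sub: "{t. ?f t \<noteq> 0} \<subseteq> {t. A.hc t (\<kappa> w) \<noteq> 0}" using pi.zero by auto
        have "(\<Sum>t | ?f t \<noteq> 0. ?f t) = (\<Sum>t | A.hc t (\<kappa> w) \<noteq> 0. ?f t)"
          by (rule sum.mono_neutral_left[OF A.finite_hc sub]) simp
        also have "\<dots> = w" by (simp add: A.hc_sum pi_kappa flip: pi.sum)
        finally have "w = (\<Sum>t | ?f t \<noteq> 0. ?f t)" by simp
        moreover have "finite {t. ?f t \<noteq> 0}" using A.finite_hc by (rule finite_subset[OF sub])
        ultimately show "is_decomposition UNIV (\<lambda>t. I \<inter> ?G' t) w ?f"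
          unfolding is_decomposition_def using I(3)[OF w] A.hc_in by simp
        fix f assume "is_decomposition UNIV (\<lambda>t. I \<inter> ?G' t) w f"
        then have "is_decomposition UNIV ?G' w f" by (simp add: is_decomposition_def)
        from hq_unique[OF this] show "f = ?f" by auto
      qed
    qed simp
    then have "graded_ideal_of sQ ?G' (B i) I"
      unfolding graded_ideal_of_def graded_subspace_def using I by blast
    then show ?thesis using assms(12)[folded idx_def, OF i] unfolding graded_simple_def by blast
  qed
  have B_nontrivial: "B i \<noteq> {0}" if i: "i \<in> idx" for i
    using assms(12)[folded idx_def, OF i] unfolding graded_simple_def by force
  \<comment> \<open>The elements of the preimage of \<open>N\<close> have powers in
    \<open>J\<close>, so this left ideal lies in \<open>J\<close> and its image is 0.\<close>
  have nil_zero: "N = {0}" if N: "left_ideal sQ N" "\<And>x. x \<in> N \<Longrightarrow> \<exists>l. pw x l = 0" for N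
  proof -
    have sN: "QQ.subspace N" and lN: "\<And>a x. x \<in> N \<Longrightarrow> a * x \<in> N"
      using N(1) by (simp_all add: left_ideal_def)
    have "left_ideal sA (\<pi> -` N)"
      unfolding left_ideal_def using pi.subspace_vimage[OF sN] lN by (simp add: pi_mult)
    moreover have "\<exists>l. pw x l \<in> A.J" if "x \<in> \<pi> -` N" for x
      using N(2)[of "\<pi> x"] that by (simp flip: pi_ker add: pi_pw)
    ultimately have "\<pi> -` N \<subseteq> A.J" by (rule A.nil_left_ideal_subset_J)
    then have "N \<subseteq> {0}" using pi_kappa pi_ker by (metis insertI1 subsetD subsetI vimageI2)
    then show ?thesis using QQ.subspace_0[OF sN] by blast
  qed
  have fdQ: "finite_dimensional_vector_space sQ BQ"
    using finBQ indBQ spanBQ QQ.vector_space_axioms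
    by (intro finite_dimensional_vector_space.intro finite_dimensional_vector_space_axioms.intro)
  have Q0: "fd_algebra0 sQ BQ"
    by (intro fd_algebra0.intro fd_algebra.intro fd_algebra0_axioms.intro assms(6) fdQ) (rule nil_zero)
  interpret S: codim_setup sA BA G sQ BQ idx bas \<pi> \<kappa> B
  proof (intro codim_setup.intro codim_setup_axioms.intro)
    show "graded_algebra sA BA G" ..
    show "fd_algebra0 sQ BQ" by (rule Q0)
    show "Vector_Spaces.linear sA sQ \<pi>" "Vector_Spaces.linear sQ sA \<kappa>" ..
    show "finite idx" "idx \<noteq> {}" by (rule finite_idx idx_ne)+
    show "BQ = (\<Union>i\<in>idx. bas i)" by (rule BQ_def)
  qed (fact J_right J_hc pi_mult pi_ker kappa_mult pi_kappa bas_disjoint bas(3) ideal(2,3) B_disjoint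
        B_simple B_nontrivial)+
  have dimB: "QQ.dim (QQ.span (\<Union>i\<in>set is. B i)) = card (\<Union>i\<in>set is. bas i)" if "set is \<subseteq> idx" for "is"
  proof -
    let ?D = "\<Union>i\<in>set is. bas i"
    have "?D \<subseteq> BQ" using that by (auto simp: BQ_def)
    then have ind: "QQ.independent ?D" using indBQ by (rule QQ.independent_mono[rotated])
    have "B i \<subseteq> QQ.span ?D" if "i \<in> set is" for i
    proof -
      have "QQ.span (bas i) \<subseteq> QQ.span ?D" using that by (intro QQ.span_mono) blast
      then show ?thesis using bas(3) that \<open>set is \<subseteq> idx\<close> by blast
    qed
    then have "QQ.span (\<Union>i\<in>set is. B i) \<subseteq> QQ.span ?D"
      by (intro QQ.span_minimal QQ.subspace_span) blast
    moreover have "QQ.span ?D \<subseteq> QQ.span (\<Union>i\<in>set is. B i)"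
      using bas(1) that by (intro QQ.span_mono) blast
    ultimately have "QQ.span (\<Union>i\<in>set is. B i) = QQ.span ?D" by (rule equalityI)
    then show ?thesis using QQ.dim_span_eq_card_independent[OF ind] by (simp only:)
  qed
  define adm where "adm = (\<lambda>is. is \<noteq> [] \<and> distinct is \<and> set is \<subseteq> idx \<and> S.chain is \<noteq> {0})"
  define M where "M = {card (\<Union>i\<in>set is. bas i) | is. adm is}"
  have "graded_exponent sA sQ G \<kappa> q B = Max M"
  proof -
    have eq: "is \<noteq> [] \<and> distinct is \<and> set is \<subseteq> idx \<and>
        chain_prod sA (map (\<lambda>i. dual_span sA G (\<kappa> ` B i)) is) \<noteq> {0} \<longleftrightarrow> adm is" for "is"
      by (simp only: adm_def S.dual_span_eq_W)
    have "{QQ.dim (QQ.span (\<Union>i\<in>set is. B i)) | is. adm is} = M"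
      unfolding M_def using dimB by (metis (no_types, lifting) adm_def)
    then show ?thesis unfolding graded_exponent_def idx_def[symmetric] eq by simp
  qed
  moreover have finM: "finite M"
  proof -
    have "M \<subseteq> (\<lambda>is. card (\<Union>i\<in>set is. bas i)) ` {is. set is \<subseteq> idx \<and> distinct is}"
      unfolding M_def adm_def by blast
    then show ?thesis by (rule finite_subset) (simp add: finite_subset_distinct finite_idx)
  qed
  \<comment> \<open>Lists of one element make the maximum range over a nonempty set, and force it to
    be at least 1.\<close>
  moreover have single: "adm [i]" if i: "i \<in> idx" for i
  proof -
    obtain b where b: "b \<in> B i" "b \<noteq> 0"
      using B_nontrivial[OF i] QQ.subspace_0[OF ideal(1)[OF i]] by blast
    have "\<kappa> b \<noteq> 0" using pi_kappa[of b] b(2) pi.zero by auto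
    then have "S.chain [i] \<noteq> {0}" using S.W_kappa[OF b(1)] by auto
    then show ?thesis using i by (simp add: adm_def)
  qed
  obtain i0 where i0: "i0 \<in> idx" using idx_ne by blast
  have "M \<noteq> {}" using single[OF i0] unfolding M_def by blast
  then have "Max M \<in> M" using finM by (intro Max_in)
  then obtain js where js: "adm js" "card (\<Union>i\<in>set js. bas i) = Max M" unfolding M_def by auto
  have le: "card (\<Union>i\<in>set is. bas i) \<le> Max M" if "adm is" for "is"
    using that by (intro Max_ge[OF finM]) (auto simp: M_def)
  have "1 \<le> Max M"
  proof -
    have "bas i0 \<noteq> {}" using bas(3)[OF i0] B_nontrivial[OF i0] by auto
    then have "1 \<le> card (bas i0)" using bas(4)[OF i0] by (simp add: Suc_le_eq card_gt_0_iff)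
    then show ?thesis using le[OF single[OF i0]] by simp
  qed
  moreover have "js \<noteq> []" "distinct js" "set js \<subseteq> idx" "S.chain js \<noteq> {0}"
    using js(1) by (simp_all add: adm_def)
  moreover have "card (\<Union>i\<in>set is. bas i) \<le> Max M"
    if "is \<noteq> []" "distinct is" "set is \<subseteq> idx" "S.chain is \<noteq> {0}" for "is"
    using that by (intro le) (simp add: adm_def)
  ultimately show ?thesis
    using S.codim_growth[OF assms(3), of "Max M" js] js(2) by simp
qed

end
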